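(* Let $(M,F)$ be an $n$-dimensional Finsler space with dual Cartan structure $K$, and consider on the big-tangent manifold $\mathcal{T}M$ (with $y\neq0$, $p\neq0$) the foliations $V_{\mathcal{E}_1}\oplus V_{\mathcal{E}_2}\subset V_{\mathcal{E}}\subset V$. Then the leaves of $V_{\mathcal{E}_1}\oplus V_{\mathcal{E}_2}$ are not totally umbilical submanifolds of the leaves of $V_{\mathcal{E}}$.
   Context: Let $M$ be a smooth $n$-dimensional manifold, $TM^0$ and $T^*M^0$ its tangent and cotangent bundles with the zero sections removed. A Finsler structure on $M$ is a function $F:TM\to[0,\infty)$, smooth on $TM^0$, with $F(x,\lambda y)=\lambda F(x,y)$ for $\lambda>0$, and such that $g_{ij}(x,y)=\frac12\frac{\partial^2F^2}{\partial y^i\partial y^j}$ is positive definite on $TM^0$; $(M,F)$ is called a Finsler space. The dual Cartan structure $K:T^*M\to[0,\infty)$ is obtained from $F$ by Legendre transformation: $K(x,p)=F(x,y)$ whenever $p_i=g_{ij}(x,y)y^j$, $y\ne0$, and $K(x,0)=0$. It is smooth on $T^*M^0$, satisfies $K(x,\lambda p)=\lambda K(x,p)$ for $\lambda>0$, and $g^{*ij}(x,p)=\frac12\frac{\partial^2K^2}{\partial p_i\partial p_j}$ is positive definite on $T^*M^0$. The big-tangent manifold $\mathcal{T}M$ is the total space of $TM\oplus T^*M\to M$, a $3n$-dimensional manifold with local coordinates $(x^i,y^i,p_i)$, where $(x^i)$ are coordinates on $M$, $(y^i)$ vector coordinates and $(p_i)$ covector coordinates; we work on its open subset where $y\ne 0$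 and $p\neq 0$. The vertical bundle $V$ (the kernel of the differential of the projection to $M$) decomposes as $V=V_1\oplus V_2$, where $V_1$, $V_2$ have local frames $\{\frac{\partial}{\partial y^i}\}$, $\{\frac{\partial}{\partial p_i}\}$, respectively. The metric $G$ on $V$ is $G(X,Y)=g_{ij}(x,y)X_1^iY_1^j+g^{*ij}(x,p)X^2_iY^2_j$ for $X=X_1^i\frac{\partial}{\partial y^i}+X^2_i\frac{\partial}{\partial p_i}$, $Y=Y_1^j\frac{\partial}{\partial y^j}+Y^2_j\frac{\partial}{\partial p_j}$ in $\Gamma(V)$; it restricts to a Riemannian metric on every leaf of $V$ and its submanifolds. The Liouville vector fields are $\mathcal{E}_1=y^i\frac{\partial}{\partial y^i}$, $\mathcal{E}_2=p_i\frac{\partial}{\partial p_i}$, $\mathcal{E}=\mathcal{E}_1+\mathcal{E}_2$. Let $V_{\mathcal{E}_1}$ (resp. $V_{\mathcal{E}_2}$, $V_{\mathcal{E}}$) be the $G$-orthogonal complement of the line distribution spanned by $\mathcal{E}_1$ in $V_1$ (resp. by $\mathcal{E}_2$ in $V_2$, by $\mathcal{E}$ in $V$). The distributions $V_{\mathcal{E}_1}\oplus V_{\mathcal{E}_2}$ and $V_{\mathcal{E}}$ are integrable and $V_{\mathcal{E}_1}\oplus V_{\mathcal{E}_2}\subset V_{\mathcal{E}}$ has corank one. A leaf $L'$ of $V_{\mathcal{E}_1}\oplus V_{\mathcal{E}_2}$ is thus a hypersurface of the leaf of $V_{\mathcal{E}}$ containing it, with unit normal $N=\frac{1}{FK\sqrt{F^2+K^2}}(K^2\mathcal{E}_1-F^2\mathcal{E}_2)$;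 its second fundamental form there is $B'(X',Y')=G(\nabla_{X'}Y',N)$ for $X',Y'\in\Gamma(TL')$, with $\nabla$ the Levi-Civita connection of the leaf of $V$ containing it (with metric induced by $G$), and it is totally umbilical if $B'=\lambda\,G$ on $TL'$ for some function $\lambda$.
   Formalization: The dimension n is assumed to be at least 2; for n = 1 the leaves of V_{E1}⊕V_{E2} are single points, hence vacuously totally umbilical, and the claim fails. *)

theory Defs
  imports "HOL-Analysis.Analysis"
begin

section \<open>Smooth maps and smooth manifolds\<close>

text \<open>\<open>Ck k S f\<close>: the map \<open>f\<close> is \<open>k\<close> times continuously differentiable on the open set \<open>S\<close>
  (the domain is finite-dimensional in all uses, so directional derivatives suffice).\<close>

primrec Ck :: "nat \<Rightarrow> 'a::euclidean_space set \<Rightarrow> ('a \<Rightarrow> 'b::real_normed_vector) \<Rightarrow> bool" where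
  "Ck 0 S f \<longleftrightarrow> continuous_on S f"
| "Ck (Suc k) S f \<longleftrightarrow> (\<forall>x\<in>S. f differentiable (at x)) \<and>
     (\<forall>v. Ck k S (\<lambda>x. frechet_derivative f (at x) v))"

definition smooth_on :: "'a::euclidean_space set \<Rightarrow> ('a \<Rightarrow> 'b::real_normed_vector) \<Rightarrow> bool" where
  "smooth_on S f \<longleftrightarrow> (\<forall>k. Ck k S f)"

text \<open>A chart is a pair of its domain and its coordinate map; the values of the coordinate map
  outside the domain are irrelevant.\<close>

type_synonym ('a, 'e) chart = "'a set \<times> ('a \<Rightarrow> 'e)"

definition chart_inv :: "('a, 'e) chart \<Rightarrow> 'e \<Rightarrow> 'a" where
  "chart_inv c = inv_into (fst c) (snd c)"

definition transition :: "('a, 'e) chart \<Rightarrow> ('a, 'f) chart \<Rightarrow> 'e \<Rightarrow> 'f" where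
  "transition c c' = snd c' \<circ> chart_inv c"

definition smooth_atlas :: "('a, 'e::euclidean_space) chart set \<Rightarrow> bool" where
  "smooth_atlas A \<longleftrightarrow>
     (\<forall>c\<in>A. inj_on (snd c) (fst c) \<and> open (snd c ` fst c)) \<and>
     (\<forall>c\<in>A. \<forall>c'\<in>A. open (snd c ` (fst c \<inter> fst c')) \<and>
        smooth_on (snd c ` (fst c \<inter> fst c')) (transition c c'))"

definition points :: "('a, 'e) chart set \<Rightarrow> 'a set" where
  "points A = \<Union> (fst ` A)"

definition manifold_topology :: "('a, 'e::euclidean_space) chart set \<Rightarrow> 'a topology" where
  "manifold_topology A =
     topology (\<lambda>W. W \<subseteq> points A \<and> (\<forall>c\<in>A. open (snd c ` (W \<inter> fst c))))"

definition smooth_manifold :: "('a, 'e::euclidean_space) chart set \<Rightarrow> bool" where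
  "smooth_manifold A \<longleftrightarrow> smooth_atlas A \<and>
     Hausdorff_space (manifold_topology A) \<and> second_countable (manifold_topology A)"

definition smooth_fun :: "('a, 'e::euclidean_space) chart set \<Rightarrow> 'a set \<Rightarrow> ('a \<Rightarrow> real) \<Rightarrow> bool" where
  "smooth_fun A W f \<longleftrightarrow> (\<forall>c\<in>A. smooth_on (snd c ` (W \<inter> fst c)) (f \<circ> chart_inv c))"


section \<open>Tangent and cotangent vectors\<close>

text \<open>A tangent vector at \<open>x\<close> is the family of its coordinate vectors in the charts around \<open>x\<close>,
  which transform by the Jacobians of the coordinate changes; a covector transforms
  contragrediently, \<open>p_i = (\<partial>x'^j/\<partial>x^i) p'_j\<close>. The families are \<open>0\<close> at all other
  indices.\<close>

type_synonym ('a, 'e) tvec = "('a, 'e) chart \<Rightarrow> 'e"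

definition tangent_space :: "('a, 'e::euclidean_space) chart set \<Rightarrow> 'a \<Rightarrow> ('a, 'e) tvec set" where
  "tangent_space A x = {v.
     (\<forall>c\<in>A. \<forall>c'\<in>A. x \<in> fst c \<longrightarrow> x \<in> fst c' \<longrightarrow>
        v c' = frechet_derivative (transition c c') (at (snd c x)) (v c)) \<and>
     (\<forall>c. \<not> (c \<in> A \<and> x \<in> fst c) \<longrightarrow> v c = 0)}"

definition cotangent_space :: "('a, 'e::euclidean_space) chart set \<Rightarrow> 'a \<Rightarrow> ('a, 'e) tvec set" where
  "cotangent_space A x = {p.
     (\<forall>c\<in>A. \<forall>c'\<in>A. x \<in> fst c \<longrightarrow> x \<in> fst c' \<longrightarrow>
        (\<forall>a. p c \<bullet> a = p c' \<bullet> frechet_derivative (transition c c') (at (snd c x)) a)) \<and>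
     (\<forall>c. \<not> (c \<in> A \<and> x \<in> fst c) \<longrightarrow> p c = 0)}"

definition vec_zero :: "('a, 'e::zero) tvec" where
  "vec_zero = (\<lambda>c. 0)"

definition vec_add :: "('a, 'e::plus) tvec \<Rightarrow> ('a, 'e) tvec \<Rightarrow> ('a, 'e) tvec" where
  "vec_add v w = (\<lambda>c. v c + w c)"

definition vec_scale :: "real \<Rightarrow> ('a, 'e::real_vector) tvec \<Rightarrow> ('a, 'e) tvec" where
  "vec_scale r v = (\<lambda>c. r *\<^sub>R v c)"

text \<open>The (co)tangent vector at \<open>x\<close> with coordinates \<open>a\<close> in the chart \<open>c\<close>.\<close>

definition vec_of :: "('a, 'e::euclidean_space) chart set \<Rightarrow> 'a \<Rightarrow> ('a, 'e) chart \<Rightarrow> 'e \<Rightarrow> ('a, 'e) tvec" where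
  "vec_of A x c a = (\<lambda>c'. if c' \<in> A \<and> x \<in> fst c'
     then frechet_derivative (transition c c') (at (snd c x)) a else 0)"

definition covec_of :: "('a, 'e::euclidean_space) chart set \<Rightarrow> 'a \<Rightarrow> ('a, 'e) chart \<Rightarrow> 'e \<Rightarrow> ('a, 'e) tvec" where
  "covec_of A x c a = (\<lambda>c'. if c' \<in> A \<and> x \<in> fst c'
     then adjoint (frechet_derivative (transition c' c) (at (snd c' x))) a else 0)"

definition tangent_atlas :: "('a, 'e::euclidean_space) chart set \<Rightarrow> ('a \<times> ('a, 'e) tvec, 'e \<times> 'e) chart set" where
  "tangent_atlas A = (\<lambda>c. ({(x, v). x \<in> fst c \<and> v \<in> tangent_space A x},
                             \<lambda>(x, v). (snd c x, v c))) ` A"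

definition tangent_bundle :: "('a, 'e::euclidean_space) chart set \<Rightarrow> ('a \<times> ('a, 'e) tvec) set" where
  "tangent_bundle A = {(x, v). x \<in> points A \<and> v \<in> tangent_space A x}"

definition tangent_bundle0 :: "('a, 'e::euclidean_space) chart set \<Rightarrow> ('a \<times> ('a, 'e) tvec) set" where
  "tangent_bundle0 A = {(x, v) \<in> tangent_bundle A. v \<noteq> vec_zero}"

definition cotangent_bundle :: "('a, 'e::euclidean_space) chart set \<Rightarrow> ('a \<times> ('a, 'e) tvec) set" where
  "cotangent_bundle A = {(x, p). x \<in> points A \<and> p \<in> cotangent_space A x}"


section \<open>Finsler structure and dual Cartan structure\<close>

definition partial :: "'n::finite \<Rightarrow> (real ^ 'n \<Rightarrow> real) \<Rightarrow> real ^ 'n \<Rightarrow> real" where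
  "partial i f u = frechet_derivative f (at u) (axis i 1)"

text \<open>\<open>g\<^sub>i\<^sub>j(x,y)\<close> and \<open>g\<^sup>*\<^sup>i\<^sup>j(x,p)\<close> in the chart \<open>c\<close>.\<close>

definition finsler_g ::
  "('m, real ^ 'n) chart set \<Rightarrow> ('m \<times> ('m, real ^ 'n) tvec \<Rightarrow> real) \<Rightarrow> ('m, real ^ 'n) chart \<Rightarrow>
   'm \<Rightarrow> ('m, real ^ 'n) tvec \<Rightarrow> 'n \<Rightarrow> 'n \<Rightarrow> real" where
  "finsler_g A F c x y i j =
     (1/2) * partial i (partial j (\<lambda>v. (F (x, vec_of A x c v))\<^sup>2)) (y c)"

definition cartan_g ::
  "('m, real ^ 'n) chart set \<Rightarrow> ('m \<times> ('m, real ^ 'n) tvec \<Rightarrow> real) \<Rightarrow> ('m, real ^ 'n) chart \<Rightarrow>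
   'm \<Rightarrow> ('m, real ^ 'n) tvec \<Rightarrow> 'n \<Rightarrow> 'n \<Rightarrow> real" where
  "cartan_g A K c x p i j =
     (1/2) * partial i (partial j (\<lambda>q. (K (x, covec_of A x c q))\<^sup>2)) (p c)"

definition finsler_structure ::
  "('m, real ^ 'n) chart set \<Rightarrow> ('m \<times> ('m, real ^ 'n) tvec \<Rightarrow> real) \<Rightarrow> bool" where
  "finsler_structure A F \<longleftrightarrow>
     (\<forall>z\<in>tangent_bundle A. F z \<ge> 0) \<and>
     smooth_fun (tangent_atlas A) (tangent_bundle0 A) F \<and>
     (\<forall>(x, y)\<in>tangent_bundle A. \<forall>r>0. F (x, vec_scale r y) = r * F (x, y)) \<and>
     (\<forall>(x, y)\<in>tangent_bundle0 A. \<forall>c\<in>A. x \<in> fst c \<longrightarrow>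
        (\<forall>a. a \<noteq> 0 \<longrightarrow> (\<Sum>i\<in>UNIV. \<Sum>j\<in>UNIV. finsler_g A F c x y i j * a $ i * a $ j) > 0))"

text \<open>Since the Legendre map \<open>y \<mapsto> g\<^sub>i\<^sub>j(x,y) y\<^sup>j\<close> is a bijection from the nonzero tangent
  vectors to the nonzero covectors, these clauses determine \<open>K\<close> on the whole cotangent bundle.
  Smoothness and homogeneity of \<open>K\<close> and positive definiteness of \<open>g\<^sup>*\<close> are
  consequences.\<close>

definition dual_cartan_structure ::
  "('m, real ^ 'n) chart set \<Rightarrow> ('m \<times> ('m, real ^ 'n) tvec \<Rightarrow> real) \<Rightarrow>
   ('m \<times> ('m, real ^ 'n) tvec \<Rightarrow> real) \<Rightarrow> bool" where
  "dual_cartan_structure A F K \<longleftrightarrow>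
     (\<forall>z\<in>cotangent_bundle A. K z \<ge> 0) \<and>
     (\<forall>x\<in>points A. K (x, vec_zero) = 0) \<and>
     (\<forall>c\<in>A. \<forall>x\<in>fst c. \<forall>y\<in>tangent_space A x. \<forall>p\<in>cotangent_space A x.
        y \<noteq> vec_zero \<longrightarrow> (\<forall>i. p c $ i = (\<Sum>j\<in>UNIV. finsler_g A F c x y i j * y c $ j)) \<longrightarrow>
        K (x, p) = F (x, y))"


section \<open>The big-tangent manifold and its vertical bundle\<close>

type_synonym ('m, 'n) bt_point =
  "'m \<times> ('m, real ^ 'n) tvec \<times> ('m, real ^ 'n) tvec"

type_synonym 'n bt_coords = "(real ^ 'n) \<times> (real ^ 'n) \<times> (real ^ 'n)"

type_synonym ('m, 'n) bt_chart = "(('m, 'n) bt_point, 'n bt_coords) chart"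

type_synonym ('m, 'n) bt_vec = "(('m, 'n) bt_point, 'n bt_coords) tvec"

type_synonym ('m, 'n) bt_field = "('m, 'n) bt_point \<Rightarrow> ('m, 'n) bt_vec"

text \<open>The coordinates \<open>(x\<^sup>i, y\<^sup>i, p\<^sub>i)\<close>, on the open subset where \<open>y \<noteq> 0\<close> and \<open>p \<noteq> 0\<close>.\<close>

definition bt_chart :: "('m, real ^ 'n) chart set \<Rightarrow> ('m, real ^ 'n) chart \<Rightarrow> ('m, 'n) bt_chart" where
  "bt_chart A c =
     ({(x, y, p). x \<in> fst c \<and> y \<in> tangent_space A x \<and> y \<noteq> vec_zero \<and>
                  p \<in> cotangent_space A x \<and> p \<noteq> vec_zero},
      \<lambda>(x, y, p). (snd c x, y c, p c))"

definition bt_atlas :: "('m, real ^ 'n) chart set \<Rightarrow> ('m, 'n) bt_chart set" where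
  "bt_atlas A = bt_chart A ` A"

text \<open>In the coordinates \<open>(x\<^sup>i, y\<^sup>i, p\<^sub>i)\<close> the differential of the projection to the base is the
  projection to the first component. The first, second and third component of \<open>X \<kappa>\<close> are the
  coefficients of \<open>\<partial>/\<partial>x\<^sup>i\<close>, \<open>\<partial>/\<partial>y\<^sup>i\<close> and \<open>\<partial>/\<partial>p\<^sub>i\<close> in the coordinate frame of \<open>\<kappa>\<close>.\<close>

definition vert :: "('m, real ^ 'n) chart set \<Rightarrow> ('m, 'n) bt_point \<Rightarrow> ('m, 'n) bt_vec set" where
  "vert A z = {X \<in> tangent_space (bt_atlas A) z.
     \<forall>\<kappa>\<in>bt_atlas A. z \<in> fst \<kappa> \<longrightarrow> fst (X \<kappa>) = 0}"

definition vert1 :: "('m, real ^ 'n) chart set \<Rightarrow> ('m, 'n) bt_point \<Rightarrow> ('m, 'n) bt_vec set" where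
  "vert1 A z = {X \<in> vert A z. \<forall>\<kappa>\<in>bt_atlas A. z \<in> fst \<kappa> \<longrightarrow> snd (snd (X \<kappa>)) = 0}"

definition vert2 :: "('m, real ^ 'n) chart set \<Rightarrow> ('m, 'n) bt_point \<Rightarrow> ('m, 'n) bt_vec set" where
  "vert2 A z = {X \<in> vert A z. \<forall>\<kappa>\<in>bt_atlas A. z \<in> fst \<kappa> \<longrightarrow> fst (snd (X \<kappa>)) = 0}"

text \<open>The value of the metric \<open>G\<close> does not depend on the chart used to compute it.\<close>

definition chart_at :: "('a, 'e) chart set \<Rightarrow> 'a \<Rightarrow> ('a, 'e) chart" where
  "chart_at A x = (SOME c. c \<in> A \<and> x \<in> fst c)"

definition vert_metric ::
  "('m, real ^ 'n) chart set \<Rightarrow> ('m \<times> ('m, real ^ 'n) tvec \<Rightarrow> real) \<Rightarrow>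
   ('m \<times> ('m, real ^ 'n) tvec \<Rightarrow> real) \<Rightarrow>
   ('m, 'n) bt_point \<Rightarrow> ('m, 'n) bt_vec \<Rightarrow> ('m, 'n) bt_vec \<Rightarrow> real" where
  "vert_metric A F K = (\<lambda>(x, y, p) X Y.
     let c = chart_at A x; \<kappa> = bt_chart A c;
         X1 = fst (snd (X \<kappa>)); X2 = snd (snd (X \<kappa>));
         Y1 = fst (snd (Y \<kappa>)); Y2 = snd (snd (Y \<kappa>))
     in (\<Sum>i\<in>UNIV. \<Sum>j\<in>UNIV. finsler_g A F c x y i j * X1 $ i * Y1 $ j) +
        (\<Sum>i\<in>UNIV. \<Sum>j\<in>UNIV. cartan_g A K c x p i j * X2 $ i * Y2 $ j))"

text \<open>The Liouville fields \<open>\<E>\<^sub>1 = y\<^sup>i \<partial>/\<partial>y\<^sup>i\<close>, \<open>\<E>\<^sub>2 = p\<^sub>i \<partial>/\<partial>p\<^sub>i\<close> and their sum: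
  \<open>snd \<kappa> z\<close> is the coordinate triple \<open>(x\<^sup>i, y\<^sup>i, p\<^sub>i)\<close> of \<open>z\<close>.\<close>

definition liouville1 :: "('m, real ^ 'n) chart set \<Rightarrow> ('m, 'n) bt_field" where
  "liouville1 A z = (\<lambda>\<kappa>. if \<kappa> \<in> bt_atlas A \<and> z \<in> fst \<kappa> then (0, fst (snd (snd \<kappa> z)), 0) else 0)"

definition liouville2 :: "('m, real ^ 'n) chart set \<Rightarrow> ('m, 'n) bt_field" where
  "liouville2 A z = (\<lambda>\<kappa>. if \<kappa> \<in> bt_atlas A \<and> z \<in> fst \<kappa> then (0, 0, snd (snd (snd \<kappa> z))) else 0)"

definition liouville :: "('m, real ^ 'n) chart set \<Rightarrow> ('m, 'n) bt_field" where
  "liouville A z = vec_add (liouville1 A z) (liouville2 A z)"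

definition vert_E1 ::
  "('m, real ^ 'n) chart set \<Rightarrow> ('m \<times> ('m, real ^ 'n) tvec \<Rightarrow> real) \<Rightarrow>
   ('m \<times> ('m, real ^ 'n) tvec \<Rightarrow> real) \<Rightarrow> ('m, 'n) bt_point \<Rightarrow> ('m, 'n) bt_vec set" where
  "vert_E1 A F K z = {X \<in> vert1 A z. vert_metric A F K z X (liouville1 A z) = 0}"

definition vert_E2 ::
  "('m, real ^ 'n) chart set \<Rightarrow> ('m \<times> ('m, real ^ 'n) tvec \<Rightarrow> real) \<Rightarrow>
   ('m \<times> ('m, real ^ 'n) tvec \<Rightarrow> real) \<Rightarrow> ('m, 'n) bt_point \<Rightarrow> ('m, 'n) bt_vec set" where
  "vert_E2 A F K z = {X \<in> vert2 A z. vert_metric A F K z X (liouville2 A z) = 0}"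

definition vert_E ::
  "('m, real ^ 'n) chart set \<Rightarrow> ('m \<times> ('m, real ^ 'n) tvec \<Rightarrow> real) \<Rightarrow>
   ('m \<times> ('m, real ^ 'n) tvec \<Rightarrow> real) \<Rightarrow> ('m, 'n) bt_point \<Rightarrow> ('m, 'n) bt_vec set" where
  "vert_E A F K z = {X \<in> vert A z. vert_metric A F K z X (liouville A z) = 0}"

definition vert_E1_E2 ::
  "('m, real ^ 'n) chart set \<Rightarrow> ('m \<times> ('m, real ^ 'n) tvec \<Rightarrow> real) \<Rightarrow>
   ('m \<times> ('m, real ^ 'n) tvec \<Rightarrow> real) \<Rightarrow> ('m, 'n) bt_point \<Rightarrow> ('m, 'n) bt_vec set" where
  "vert_E1_E2 A F K z = {vec_add X Y |X Y. X \<in> vert_E1 A F K z \<and> Y \<in> vert_E2 A F K z}"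


section \<open>Leaves of a distribution\<close>

definition compatible_chart :: "('a, 'e::euclidean_space) chart set \<Rightarrow> ('a, 'e) chart \<Rightarrow> bool" where
  "compatible_chart A \<phi> \<longleftrightarrow> fst \<phi> \<subseteq> points A \<and> smooth_atlas (insert \<phi> A)"

text \<open>\<open>integral_manifold A D T\<close>: the set \<open>topspace T\<close>, with the topology \<open>T\<close>, is an immersed
  submanifold whose tangent space at every point \<open>w\<close> is \<open>D w\<close>. Around each of its points some
  \<open>T\<close>-open piece \<open>W\<close> is embedded: it carries the ambient topology and is a slice, parallel to
  the linear subspace \<open>E\<close>, of a compatible chart \<open>\<phi>\<close> of the ambient manifold. The topology \<open>T\<close>
  may be finer than the ambient one.\<close>

definition integral_manifold ::
  "('a, 'e::euclidean_space) chart set \<Rightarrow> ('a \<Rightarrow> ('a, 'e) tvec set) \<Rightarrow> 'a topology \<Rightarrow> bool" where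
  "integral_manifold A D T \<longleftrightarrow> topspace T \<subseteq> points A \<and>
     (\<forall>z\<in>topspace T. \<exists>\<phi> E W.
        compatible_chart A \<phi> \<and> subspace E \<and> openin T W \<and> z \<in> W \<and> W \<subseteq> fst \<phi> \<and>
        subtopology T W = subtopology (manifold_topology A) W \<and>
        snd \<phi> ` W = {e \<in> snd \<phi> ` fst \<phi>. e - snd \<phi> z \<in> E} \<and>
        (\<forall>w\<in>W. D w = {X \<in> tangent_space A w. \<forall>c\<in>A. w \<in> fst c \<longrightarrow>
           frechet_derivative (transition c \<phi>) (at (snd c w)) (X c) \<in> E}))"

definition leaf_of ::
  "('a, 'e::euclidean_space) chart set \<Rightarrow> ('a \<Rightarrow> ('a, 'e) tvec set) \<Rightarrow> 'a set \<Rightarrow> bool" where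
  "leaf_of A D S \<longleftrightarrow> S \<noteq> {} \<and>
     (\<exists>T. topspace T = S \<and> integral_manifold A D T \<and> connected_space T) \<and>
     (\<forall>T'. integral_manifold A D T' \<and> connected_space T' \<and> S \<subseteq> topspace T' \<longrightarrow> topspace T' = S)"


section \<open>The Levi-Civita connection of a leaf of the vertical bundle\<close>

text \<open>A leaf \<open>P\<close> of the vertical bundle lies in a single fibre of the projection to the base, so
  the functions \<open>(y\<^sup>i, p\<^sub>i)\<close> of a chart \<open>\<kappa>\<close> are coordinates on \<open>P\<close>. A vector field on \<open>P\<close> is a
  map into the vertical bundle, whose coefficients in the frame \<open>\<partial>/\<partial>y\<^sup>i, \<partial>/\<partial>p\<^sub>i\<close> are functions
  of these coordinates. The values of such maps outside \<open>P\<close> are irrelevant.\<close>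

definition leaf_chart ::
  "('m, 'n::finite) bt_point set \<Rightarrow> ('m, 'n) bt_chart \<Rightarrow>
   (('m, 'n) bt_point, (real ^ 'n) \<times> (real ^ 'n)) chart" where
  "leaf_chart P \<kappa> = (P \<inter> fst \<kappa>, \<lambda>z. snd (snd \<kappa> z))"

definition leaf_coeffs ::
  "('m, 'n::finite) bt_point set \<Rightarrow> ('m, 'n) bt_chart \<Rightarrow> ('m, 'n) bt_field \<Rightarrow>
   (real ^ 'n) \<times> (real ^ 'n) \<Rightarrow> (real ^ 'n) \<times> (real ^ 'n)" where
  "leaf_coeffs P \<kappa> X u = snd (X (chart_inv (leaf_chart P \<kappa>) u) \<kappa>)"

definition leaf_fields ::
  "('m, real ^ 'n) chart set \<Rightarrow> ('m, 'n) bt_point set \<Rightarrow> ('m, 'n) bt_field set" where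
  "leaf_fields A P = {X. (\<forall>z\<in>P. X z \<in> vert A z) \<and>
     (\<forall>\<kappa>\<in>bt_atlas A. smooth_on (snd (leaf_chart P \<kappa>) ` fst (leaf_chart P \<kappa>)) (leaf_coeffs P \<kappa> X))}"

definition leaf_funs ::
  "('m, real ^ 'n) chart set \<Rightarrow> ('m, 'n) bt_point set \<Rightarrow> (('m, 'n) bt_point \<Rightarrow> real) set" where
  "leaf_funs A P = {f. smooth_fun (leaf_chart P ` bt_atlas A) P f}"

text \<open>The derivative, in the chart \<open>\<kappa>\<close>, of a map \<open>f\<close> of the leaf coordinates at \<open>z\<close> in
  direction of the field \<open>X\<close>.\<close>

definition leaf_deriv ::
  "('m, 'n::finite) bt_point set \<Rightarrow> ('m, 'n) bt_chart \<Rightarrow> ('m, 'n) bt_field \<Rightarrow>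
   ((real ^ 'n) \<times> (real ^ 'n) \<Rightarrow> 'b::real_normed_vector) \<Rightarrow> ('m, 'n) bt_point \<Rightarrow> 'b" where
  "leaf_deriv P \<kappa> X f z = frechet_derivative f (at (snd (leaf_chart P \<kappa>) z)) (snd (X z \<kappa>))"

text \<open>The first five clauses make \<open>nabla\<close> a connection; the last two
  say that its torsion vanishes, with \<open>[X,Y]\<close> written out in coordinates, and that it is
  compatible with the metric induced by \<open>G\<close>.\<close>

definition levi_civita_connection ::
  "('m, real ^ 'n) chart set \<Rightarrow> ('m \<times> ('m, real ^ 'n) tvec \<Rightarrow> real) \<Rightarrow>
   ('m \<times> ('m, real ^ 'n) tvec \<Rightarrow> real) \<Rightarrow> ('m, 'n) bt_point set \<Rightarrow>
   (('m, 'n) bt_field \<Rightarrow> ('m, 'n) bt_field \<Rightarrow> ('m, 'n) bt_field) \<Rightarrow> bool" where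
  "levi_civita_connection A F K P nabla \<longleftrightarrow>
     (\<forall>X\<in>leaf_fields A P. \<forall>Y\<in>leaf_fields A P. nabla X Y \<in> leaf_fields A P) \<and>
     (\<forall>X\<in>leaf_fields A P. \<forall>X'\<in>leaf_fields A P. \<forall>Y\<in>leaf_fields A P. \<forall>z\<in>P.
        nabla (\<lambda>w. vec_add (X w) (X' w)) Y z = vec_add (nabla X Y z) (nabla X' Y z)) \<and>
     (\<forall>f\<in>leaf_funs A P. \<forall>X\<in>leaf_fields A P. \<forall>Y\<in>leaf_fields A P. \<forall>z\<in>P.
        nabla (\<lambda>w. vec_scale (f w) (X w)) Y z = vec_scale (f z) (nabla X Y z)) \<and>
     (\<forall>X\<in>leaf_fields A P. \<forall>Y\<in>leaf_fields A P. \<forall>Y'\<in>leaf_fields A P. \<forall>z\<in>P.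
        nabla X (\<lambda>w. vec_add (Y w) (Y' w)) z = vec_add (nabla X Y z) (nabla X Y' z)) \<and>
     (\<forall>f\<in>leaf_funs A P. \<forall>X\<in>leaf_fields A P. \<forall>Y\<in>leaf_fields A P. \<forall>\<kappa>\<in>bt_atlas A. \<forall>z\<in>P \<inter> fst \<kappa>.
        nabla X (\<lambda>w. vec_scale (f w) (Y w)) z =
          vec_add (vec_scale (leaf_deriv P \<kappa> X (f \<circ> chart_inv (leaf_chart P \<kappa>)) z) (Y z))
                  (vec_scale (f z) (nabla X Y z))) \<and>
     (\<forall>X\<in>leaf_fields A P. \<forall>Y\<in>leaf_fields A P. \<forall>\<kappa>\<in>bt_atlas A. \<forall>z\<in>P \<inter> fst \<kappa>.
        snd (nabla X Y z \<kappa>) - snd (nabla Y X z \<kappa>) =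
          leaf_deriv P \<kappa> X (leaf_coeffs P \<kappa> Y) z - leaf_deriv P \<kappa> Y (leaf_coeffs P \<kappa> X) z) \<and>
     (\<forall>X\<in>leaf_fields A P. \<forall>Y\<in>leaf_fields A P. \<forall>Z\<in>leaf_fields A P. \<forall>\<kappa>\<in>bt_atlas A. \<forall>z\<in>P \<inter> fst \<kappa>.
        leaf_deriv P \<kappa> X ((\<lambda>w. vert_metric A F K w (Y w) (Z w)) \<circ> chart_inv (leaf_chart P \<kappa>)) z =
          vert_metric A F K z (nabla X Y z) (Z z) + vert_metric A F K z (Y z) (nabla X Z z))"


section \<open>Second fundamental form and total umbilicity\<close>

text \<open>The unit normal, in a leaf of \<open>vert_E\<close>, of the leaves of \<open>vert_E1_E2\<close> contained in it.\<close>

definition unit_normal ::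
  "('m, real ^ 'n) chart set \<Rightarrow> ('m \<times> ('m, real ^ 'n) tvec \<Rightarrow> real) \<Rightarrow>
   ('m \<times> ('m, real ^ 'n) tvec \<Rightarrow> real) \<Rightarrow> ('m, 'n) bt_field" where
  "unit_normal A F K = (\<lambda>(x, y, p).
     let f = F (x, y); k = K (x, p)
     in vec_scale (1 / (f * k * sqrt (f\<^sup>2 + k\<^sup>2)))
          (vec_add (vec_scale (k\<^sup>2) (liouville1 A (x, y, p)))
                   (vec_scale (- (f\<^sup>2)) (liouville2 A (x, y, p)))))"

definition second_fundamental_form ::
  "('m, real ^ 'n) chart set \<Rightarrow> ('m \<times> ('m, real ^ 'n) tvec \<Rightarrow> real) \<Rightarrow>
   ('m \<times> ('m, real ^ 'n) tvec \<Rightarrow> real) \<Rightarrow>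
   (('m, 'n) bt_field \<Rightarrow> ('m, 'n) bt_field \<Rightarrow> ('m, 'n) bt_field) \<Rightarrow>
   ('m, 'n) bt_field \<Rightarrow> ('m, 'n) bt_field \<Rightarrow> ('m, 'n) bt_point \<Rightarrow> real" where
  "second_fundamental_form A F K nabla X Y z =
     vert_metric A F K z (nabla X Y z) (unit_normal A F K z)"

text \<open>Sections of the tangent bundle of a leaf \<open>L'\<close> of \<open>vert_E1_E2\<close> are represented, as usual
  for the second fundamental form, by vector fields on the ambient leaf \<open>P\<close> of the vertical bundle
  that are tangent to \<open>L'\<close> along \<open>L'\<close>.\<close>

definition tangent_fields ::
  "('m, real ^ 'n) chart set \<Rightarrow> ('m \<times> ('m, real ^ 'n) tvec \<Rightarrow> real) \<Rightarrow>
   ('m \<times> ('m, real ^ 'n) tvec \<Rightarrow> real) \<Rightarrow> ('m, 'n) bt_point set \<Rightarrow> ('m, 'n) bt_point set \<Rightarrow>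
   ('m, 'n) bt_field set" where
  "tangent_fields A F K P L' = {X \<in> leaf_fields A P. \<forall>z\<in>L'. X z \<in> vert_E1_E2 A F K z}"

definition totally_umbilical ::
  "('m, real ^ 'n) chart set \<Rightarrow> ('m \<times> ('m, real ^ 'n) tvec \<Rightarrow> real) \<Rightarrow>
   ('m \<times> ('m, real ^ 'n) tvec \<Rightarrow> real) \<Rightarrow>
   (('m, 'n) bt_field \<Rightarrow> ('m, 'n) bt_field \<Rightarrow> ('m, 'n) bt_field) \<Rightarrow>
   ('m, 'n) bt_point set \<Rightarrow> ('m, 'n) bt_point set \<Rightarrow> bool" where
  "totally_umbilical A F K nabla P L' \<longleftrightarrow>
     (\<exists>lam. \<forall>X\<in>tangent_fields A F K P L'. \<forall>Y\<in>tangent_fields A F K P L'. \<forall>z\<in>L'.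
        second_fundamental_form A F K nabla X Y z = lam z * vert_metric A F K z (X z) (Y z))"

end

theory Submission
  imports Defs
begin

text \<open>
  On a fibre of the projection to the base, \<open>G\<close> is a product of two metrics, one in \<open>y\<close> and one in
  \<open>p\<close>, each the Hessian of a function that is homogeneous of degree 2. Let \<open>X\<close> be a field in
  \<open>V\<^sub>1\<close> that is orthogonal to \<open>\<E>\<^sub>1\<close>, depends only on \<open>y\<close> and is invariant under rescaling of \<open>y\<close>.
  Then \<open>[X, \<E>\<^sub>1] = X\<close> and \<open>[X, \<E>\<^sub>2] = 0\<close>, while \<open>G(X, X)\<close> does not change along \<open>\<E>\<^sub>1\<close> and
  \<open>\<E>\<^sub>2\<close>. Metric compatibility and vanishing torsion turn this into
  \<open>G(\<nabla>\<^sub>X X, \<E>\<^sub>1) = - G(X, X)\<close> and \<open>G(\<nabla>\<^sub>X X, \<E>\<^sub>2) = 0\<close> (\<open>nabla_normal_part\<close>). Symmetrically for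
  fields in \<open>V\<^sub>2\<close>. With \<open>N = \<alpha> (K\<^sup>2 \<E>\<^sub>1 - F\<^sup>2 \<E>\<^sub>2)\<close> and \<open>\<alpha> > 0\<close> the second fundamental form is
  therefore \<open>- \<alpha> K\<^sup>2 G\<close> on such fields of the first kind and \<open>+ \<alpha> F\<^sup>2 G\<close> on those of the second
  (\<open>second_fundamental_form_tangential\<close>). The signs differ, so no single factor \<open>\<lambda>\<close> can serve both,
  and for \<open>n \<ge> 2\<close> both kinds occur at every point.

  Such fields have to be exhibited as smooth fields on the whole leaf \<open>P\<close> of \<open>V\<close>, and this takes two
  preparations.

  First, \<open>P\<close> must be identified. The base point is locally constant on an integral manifold of \<open>V\<close>, so
  a connected one lies in a fibre. The fibre with \<open>y \<noteq> 0\<close> and \<open>p \<noteq> 0\<close> is itself a connected integral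
  manifold, as \<open>n \<ge> 2\<close>, hence \<open>P\<close> is all of it by maximality (\<open>vert_leaf\<close>).

  Second, \<open>K\<close> is only characterised through the Legendre map, and its smoothness and convexity must be
  proved. On one tangent space, \<open>F\<close> is a Minkowski norm. Its Legendre map is a diffeomorphism of the
  punctured spaces: injective by monotonicity, surjective because its image is open and closed, smooth
  in both directions because the derivative is the positive definite fundamental tensor. Hence the
  dual is again a Minkowski norm (\<open>legendre_dual\<close>), and everything proved for \<open>F\<close> applies to \<open>K\<close>.
\<close>

section \<open>Calculus of continuously differentiable maps\<close>

lemma Ck_eq_on_open:
  assumes "open S" "Ck k S f" "\<And>x. x \<in> S \<Longrightarrow> f x = g x"
  shows "Ck k S g"
  using assms(2,3)
proof (induction k arbitrary: f g)
  case 0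
  then show ?case by (simp cong: continuous_on_cong)
next
  case (Suc k)
  have diff: "g differentiable at x" and eq: "frechet_derivative f (at x) = frechet_derivative g (at x)"
    if x: "x \<in> S" for x
  proof -
    have d: "f differentiable at x" using Suc.prems(1) x by simp
    show "g differentiable at x"
      using d \<open>open S\<close> x Suc.prems(2) has_derivative_transform_within_open
      unfolding differentiable_def by metis
    show "frechet_derivative f (at x) = frechet_derivative g (at x)"
      by (rule frechet_derivative_transform_within_open[OF d \<open>open S\<close> x Suc.prems(2)])
  qed
  have "Ck k S (\<lambda>x. frechet_derivative g (at x) v)" for v
    using Suc.IH[of "\<lambda>x. frechet_derivative f (at x) v" "\<lambda>x. frechet_derivative g (at x) v"]
      Suc.prems(1) eq by simp
  then show ?case using diff by simp
qed

text \<open>Any formula \<open>D\<close> for the derivative may stand in for \<open>frechet_derivative\<close>; this is the step of the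
  inductions over the differentiability class below.\<close>

lemma Ck_SucI:
  assumes "open S" "\<And>x. x \<in> S \<Longrightarrow> (f has_derivative D x) (at x)" "\<And>v. Ck k S (\<lambda>x. D x v)"
  shows "Ck (Suc k) S f"
proof -
  have "Ck k S (\<lambda>x. frechet_derivative f (at x) v)" for v
    by (rule Ck_eq_on_open[OF assms(1) assms(3)[of v]]) (simp add: frechet_derivative_at[OF assms(2), symmetric])
  then show ?thesis using assms(2) by (auto simp: differentiable_def)
qed

lemma Ck_Suc_has_derivative:
  assumes "Ck (Suc k) S f" "x \<in> S"
  shows "(f has_derivative frechet_derivative f (at x)) (at x)"
  using assms frechet_derivative_works by auto

lemma Ck_Suc_imp_Ck:
  "Ck (Suc k) S f \<Longrightarrow> Ck k S f"
proof (induction k arbitrary: f)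
  case 0
  then show ?case
    by (auto intro!: continuous_at_imp_continuous_on dest: differentiable_imp_continuous_within)
next
  case (Suc k)
  then show ?case by (metis Ck.simps(2))
qed

lemma Ck_subset: "Ck k S f \<Longrightarrow> T \<subseteq> S \<Longrightarrow> Ck k T f"
  by (induction k arbitrary: f) (auto intro: continuous_on_subset)

lemma Ck_const: "Ck k S (\<lambda>x. c)"
proof (induction k arbitrary: c)
  case (Suc k)
  show ?case using Suc[of 0] by simp
qed simp

lemma Ck_bounded_linear:
  assumes "open S" "bounded_linear L"
  shows "Ck k S f \<Longrightarrow> Ck k S (\<lambda>x. L (f x))"
proof (induction k arbitrary: f)
  case 0
  then show ?case by (auto intro: bounded_linear.continuous_on[OF assms(2)])
next
  case (Suc k)
  show ?case
  proof (rule Ck_SucI[OF assms(1)])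
    show "((\<lambda>x. L (f x)) has_derivative (\<lambda>v. L (frechet_derivative f (at x) v))) (at x)" if "x \<in> S" for x
      by (rule bounded_linear.has_derivative[OF assms(2) Ck_Suc_has_derivative[OF Suc.prems that]])
    show "Ck k S (\<lambda>x. L (frechet_derivative f (at x) v))" for v
      using Suc by simp
  qed
qed

lemma Ck_linear:
  fixes L :: "'a::euclidean_space \<Rightarrow> 'b::real_normed_vector"
  assumes "bounded_linear L"
  shows "Ck k S L"
proof (cases k)
  case 0
  then show ?thesis using assms by (simp add: linear_continuous_on)
next
  case (Suc m)
  have "Ck (Suc m) UNIV L"
    by (rule Ck_SucI[where D = "\<lambda>x. L"])
      (auto intro: bounded_linear_imp_has_derivative assms Ck_const)
  then show ?thesis using Suc Ck_subset by blast
qed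

lemma Ck_add:
  assumes "open S"
  shows "Ck k S f \<Longrightarrow> Ck k S g \<Longrightarrow> Ck k S (\<lambda>x. f x + g x)"
proof (induction k arbitrary: f g)
  case 0
  then show ?case by (auto intro: continuous_on_add)
next
  case (Suc k)
  show ?case
    by (rule Ck_SucI[OF assms has_derivative_add[OF Ck_Suc_has_derivative Ck_Suc_has_derivative]])
      (use Suc in auto)
qed

lemma Ck_sum:
  assumes "open S" "\<And>i. i \<in> I \<Longrightarrow> Ck k S (f i)"
  shows "Ck k S (\<lambda>x. \<Sum>i\<in>I. f i x)"
  using assms(2) by (induction I rule: infinite_finite_induct) (auto intro: Ck_const Ck_add[OF assms(1)])

lemma Ck_bilinear:
  assumes "open S" "bounded_bilinear pr"
  shows "Ck k S f \<Longrightarrow> Ck k S g \<Longrightarrow> Ck k S (\<lambda>x. pr (f x) (g x))"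
proof (induction k arbitrary: f g)
  case 0
  then show ?case by (auto intro: bounded_bilinear.continuous_on[OF assms(2)])
next
  case (Suc k)
  show ?case
  proof (rule Ck_SucI[OF assms(1) bounded_bilinear.FDERIV[OF assms(2)
          Ck_Suc_has_derivative[OF Suc.prems(1)] Ck_Suc_has_derivative[OF Suc.prems(2)]]])
    fix v
    show "Ck k S (\<lambda>x. pr (f x) (frechet_derivative g (at x) v) + pr (frechet_derivative f (at x) v) (g x))"
      using Suc.prems Suc.prems[THEN Ck_Suc_imp_Ck] by (intro Ck_add Suc.IH assms(1)) auto
  qed
qed

lemmas Ck_mult = Ck_bilinear[OF _ bounded_bilinear_mult]
lemmas Ck_scaleR = Ck_bilinear[OF _ bounded_bilinear_scaleR]

lemma Ck_minus: "open S \<Longrightarrow> Ck k S f \<Longrightarrow> Ck k S (\<lambda>x. - f x)"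
  by (rule Ck_bounded_linear[OF _ bounded_linear_minus[OF bounded_linear_ident]])

lemma Ck_diff: "open S \<Longrightarrow> Ck k S f \<Longrightarrow> Ck k S g \<Longrightarrow> Ck k S (\<lambda>x. f x - g x)"
  using Ck_add[OF _ _ Ck_minus] by fastforce

lemma Ck_prod:
  fixes f :: "'i \<Rightarrow> 'a::euclidean_space \<Rightarrow> real"
  assumes "open S" "\<And>i. i \<in> I \<Longrightarrow> Ck k S (f i)"
  shows "Ck k S (\<lambda>x. \<Prod>i\<in>I. f i x)"
  using assms(2) by (induction I rule: infinite_finite_induct) (auto intro: Ck_const Ck_mult[OF assms(1)])

lemma Ck_inverse:
  fixes f :: "'a::euclidean_space \<Rightarrow> real"
  assumes "open S" "\<And>x. x \<in> S \<Longrightarrow> f x \<noteq> 0"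
  shows "Ck k S f \<Longrightarrow> Ck k S (\<lambda>x. inverse (f x))"
proof (induction k)
  case 0
  then show ?case using assms by (auto intro: continuous_on_inverse)
next
  case (Suc k)
  show ?case
  proof (rule Ck_SucI[OF assms(1) Deriv.has_derivative_inverse[OF assms(2) Ck_Suc_has_derivative[OF Suc.prems]]])
    show "Ck k S (\<lambda>x. - (inverse (f x) * frechet_derivative f (at x) v * inverse (f x)))" for v
      using Suc.prems Suc.IH[OF Ck_Suc_imp_Ck[OF Suc.prems]]
      by (intro Ck_minus Ck_mult assms(1)) auto
  qed
qed

lemma Ck_divide:
  fixes f g :: "'a::euclidean_space \<Rightarrow> real"
  assumes "open S" "\<And>x. x \<in> S \<Longrightarrow> g x \<noteq> 0" "Ck k S f" "Ck k S g"
  shows "Ck k S (\<lambda>x. f x / g x)"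
  unfolding divide_inverse using assms by (intro Ck_mult Ck_inverse)

text \<open>Expanding the inner derivative in the basis turns the chain rule into a sum of products of maps
  to which the induction hypothesis applies.\<close>

lemma Ck_compose:
  fixes f :: "'a::euclidean_space \<Rightarrow> 'b::euclidean_space"
  assumes "open S" "open T" "f ` S \<subseteq> T"
  shows "Ck k S f \<Longrightarrow> Ck k T g \<Longrightarrow> Ck k S (\<lambda>x. g (f x))"
proof (induction k arbitrary: g)
  case 0
  then show ?case using assms(3) by (auto intro: continuous_on_compose2)
next
  case (Suc k)
  define D where "D x v = (\<Sum>b\<in>Basis. (frechet_derivative f (at x) v \<bullet> b) *\<^sub>R frechet_derivative g (at (f x)) b)"
    for x v
  show ?case
  proof (rule Ck_SucI[OF assms(1)])
    fix x assume x: "x \<in> S"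
    have g: "(g has_derivative frechet_derivative g (at (f x))) (at (f x))"
      using Ck_Suc_has_derivative[OF Suc.prems(2)] x assms(3) by auto
    have "D x v = frechet_derivative g (at (f x)) (frechet_derivative f (at x) v)" for v
      unfolding D_def using has_derivative_linear[OF g]
      by (subst (2) euclidean_representation[symmetric]) (simp only: linear_sum linear_scale o_def)
    then have "D x = (\<lambda>v. frechet_derivative g (at (f x)) (frechet_derivative f (at x) v))"
      by blast
    then show "((\<lambda>x. g (f x)) has_derivative D x) (at x)"
      using has_derivative_compose[OF Ck_Suc_has_derivative[OF Suc.prems(1) x] g] by simp
  next
    fix v
    have "Ck k S (\<lambda>x. frechet_derivative g (at (f x)) b)" for b
      by (rule Suc.IH[of "\<lambda>y. frechet_derivative g (at y) b"])
        (use Suc.prems Ck_Suc_imp_Ck in auto)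
    moreover have "Ck k S (\<lambda>x. frechet_derivative f (at x) v \<bullet> b)" for b
      using Suc.prems(1) by (auto intro: Ck_bounded_linear[OF assms(1) bounded_linear_inner_left])
    ultimately show "Ck k S (\<lambda>x. D x v)"
      unfolding D_def by (intro Ck_sum Ck_scaleR assms(1))
  qed
qed

lemma Ck_Pair:
  assumes "open S" "Ck k S f" "Ck k S g"
  shows "Ck k S (\<lambda>x. (f x, g x))"
proof -
  have "bounded_linear (\<lambda>a::'b. (a, 0::'c))" "bounded_linear (\<lambda>b::'c. (0::'b, b))"
    by (rule bounded_linear_Pair[OF bounded_linear_ident bounded_linear_zero]
        bounded_linear_Pair[OF bounded_linear_zero bounded_linear_ident])+
  then have "Ck k S (\<lambda>x. (f x, 0) + (0, g x))"
    using Ck_add[OF assms(1) Ck_bounded_linear[OF assms(1) _ assms(2)] Ck_bounded_linear[OF assms(1) _ assms(3)]]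
    by blast
  then show ?thesis by simp
qed

lemma Ck_vec_nth:
  assumes "open S" "Ck k S f"
  shows "Ck k S (\<lambda>x. f x $ i)"
  by (rule Ck_bounded_linear[OF assms(1) bounded_linear_vec_nth assms(2)])

lemma Ck_vec_lambda:
  assumes "open S" "\<And>i. Ck k S (f i)"
  shows "Ck k S (\<lambda>x. (\<chi> i. f i x) :: real ^ 'n)"
proof -
  have "Ck k S (\<lambda>x. (\<Sum>i\<in>UNIV. f i x *\<^sub>R (axis i 1 :: real ^ 'n)))"
    using assms by (intro Ck_sum Ck_scaleR Ck_const)
  moreover have "(\<Sum>i\<in>UNIV. f i x *\<^sub>R (axis i 1 :: real ^ 'n)) = (\<chi> i. f i x)" for x
    using basis_expansion[of "\<chi> i. f i x"] by (simp add: scalar_mult_eq_scaleR)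
  ultimately show ?thesis by simp
qed

lemma Ck_det:
  fixes M :: "'a::euclidean_space \<Rightarrow> real ^ 'n ^ 'n"
  assumes "open S" "\<And>i j. Ck k S (\<lambda>x. M x $ i $ j)"
  shows "Ck k S (\<lambda>x. det (M x))"
  unfolding det_def using assms by (intro Ck_sum Ck_mult Ck_const Ck_prod)

text \<open>By Cramer's rule the solution of a linear system is a quotient of determinants, hence as smooth
  as the coefficients.\<close>

lemma Ck_linear_system:
  fixes M :: "'a::euclidean_space \<Rightarrow> real ^ 'n ^ 'n"
  assumes "open S" "\<And>i j. Ck k S (\<lambda>x. M x $ i $ j)" "\<And>x. x \<in> S \<Longrightarrow> det (M x) \<noteq> 0"
    and "\<And>x. x \<in> S \<Longrightarrow> M x *v f x = b"
  shows "Ck k S f"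
proof (rule Ck_eq_on_open[OF assms(1)])
  show "Ck k S (\<lambda>x. \<chi> l. det (\<chi> i j. if j = l then b $ i else M x $ i $ j) / det (M x))"
  proof (intro Ck_vec_lambda Ck_divide Ck_det assms)
    fix l i j show "Ck k S (\<lambda>x. (\<chi> i j. if j = l then b $ i else M x $ i $ j) $ i $ j)"
      using assms(2)[of i j] by (cases "j = l") (simp_all add: Ck_const)
  qed
  show "(\<chi> l. det (\<chi> i j. if j = l then b $ i else M x $ i $ j) / det (M x)) = f x" if "x \<in> S" for x
    using cramer[OF assms(3)[OF that], of "f x" b] assms(4)[OF that] by simp
qed

lemma smooth_on_Ck: "smooth_on S f \<Longrightarrow> Ck k S f"
  by (simp add: smooth_on_def)

lemma smooth_on_has_derivative:
  "smooth_on S f \<Longrightarrow> x \<in> S \<Longrightarrow> (f has_derivative frechet_derivative f (at x)) (at x)"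
  using smooth_on_Ck Ck_Suc_has_derivative by blast

lemma smooth_on_continuous_on: "smooth_on S f \<Longrightarrow> continuous_on S f"
  using smooth_on_Ck[of S f 0] by simp

lemma has_vector_derivative_along_line:
  assumes "(f has_derivative D) (at (x + t *\<^sub>R v))"
  shows "((\<lambda>t. f (x + t *\<^sub>R v)) has_vector_derivative D v) (at t)"
proof -
  have "((\<lambda>t. x + t *\<^sub>R v) has_derivative (\<lambda>t. t *\<^sub>R v)) (at t)"
    by (auto intro!: derivative_eq_intros)
  from has_derivative_compose[OF this, of f D] assms
  show ?thesis
    using has_derivative_linear[OF assms] by (simp add: has_vector_derivative_def linear_scale)
qed

lemma has_real_derivative_along_line:
  "(f has_derivative D) (at (x + t *\<^sub>R v)) \<Longrightarrow>
    ((\<lambda>t. f (x + t *\<^sub>R v)) has_real_derivative D v) (at t)"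
  unfolding has_real_derivative_iff_has_vector_derivative by (rule has_vector_derivative_along_line)

text \<open>A derivative that is known to exist is determined in one direction by the values on a short
  segment; all directional derivatives along the radial fields are computed in this way.\<close>

lemma derivative_eq_along_line:
  assumes "(f has_derivative D) (at x)" "\<delta> > 0"
    and "\<And>t. \<bar>t\<bar> < \<delta> \<Longrightarrow> f (x + t *\<^sub>R v) = g t"
    and "(g has_vector_derivative d) (at 0)"
  shows "D v = d"
proof -
  have "((\<lambda>t. f (x + t *\<^sub>R v)) has_vector_derivative d) (at 0)"
    by (rule has_vector_derivative_transform_within_open[OF assms(4), of "ball 0 \<delta>"])
      (use assms in auto)
  moreover have "((\<lambda>t. f (x + t *\<^sub>R v)) has_vector_derivative D v) (at 0)"
    using has_vector_derivative_along_line[of f D x 0 v] assms(1) by simp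
  ultimately show ?thesis
    using vector_derivative_unique_at by blast
qed


text \<open>Two applications of the mean value theorem, first in the direction \<open>a\<close> and then in the
  direction \<open>b\<close>, reach a mixed derivative. The second difference itself is symmetric in \<open>a\<close> and \<open>b\<close>.\<close>

lemma second_difference_mean_value:
  fixes h :: "'a::euclidean_space \<Rightarrow> real"
  assumes "Ck 2 S h" "0 < s" "\<And>\<tau> \<sigma>. \<tau> \<in> {0..s} \<Longrightarrow> \<sigma> \<in> {0..s} \<Longrightarrow> x + \<tau> *\<^sub>R a + \<sigma> *\<^sub>R b \<in> S"
  obtains \<tau> \<sigma> where "\<tau> \<in> {0..s}" "\<sigma> \<in> {0..s}"
    "h (x + s *\<^sub>R a + s *\<^sub>R b) - h (x + s *\<^sub>R a) - h (x + s *\<^sub>R b) + h x =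
     s\<^sup>2 * frechet_derivative (\<lambda>u. frechet_derivative h (at u) a) (at (x + \<tau> *\<^sub>R a + \<sigma> *\<^sub>R b)) b"
proof -
  let ?D = "\<lambda>u. frechet_derivative h (at u) a"
  have C: "Ck (Suc (Suc 0)) S h" using assms(1) by (simp add: numeral_2_eq_2)
  have h: "(h has_derivative frechet_derivative h (at u)) (at u)" if "u \<in> S" for u
    by (rule Ck_Suc_has_derivative[OF C that])
  have D: "(?D has_derivative frechet_derivative ?D (at u)) (at u)" if "u \<in> S" for u
    using Ck_Suc_has_derivative[of 0 S ?D] C that by simp
  have mem: "x + \<tau> *\<^sub>R a \<in> S" "(x + s *\<^sub>R b) + \<tau> *\<^sub>R a \<in> S" "(x + \<tau> *\<^sub>R a) + \<sigma> *\<^sub>R b \<in> S"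
    if "\<tau> \<in> {0..s}" "\<sigma> \<in> {0..s}" for \<tau> \<sigma>
    using assms(3)[of \<tau> 0] assms(3)[of \<tau> s] assms(3)[of \<tau> \<sigma>] that \<open>0 < s\<close>
    by (simp_all add: algebra_simps)
  have "((\<lambda>t. h ((x + s *\<^sub>R b) + t *\<^sub>R a) - h (x + t *\<^sub>R a)) has_real_derivative
      ?D ((x + s *\<^sub>R b) + t *\<^sub>R a) - ?D (x + t *\<^sub>R a)) (at t)" if "0 \<le> t" "t \<le> s" for t
    using that \<open>0 < s\<close>
    by (intro DERIV_diff has_real_derivative_along_line h mem[of t 0]) auto
  from MVT2[OF \<open>0 < s\<close> this] obtain \<tau> where \<tau>: "0 < \<tau>" "\<tau> < s"
    "h ((x + s *\<^sub>R b) + s *\<^sub>R a) - h (x + s *\<^sub>R a) - (h (x + s *\<^sub>R b) - h x) =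
     s * (?D ((x + s *\<^sub>R b) + \<tau> *\<^sub>R a) - ?D (x + \<tau> *\<^sub>R a))"
    by auto
  have "((\<lambda>t. ?D ((x + \<tau> *\<^sub>R a) + t *\<^sub>R b)) has_real_derivative
      frechet_derivative ?D (at ((x + \<tau> *\<^sub>R a) + t *\<^sub>R b)) b) (at t)" if "0 \<le> t" "t \<le> s" for t
    using that \<tau> by (intro has_real_derivative_along_line D mem(3)) auto
  from MVT2[OF \<open>0 < s\<close> this] obtain \<sigma> where \<sigma>: "0 < \<sigma>" "\<sigma> < s"
    "?D ((x + \<tau> *\<^sub>R a) + s *\<^sub>R b) - ?D (x + \<tau> *\<^sub>R a) =
     s * frechet_derivative ?D (at (x + \<tau> *\<^sub>R a + \<sigma> *\<^sub>R b)) b"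
    by auto
  show thesis
    by (rule that[of \<tau> \<sigma>]) (use \<tau> \<sigma> in \<open>simp_all add: power2_eq_square algebra_simps\<close>)
qed

text \<open>Schwarz's theorem. The symmetric second difference equals either mixed derivative at a point
  near \<open>x\<close>, and both are continuous.\<close>

lemma second_derivative_symmetric:
  fixes h :: "'a::euclidean_space \<Rightarrow> real"
  assumes "open S" "Ck 2 S h" "x \<in> S"
  shows "frechet_derivative (\<lambda>u. frechet_derivative h (at u) a) (at x) b =
         frechet_derivative (\<lambda>u. frechet_derivative h (at u) b) (at x) a"
    (is "?H a b x = ?H b a x")
proof (rule dense_eq0_I[of "?H a b x - ?H b a x", simplified])
  fix e :: real assume "0 < e"
  have cont: "continuous_on S (?H a b)" for a b
    using assms(2) by (simp add: numeral_2_eq_2)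
  have "\<exists>d>0. \<forall>y\<in>S. dist y x < d \<longrightarrow> dist (?H a b y) (?H a b x) < e / 2" for a b
    using cont[of a b] assms(3) \<open>0 < e\<close> unfolding continuous_on_iff by (meson half_gt_zero)
  then obtain d1 d2 where d: "d1 > 0" "d2 > 0"
    "\<And>y. y \<in> S \<Longrightarrow> dist y x < d1 \<Longrightarrow> dist (?H a b y) (?H a b x) < e / 2"
    "\<And>y. y \<in> S \<Longrightarrow> dist y x < d2 \<Longrightarrow> dist (?H b a y) (?H b a x) < e / 2"
    by metis
  obtain r where r: "r > 0" "ball x r \<subseteq> S"
    using assms(1,3) open_contains_ball by blast
  define m where "m = min r (min d1 d2)"
  have m: "m > 0" "m \<le> r" "m \<le> d1" "m \<le> d2" using r d by (auto simp: m_def)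
  \<comment> \<open>So small that the parallelogram spanned by \<open>s a\<close> and \<open>s b\<close> stays within distance \<open>m\<close> of \<open>x\<close>.\<close>
  define s where "s = m / (2 * (norm a + norm b + 1))"
  have s: "s > 0" using m by (simp add: s_def add_nonneg_pos)
  have near: "dist (x + \<tau> *\<^sub>R a + \<sigma> *\<^sub>R b) x < m" if "\<tau> \<in> {0..s}" "\<sigma> \<in> {0..s}" for \<tau> \<sigma>
  proof -
    have "dist (x + \<tau> *\<^sub>R a + \<sigma> *\<^sub>R b) x = norm (\<tau> *\<^sub>R a + \<sigma> *\<^sub>R b)"
      by (simp add: dist_norm algebra_simps)
    also have "\<dots> \<le> \<tau> * norm a + \<sigma> * norm b"
      using norm_triangle_ineq[of "\<tau> *\<^sub>R a" "\<sigma> *\<^sub>R b"] that by simp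
    also have "\<dots> \<le> s * norm a + s * norm b"
      using that by (intro add_mono mult_right_mono) auto
    also have "\<dots> < s * (2 * (norm a + norm b + 1))"
      using s by (simp add: algebra_simps add_pos_nonneg add_nonneg_pos)
    also have "\<dots> = m" unfolding s_def using norm_ge_zero[of a] norm_ge_zero[of b]
      by (simp add: field_simps add_nonneg_eq_0_iff)
    finally show ?thesis .
  qed
  have mem: "x + \<tau> *\<^sub>R a + \<sigma> *\<^sub>R b \<in> S" if "\<tau> \<in> {0..s}" "\<sigma> \<in> {0..s}" for \<tau> \<sigma>
    using near[OF that] r m by (auto simp: dist_commute subset_iff)
  obtain t1 s1 where 1: "t1 \<in> {0..s}" "s1 \<in> {0..s}"
    "h (x + s *\<^sub>R a + s *\<^sub>R b) - h (x + s *\<^sub>R a) - h (x + s *\<^sub>R b) + h x = s\<^sup>2 * ?H a b (x + t1 *\<^sub>R a + s1 *\<^sub>R b)"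
    using second_difference_mean_value[OF assms(2) s mem] by blast
  obtain t2 s2 where 2: "t2 \<in> {0..s}" "s2 \<in> {0..s}"
    "h (x + s *\<^sub>R b + s *\<^sub>R a) - h (x + s *\<^sub>R b) - h (x + s *\<^sub>R a) + h x = s\<^sup>2 * ?H b a (x + t2 *\<^sub>R b + s2 *\<^sub>R a)"
  proof (rule second_difference_mean_value[OF assms(2) s])
    show "x + \<tau> *\<^sub>R b + \<sigma> *\<^sub>R a \<in> S" if "\<tau> \<in> {0..s}" "\<sigma> \<in> {0..s}" for \<tau> \<sigma>
      using mem[OF that(2,1)] by (simp add: algebra_simps)
  qed blast
  define y z where "y = x + t1 *\<^sub>R a + s1 *\<^sub>R b" and "z = x + s2 *\<^sub>R a + t2 *\<^sub>R b"
  have "s\<^sup>2 * ?H a b y = s\<^sup>2 * ?H b a z"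
    using 1(3) 2(3) by (simp add: y_def z_def algebra_simps)
  then have eq: "?H a b y = ?H b a z" using s by simp
  have "y \<in> S" "dist y x < d1" "z \<in> S" "dist z x < d2"
    using near[OF 1(1,2)] near[OF 2(2,1)] mem[OF 1(1,2)] mem[OF 2(2,1)] m by (auto simp: y_def z_def)
  then have "dist (?H a b y) (?H a b x) < e / 2" "dist (?H b a z) (?H b a x) < e / 2"
    using d by blast+
  then show "\<bar>?H a b x - ?H b a x\<bar> \<le> e"
    using eq unfolding dist_real_def by linarith
qed


lemma open_punctured: "open (- {0 :: 'a::real_normed_vector})"
  by (rule open_Compl[OF closed_singleton])

lemma matrix_inv_right: "invertible A \<Longrightarrow> A ** matrix_inv A = mat 1"
  unfolding invertible_def matrix_inv_def by (rule someI2_ex) auto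


section \<open>Minkowski norms and their Legendre duals\<close>

definition fundamental_tensor :: "(real ^ 'n \<Rightarrow> real) \<Rightarrow> real ^ 'n \<Rightarrow> 'n \<Rightarrow> 'n \<Rightarrow> real" where
  "fundamental_tensor f v i j = (1/2) * partial i (partial j (\<lambda>v. (f v)\<^sup>2)) v"

definition fundamental_form :: "(real ^ 'n \<Rightarrow> real) \<Rightarrow> real ^ 'n \<Rightarrow> real ^ 'n \<Rightarrow> real ^ 'n \<Rightarrow> real" where
  "fundamental_form f v a b = (\<Sum>i\<in>UNIV. \<Sum>j\<in>UNIV. fundamental_tensor f v i j * a $ i * b $ j)"

definition legendre :: "(real ^ 'n \<Rightarrow> real) \<Rightarrow> real ^ 'n \<Rightarrow> real ^ 'n" where
  "legendre f v = (\<chi> i. \<Sum>j\<in>UNIV. fundamental_tensor f v i j * v $ j)"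

text \<open>The restriction of a Finsler structure to one tangent space. All conditions concern nonzero
  vectors only, since the square of a Minkowski norm is twice differentiable at the origin only if it
  is quadratic.\<close>

locale minkowski_norm =
  fixes f :: "real ^ 'n \<Rightarrow> real"
  assumes smooth: "smooth_on (- {0}) f"
    and homogeneous: "v \<noteq> 0 \<Longrightarrow> t > 0 \<Longrightarrow> f (t *\<^sub>R v) = t * f v"
    and nonneg: "v \<noteq> 0 \<Longrightarrow> f v \<ge> 0"
    and fundamental_form_pos: "v \<noteq> 0 \<Longrightarrow> a \<noteq> 0 \<Longrightarrow> fundamental_form f v a a > 0"
begin

definition energy :: "real ^ 'n \<Rightarrow> real" where
  "energy v = (f v)\<^sup>2"

definition denergy :: "real ^ 'n \<Rightarrow> real ^ 'n \<Rightarrow> real" where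
  "denergy v b = frechet_derivative energy (at v) b"

definition ddenergy :: "real ^ 'n \<Rightarrow> real ^ 'n \<Rightarrow> real ^ 'n \<Rightarrow> real" where
  "ddenergy v a b = frechet_derivative (\<lambda>u. denergy u b) (at v) a"

lemma Ck_f: "Ck k (- {0}) f"
  by (rule smooth_on_Ck[OF smooth])

lemma Ck_energy: "Ck k (- {0}) energy"
  unfolding energy_def power2_eq_square by (intro Ck_mult Ck_f) auto

lemma Ck_denergy: "Ck k (- {0}) (\<lambda>v. denergy v b)"
  using Ck_energy[of "Suc k"] by (simp add: denergy_def)

lemma Ck_ddenergy: "Ck k (- {0}) (\<lambda>v. ddenergy v a b)"
  using Ck_denergy[of "Suc k" b] by (simp add: ddenergy_def)

lemma energy_has_derivative: "v \<noteq> 0 \<Longrightarrow> (energy has_derivative denergy v) (at v)"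
  using Ck_Suc_has_derivative[OF Ck_energy] by (simp add: denergy_def[abs_def])

lemma denergy_has_derivative: "v \<noteq> 0 \<Longrightarrow> ((\<lambda>v. denergy v b) has_derivative (\<lambda>a. ddenergy v a b)) (at v)"
  using Ck_Suc_has_derivative[OF Ck_denergy] by (simp add: ddenergy_def[abs_def])

lemma linear_denergy: "v \<noteq> 0 \<Longrightarrow> linear (denergy v)"
  using energy_has_derivative has_derivative_linear by blast

lemma linear_ddenergy: "v \<noteq> 0 \<Longrightarrow> linear (\<lambda>a. ddenergy v a b)"
  using denergy_has_derivative has_derivative_linear by blast

text \<open>Symmetry of the second derivative is what makes the fundamental form a metric.\<close>

lemma ddenergy_commute: "v \<noteq> 0 \<Longrightarrow> ddenergy v a b = ddenergy v b a"
  unfolding ddenergy_def denergy_def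
  by (rule second_derivative_symmetric[OF _ Ck_energy]) auto

lemma linear_ddenergy_right: "v \<noteq> 0 \<Longrightarrow> linear (ddenergy v a)"
  using linear_ddenergy[of v a] ddenergy_commute[of v _ a] by simp

lemma fundamental_tensor_eq: "fundamental_tensor f v i j = ddenergy v (axis i 1) (axis j 1) / 2"
  by (simp add: fundamental_tensor_def partial_def[abs_def] ddenergy_def denergy_def energy_def[abs_def])

lemma fundamental_form_eq:
  assumes "v \<noteq> 0"
  shows "fundamental_form f v a b = ddenergy v a b / 2"
proof -
  have a: "a = (\<Sum>i\<in>UNIV. (a $ i) *\<^sub>R axis i 1)" for a :: "real ^ 'n"
    using basis_expansion[of a] by (simp add: scalar_mult_eq_scaleR)
  have "ddenergy v a b = (\<Sum>i\<in>UNIV. a $ i * ddenergy v (axis i 1) b)"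
    by (subst a) (simp add: linear_sum[OF linear_ddenergy[OF assms]] linear_scale[OF linear_ddenergy[OF assms]])
  also have "\<dots> = (\<Sum>i\<in>UNIV. a $ i * (\<Sum>j\<in>UNIV. b $ j * ddenergy v (axis i 1) (axis j 1)))"
    by (subst a[of b]) (simp add: linear_sum[OF linear_ddenergy_right[OF assms]]
        linear_scale[OF linear_ddenergy_right[OF assms]])
  finally show ?thesis
    by (simp add: fundamental_form_def fundamental_tensor_eq sum_divide_distrib sum_distrib_left
        mult_ac)
qed

lemma fundamental_form_commute: "v \<noteq> 0 \<Longrightarrow> fundamental_form f v a b = fundamental_form f v b a"
  by (simp add: fundamental_form_eq ddenergy_commute)

lemma linear_fundamental_form: "v \<noteq> 0 \<Longrightarrow> linear (fundamental_form f v a)"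
  using linear_compose_scale_right[OF linear_ddenergy_right, of v "1/2" a]
  by (simp add: fundamental_form_eq[of v a, THEN ext])

lemma linear_fundamental_form_left: "v \<noteq> 0 \<Longrightarrow> linear (\<lambda>a. fundamental_form f v a b)"
  using linear_fundamental_form[of v b] by (simp add: fundamental_form_commute[of v _ b])

lemma energy_scale: "v \<noteq> 0 \<Longrightarrow> t > 0 \<Longrightarrow> energy (t *\<^sub>R v) = t\<^sup>2 * energy v"
  by (simp add: energy_def homogeneous power_mult_distrib)

text \<open>Differentiating a homogeneous function lowers its degree by one: the energy has degree 2, its
  first derivatives degree 1 and its second derivatives degree 0.\<close>

lemma denergy_scale:
  assumes "v \<noteq> 0" "t > 0"
  shows "denergy (t *\<^sub>R v) b = t * denergy v b"
proof -
  have "((\<lambda>u. energy (t *\<^sub>R u)) has_derivative (\<lambda>b. denergy (t *\<^sub>R v) (t *\<^sub>R b))) (at v)"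
    using assms by (intro has_derivative_compose[OF _ energy_has_derivative] derivative_eq_intros refl) auto
  moreover have "((\<lambda>u. energy (t *\<^sub>R u)) has_derivative (\<lambda>b. t\<^sup>2 * denergy v b)) (at v)"
  proof (rule has_derivative_transform_within_open[of _ _ v UNIV "- {0}"])
    show "((\<lambda>u. t\<^sup>2 * energy u) has_derivative (\<lambda>b. t\<^sup>2 * denergy v b)) (at v)"
      using energy_has_derivative[OF assms(1)] by (auto intro: has_derivative_mult_right)
  qed (use assms energy_scale in auto)
  ultimately have "denergy (t *\<^sub>R v) (t *\<^sub>R b) = t\<^sup>2 * denergy v b"
    using has_derivative_unique by metis
  then show ?thesis
    using assms linear_scale[OF linear_denergy, of "t *\<^sub>R v" t b] by (simp add: power2_eq_square)
qed

lemma ddenergy_scale: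
  assumes "v \<noteq> 0" "t > 0"
  shows "ddenergy (t *\<^sub>R v) a b = ddenergy v a b"
proof -
  have "((\<lambda>u. denergy (t *\<^sub>R u) b) has_derivative (\<lambda>a. ddenergy (t *\<^sub>R v) (t *\<^sub>R a) b)) (at v)"
    using assms
    by (intro has_derivative_compose[OF _ denergy_has_derivative] derivative_eq_intros refl) auto
  moreover have "((\<lambda>u. denergy (t *\<^sub>R u) b) has_derivative (\<lambda>a. t * ddenergy v a b)) (at v)"
  proof (rule has_derivative_transform_within_open[of _ _ v UNIV "- {0}"])
    show "((\<lambda>u. t * denergy u b) has_derivative (\<lambda>a. t * ddenergy v a b)) (at v)"
      using denergy_has_derivative[OF assms(1)] by (auto intro: has_derivative_mult_right)
  qed (use assms denergy_scale in auto)
  ultimately have "ddenergy (t *\<^sub>R v) (t *\<^sub>R a) b = t * ddenergy v a b"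
    using has_derivative_unique by metis
  then show ?thesis
    using assms linear_scale[OF linear_ddenergy, of "t *\<^sub>R v" t a b] by simp
qed

lemma fundamental_form_scale:
  "v \<noteq> 0 \<Longrightarrow> t > 0 \<Longrightarrow> fundamental_form f (t *\<^sub>R v) a b = fundamental_form f v a b"
  by (simp add: fundamental_form_eq ddenergy_scale)

text \<open>Euler's relation: differentiate homogeneity along the ray through \<open>v\<close>.\<close>

lemma denergy_self:
  assumes "v \<noteq> 0"
  shows "denergy v v = 2 * energy v"
proof (rule derivative_eq_along_line[OF energy_has_derivative[OF assms], of 1])
  show "energy (v + t *\<^sub>R v) = (1 + t)\<^sup>2 * energy v" if "\<bar>t\<bar> < 1" for t
    using energy_scale[OF assms, of "1 + t"] that by (simp add: scaleR_add_left)
  show "((\<lambda>t. (1 + t)\<^sup>2 * energy v) has_vector_derivative 2 * energy v) (at 0)"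
    unfolding has_real_derivative_iff_has_vector_derivative[symmetric]
    by (auto intro!: derivative_eq_intros)
qed simp

lemma ddenergy_self:
  assumes "v \<noteq> 0"
  shows "ddenergy v v b = denergy v b"
proof (rule derivative_eq_along_line[OF denergy_has_derivative[OF assms], of 1])
  show "denergy (v + t *\<^sub>R v) b = (1 + t) * denergy v b" if "\<bar>t\<bar> < 1" for t
    using denergy_scale[OF assms, of "1 + t"] that by (simp add: scaleR_add_left)
  show "((\<lambda>t. (1 + t) * denergy v b) has_vector_derivative denergy v b) (at 0)"
    unfolding has_real_derivative_iff_has_vector_derivative[symmetric]
    by (auto intro!: derivative_eq_intros)
qed simp

lemma fundamental_form_self_left: "v \<noteq> 0 \<Longrightarrow> fundamental_form f v v b = denergy v b / 2"
  by (simp add: fundamental_form_eq ddenergy_self)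

lemma fundamental_form_self_right: "v \<noteq> 0 \<Longrightarrow> fundamental_form f v b v = denergy v b / 2"
  by (simp add: fundamental_form_commute[of v b] fundamental_form_self_left)

lemma energy_pos: "v \<noteq> 0 \<Longrightarrow> energy v > 0"
  using fundamental_form_pos[of v v] by (simp add: fundamental_form_self_left denergy_self)

lemma f_pos: "v \<noteq> 0 \<Longrightarrow> f v > 0"
  using energy_pos[of v] nonneg[of v] by (auto simp: energy_def order_less_le)

text \<open>The component of the constant vector \<open>a\<close> orthogonal to the radial direction at \<open>v\<close>. The
  coefficient of \<open>v\<close> has degree -1, so the whole field has degree 0; this makes its derivative in the
  radial direction vanish.\<close>

definition radial_complement :: "real ^ 'n \<Rightarrow> real ^ 'n \<Rightarrow> real ^ 'n" where
  "radial_complement a v = a - (denergy v a / (2 * energy v)) *\<^sub>R v"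

lemma radial_complement_orthogonal:
  assumes "v \<noteq> 0"
  shows "fundamental_form f v (radial_complement a v) v = 0"
  using energy_pos[OF assms]
  by (simp add: radial_complement_def linear_diff[OF linear_fundamental_form_left[OF assms]]
      linear_scale[OF linear_fundamental_form_left[OF assms]]
      fundamental_form_self_right[OF assms] linear_diff[OF linear_denergy[OF assms]]
      linear_scale[OF linear_denergy[OF assms]] denergy_self[OF assms])

lemma radial_complement_scale:
  assumes "v \<noteq> 0" "t > 0"
  shows "radial_complement a (t *\<^sub>R v) = radial_complement a v"
  using assms by (simp add: radial_complement_def denergy_scale energy_scale power2_eq_square)

lemma Ck_radial_complement: "Ck k (- {0}) (radial_complement a)"
  unfolding radial_complement_def[abs_def]
  using energy_pos
  by (intro Ck_diff Ck_scaleR Ck_divide Ck_const Ck_denergy Ck_mult Ck_energy Ck_linear bounded_linear_ident)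
    (auto simp: less_le)

lemma radial_complement_nonzero: "a \<notin> span {v} \<Longrightarrow> radial_complement a v \<noteq> 0"
  by (auto simp: radial_complement_def span_singleton)

lemma Ck_fundamental_tensor: "Ck k (- {0}) (\<lambda>v. fundamental_tensor f v i j)"
  unfolding fundamental_tensor_eq divide_inverse
  by (intro Ck_mult Ck_ddenergy Ck_const) auto

text \<open>By Euler's relation the Legendre map is half the differential of the energy.\<close>

lemma legendre_nth: "v \<noteq> 0 \<Longrightarrow> legendre f v $ i = denergy v (axis i 1) / 2"
proof -
  assume v: "v \<noteq> 0"
  have "fundamental_form f v (axis i 1) v = legendre f v $ i"
    by (simp add: fundamental_form_def legendre_def axis_def if_distrib[of "\<lambda>x. x * _"]
        if_distrib[of "\<lambda>x. _ * x"] sum.delta' flip: sum_distrib_left cong: if_cong)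
       (subst sum.swap, simp)
  then show ?thesis using fundamental_form_self_right[OF v] by simp
qed

lemma legendre_inner: 
  assumes "v \<noteq> 0"
  shows "legendre f v \<bullet> b = denergy v b / 2"
proof -
  have "denergy v b = denergy v (\<Sum>i\<in>UNIV. (b $ i) *\<^sub>R axis i 1)"
    using basis_expansion[of b] by (simp add: scalar_mult_eq_scaleR)
  also have "\<dots> = (\<Sum>i\<in>UNIV. b $ i * denergy v (axis i 1))"
    by (simp add: linear_sum[OF linear_denergy[OF assms]] linear_scale[OF linear_denergy[OF assms]])
  finally show ?thesis
    by (simp add: inner_vec_def legendre_nth[OF assms] sum_divide_distrib mult_ac)
qed

lemma legendre_inner_self: "v \<noteq> 0 \<Longrightarrow> legendre f v \<bullet> v = energy v"
  by (simp add: legendre_inner denergy_self)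

lemma legendre_nonzero: "v \<noteq> 0 \<Longrightarrow> legendre f v \<noteq> 0"
  using legendre_inner_self[of v] energy_pos[of v] by auto

lemma legendre_scale: "v \<noteq> 0 \<Longrightarrow> t > 0 \<Longrightarrow> legendre f (t *\<^sub>R v) = t *\<^sub>R legendre f v"
  by (simp add: vec_eq_iff legendre_nth denergy_scale)

lemma legendre_inner_has_derivative:
  assumes "v \<noteq> 0"
  shows "((\<lambda>v. legendre f v \<bullet> b) has_derivative (\<lambda>a. fundamental_form f v a b)) (at v)"
proof (rule has_derivative_transform_within_open[of _ _ v UNIV "- {0}"])
  show "((\<lambda>v. denergy v b / 2) has_derivative (\<lambda>a. fundamental_form f v a b)) (at v)"
    using has_derivative_mult_right[OF denergy_has_derivative[OF assms], of "1/2" b]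
    by (simp add: fundamental_form_eq[OF assms])
qed (use assms legendre_inner in auto)

definition tensor_matrix :: "real ^ 'n \<Rightarrow> real ^ 'n ^ 'n" where
  "tensor_matrix v = (\<chi> i j. fundamental_tensor f v i j)"

lemma tensor_matrix_inner:
  "v \<noteq> 0 \<Longrightarrow> (tensor_matrix v *v a) \<bullet> b = fundamental_form f v a b"
  by (subst fundamental_form_commute)
    (simp_all add: tensor_matrix_def matrix_vector_mult_def inner_vec_def fundamental_form_def
      sum_distrib_left sum_distrib_right mult_ac)

text \<open>Since the fundamental form is positive definite, this makes the Legendre map a local
  diffeomorphism.\<close>

lemma legendre_has_derivative:
  assumes "v \<noteq> 0"
  shows "(legendre f has_derivative (*v) (tensor_matrix v)) (at v)"
  using legendre_inner_has_derivative[OF assms]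
  by (subst has_derivative_componentwise_within) (simp add: tensor_matrix_inner[OF assms])

lemma det_tensor_matrix:
  assumes "v \<noteq> 0"
  shows "det (tensor_matrix v) \<noteq> 0"
proof -
  have "a = 0" if "tensor_matrix v *v a = 0" for a
    using tensor_matrix_inner[OF assms, of a a] fundamental_form_pos[OF assms, of a] that by auto
  then show ?thesis
    using invertible_left_inverse invertible_det_nz matrix_left_invertible_ker by blast
qed

lemma tensor_matrix_inv:
  assumes "v \<noteq> 0"
  shows "tensor_matrix v *v (matrix_inv (tensor_matrix v) *v b) = b"
proof -
  have "invertible (tensor_matrix v)"
    using det_tensor_matrix[OF assms] invertible_det_nz by blast
  then show ?thesis by (simp add: matrix_vector_mul_assoc matrix_inv_right)
qed

lemma continuous_on_legendre: "continuous_on (- {0}) (legendre f)"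
  using legendre_has_derivative
  by (auto intro!: has_derivative_continuous_on intro: has_derivative_at_withinI)

text \<open>The Legendre map is strictly monotone along every segment that avoids the origin. A segment
  through the origin cannot join two vectors with the same image \<open>q\<close>, as both have positive pairing
  with \<open>q\<close>.\<close>

lemma inj_on_legendre: "inj_on (legendre f) (- {0})"
proof (rule inj_onI)
  fix v w assume vw: "v \<in> - {0}" "w \<in> - {0}" "legendre f v = legendre f w"
  define q where "q = legendre f v"
  have q: "q \<bullet> v > 0" "q \<bullet> w > 0"
    using legendre_inner_self[of v] legendre_inner_self[of w] energy_pos vw by (auto simp: q_def)
  define d where "d = w - v"
  have nz: "v + t *\<^sub>R d \<noteq> 0" if "0 \<le> t" "t \<le> 1" for t
  proof
    assume "v + t *\<^sub>R d = 0"
    then have "0 = q \<bullet> (v + t *\<^sub>R d)" by simp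
    also have "\<dots> = (1 - t) * (q \<bullet> v) + t * (q \<bullet> w)"
      by (simp add: d_def inner_simps algebra_simps)
    also have "\<dots> > 0"
      using q that by (cases "t = 1") (auto intro: add_pos_nonneg)
    finally show False by simp
  qed
  have "(\<lambda>t. legendre f (v + t *\<^sub>R d) \<bullet> d) 0 < (\<lambda>t. legendre f (v + t *\<^sub>R d) \<bullet> d) 1" if "d \<noteq> 0"
  proof (rule DERIV_pos_imp_increasing[of 0 1 "\<lambda>t. legendre f (v + t *\<^sub>R d) \<bullet> d"])
    fix t :: real assume t: "0 \<le> t" "t \<le> 1"
    show "\<exists>y. ((\<lambda>t. legendre f (v + t *\<^sub>R d) \<bullet> d) has_real_derivative y) (at t) \<and> y > 0"
      using has_real_derivative_along_line[OF legendre_inner_has_derivative[OF nz[OF t]]]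
        fundamental_form_pos[OF nz[OF t] that] by auto
  qed simp
  then show "v = w" using vw by (auto simp: d_def)
qed

text \<open>The image of the Legendre map is open by invariance of domain; by homogeneity it is the cone over
  the compact set of directions attained on the unit sphere, hence closed in the punctured space, which is
  connected.\<close>

lemma legendre_image:
  assumes "CARD('n) \<ge> 2"
  shows "legendre f ` (- {0}) = - {0}"
proof -
  let ?I = "legendre f ` (- {0})" and ?C = "(\<lambda>v. sgn (legendre f v)) ` sphere 0 1"
  have "compact ?C"
  proof (rule compact_continuous_image[OF _ compact_sphere])
    have "continuous_on (sphere 0 1) (legendre f)"
      by (rule continuous_on_subset[OF continuous_on_legendre]) auto
    then show "continuous_on (sphere 0 1) (\<lambda>v. sgn (legendre f v))"
    proof (rule continuous_on_sgn, intro ballI)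
      show "legendre f u \<noteq> 0" if "u \<in> sphere 0 1" for u
        using that by (intro legendre_nonzero) auto
    qed
  qed
  then have "closed ?C" by (rule compact_imp_closed)
  have "?I = - {0} \<inter> sgn -` ?C"
  proof (intro equalityI subsetI)
    fix p assume "p \<in> ?I"
    then obtain v where v: "v \<noteq> 0" "p = legendre f v" by auto
    have "sgn p = sgn (legendre f (sgn v))"
      using v by (simp add: sgn_div_norm[of v] legendre_scale sgn_scaleR)
    then show "p \<in> - {0} \<inter> sgn -` ?C"
      using v legendre_nonzero by (auto simp: norm_sgn intro!: image_eqI[of _ _ "sgn v"])
  next
    fix p assume "p \<in> - {0} \<inter> sgn -` ?C"
    then obtain u where u: "norm u = 1" "sgn p = sgn (legendre f u)" and p: "p \<noteq> 0" by auto
    have u0: "u \<noteq> 0" using u(1) by auto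
    define r where "r = norm p / norm (legendre f u)"
    have "p = norm p *\<^sub>R sgn p" using p by (simp add: sgn_div_norm)
    also have "\<dots> = legendre f (r *\<^sub>R u)"
      using u u0 p legendre_nonzero[OF u0]
      by (simp add: legendre_scale r_def sgn_div_norm[of "legendre f u"] divide_inverse)
    finally show "p \<in> ?I"
      using u0 p legendre_nonzero[OF u0] by (auto simp: r_def)
  qed
  then have "closedin (top_of_set (- {0})) ?I"
    using continuous_closedin_preimage[OF continuous_on_sgn[OF continuous_on_id] \<open>closed ?C\<close>, of "- {0}"]
    by auto
  moreover have "openin (top_of_set (- {0})) ?I"
    using invariance_of_domain[OF continuous_on_legendre _ inj_on_legendre] legendre_nonzero
    by (auto intro!: open_subset)
  moreover have "connected (- {0 :: real ^ 'n})"
    using assms by (simp add: connected_punctured_universe)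
  moreover have "?I \<noteq> {}" using one_neq_zero[where 'a = "real ^ 'n"] by blast
  ultimately show ?thesis
    using connected_clopen by blast
qed

definition legendre_inv :: "real ^ 'n \<Rightarrow> real ^ 'n" where
  "legendre_inv = inv_into (- {0}) (legendre f)"

lemma legendre_inv_legendre: "v \<noteq> 0 \<Longrightarrow> legendre_inv (legendre f v) = v"
  using inv_into_f_f[OF inj_on_legendre] by (simp add: legendre_inv_def)

lemma
  assumes "CARD('n) \<ge> 2" "p \<noteq> 0"
  shows legendre_legendre_inv: "legendre f (legendre_inv p) = p"
    and legendre_inv_nonzero: "legendre_inv p \<noteq> 0"
proof -
  have "p \<in> legendre f ` (- {0})" using legendre_image assms by auto
  from f_inv_into_f[OF this] inv_into_into[OF this]
  show "legendre f (legendre_inv p) = p" "legendre_inv p \<noteq> 0"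
    by (simp_all add: legendre_inv_def)
qed

lemma legendre_inv_image: "CARD('n) \<ge> 2 \<Longrightarrow> legendre_inv ` (- {0}) \<subseteq> - {0}"
  by (intro image_subsetI) (simp add: legendre_inv_nonzero)

lemma legendre_inv_has_derivative:
  assumes "CARD('n) \<ge> 2" "p \<noteq> 0"
  shows "(legendre_inv has_derivative (*v) (matrix_inv (tensor_matrix (legendre_inv p)))) (at p)"
proof -
  define v where "v = legendre_inv p"
  have v: "v \<noteq> 0" "legendre f v = p"
    using legendre_legendre_inv legendre_inv_nonzero assms by (auto simp: v_def)
  have "(*v) (tensor_matrix v) \<circ> (*v) (matrix_inv (tensor_matrix v)) = id"
    using tensor_matrix_inv[OF v(1)] by (auto simp: fun_eq_iff)
  from has_derivative_inverse_strong[OF _ _ continuous_on_legendre _ legendre_has_derivative[OF v(1)] this,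
      of legendre_inv]
  show ?thesis using v legendre_inv_legendre by (simp add: v_def[symmetric] open_Compl)
qed

text \<open>Bootstrapping: the derivative of the inverse solves a linear system whose coefficients are
  composed with the inverse itself, so it inherits the class already established for the inverse.\<close>

lemma Ck_legendre_inv:
  assumes "CARD('n) \<ge> 2"
  shows "Ck k (- {0}) legendre_inv"
proof (induction k)
  case 0
  then show ?case
    using legendre_inv_has_derivative[OF assms]
    by (auto intro!: has_derivative_continuous_on intro: has_derivative_at_withinI)
next
  case (Suc k)
  show ?case
  proof (rule Ck_SucI[OF _ legendre_inv_has_derivative[OF assms]])
    fix b
    show "Ck k (- {0}) (\<lambda>p. matrix_inv (tensor_matrix (legendre_inv p)) *v b)"
    proof (rule Ck_linear_system)
      show "Ck k (- {0}) (\<lambda>p. tensor_matrix (legendre_inv p) $ i $ j)" for i j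
      proof -
        from Ck_compose[OF open_punctured open_punctured legendre_inv_image[OF assms] Suc Ck_fundamental_tensor]
        show ?thesis by (simp add: tensor_matrix_def)
      qed
      show "det (tensor_matrix (legendre_inv p)) \<noteq> 0" if "p \<in> - {0}" for p
        using det_tensor_matrix legendre_inv_nonzero[OF assms] that by auto
      show "tensor_matrix (legendre_inv p) *v (matrix_inv (tensor_matrix (legendre_inv p)) *v b) = b"
        if "p \<in> - {0}" for p
        using that tensor_matrix_inv legendre_inv_nonzero[OF assms] by auto
    qed auto
  qed auto
qed

text \<open>The inverse Legendre map is half the differential of \<open>k\<^sup>2\<close>. Therefore the fundamental form
  of \<open>k\<close> at \<open>p\<close> is given by the derivative of the inverse Legendre map, that is, by the inverse of the
  fundamental tensor of \<open>f\<close>, and is again positive definite.\<close>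

theorem legendre_dual:
  assumes card: "CARD('n) \<ge> 2"
    and k: "\<And>v. v \<noteq> 0 \<Longrightarrow> k (legendre f v) = f v"
  shows "minkowski_norm k"
proof -
  have k_eq: "k p = f (legendre_inv p)" if "p \<noteq> 0" for p
    using k[of "legendre_inv p"] legendre_legendre_inv legendre_inv_nonzero card that by simp
  define B where "B p = (*v) (matrix_inv (tensor_matrix (legendre_inv p)))" for p
  have inv: "(legendre_inv has_derivative B p) (at p)" if "p \<noteq> 0" for p
    using legendre_inv_has_derivative[OF card that] by (simp add: B_def)
  \<comment> \<open>Comparing the derivatives of \<open>k\<^sup>2 = energy \<circ> legendre_inv\<close> and of \<open>k\<^sup>2 = p \<bullet> legendre_inv p\<close>
    eliminates the unknown derivative of \<open>legendre_inv\<close>.\<close>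
  have d1: "((\<lambda>p. (k p)\<^sup>2) has_derivative (\<lambda>b. 2 * (legendre_inv p \<bullet> b))) (at p)" if p: "p \<noteq> 0" for p
  proof -
    define v where "v = legendre_inv p"
    have v: "v \<noteq> 0" "legendre f v = p"
      using legendre_legendre_inv legendre_inv_nonzero card p by (auto simp: v_def)
    have e: "((\<lambda>p. energy (legendre_inv p)) has_derivative (\<lambda>b. denergy v (B p b))) (at p)"
      using has_derivative_compose[OF inv[OF p] energy_has_derivative] v by (simp add: v_def)
    have i: "((\<lambda>p. p \<bullet> legendre_inv p) has_derivative (\<lambda>b. p \<bullet> B p b + b \<bullet> v)) (at p)"
      using has_derivative_inner[OF has_derivative_ident inv[OF p]] by (simp add: v_def)
    have "energy (legendre_inv q) = q \<bullet> legendre_inv q" if "q \<in> - {0}" for q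
      using legendre_inner_self[of "legendre_inv q"] legendre_legendre_inv[OF card]
        legendre_inv_nonzero[OF card] that by simp
    then have "((\<lambda>p. energy (legendre_inv p)) has_derivative (\<lambda>b. p \<bullet> B p b + b \<bullet> v)) (at p)"
      using p by (intro has_derivative_transform_within_open[OF i, of "- {0}"]) auto
    with e have "denergy v (B p b) = p \<bullet> B p b + b \<bullet> v" for b
      using has_derivative_unique by metis
    moreover have "denergy v (B p b) = 2 * (p \<bullet> B p b)" for b
      using legendre_inner[OF v(1), of "B p b"] v by simp
    ultimately have "denergy v (B p b) = 2 * (legendre_inv p \<bullet> b)" for b
      by (simp add: v_def inner_commute)
    with e have "((\<lambda>p. energy (legendre_inv p)) has_derivative (\<lambda>b. 2 * (legendre_inv p \<bullet> b))) (at p)"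
      by simp
    then show ?thesis
      using p k_eq
      by (rule_tac has_derivative_transform_within_open[of _ _ p UNIV "- {0}"]) (auto simp: energy_def)
  qed
  have d2: "frechet_derivative (\<lambda>u. frechet_derivative (\<lambda>p. (k p)\<^sup>2) (at u) b) (at p) a = 2 * (B p a \<bullet> b)"
    if p: "p \<noteq> 0" for p a b
  proof -
    have "((\<lambda>u. 2 * (legendre_inv u \<bullet> b)) has_derivative (\<lambda>a. 2 * (B p a \<bullet> b))) (at p)"
      using inv[OF p] by (intro has_derivative_mult_right has_derivative_inner_left)
    then have "((\<lambda>u. frechet_derivative (\<lambda>p. (k p)\<^sup>2) (at u) b) has_derivative (\<lambda>a. 2 * (B p a \<bullet> b))) (at p)"
      using p d1 frechet_derivative_at[OF d1, symmetric]
      by (rule_tac has_derivative_transform_within_open[of _ _ p UNIV "- {0}"]) auto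
    then show ?thesis using frechet_derivative_at by metis
  qed
  have form: "fundamental_form k p a a = B p a \<bullet> a" if p: "p \<noteq> 0" for p a
  proof -
    have "fundamental_form k p a a = (\<Sum>i\<in>UNIV. \<Sum>j\<in>UNIV. (B p (axis i 1) $ j) * a $ i * a $ j)"
      unfolding fundamental_form_def fundamental_tensor_def partial_def d2[OF p]
      by (simp add: inner_axis)
    also have "\<dots> = (\<Sum>i\<in>UNIV. a $ i *\<^sub>R B p (axis i 1)) \<bullet> a"
      by (simp add: inner_vec_def sum_distrib_left sum_distrib_right mult_ac)
         (subst sum.swap, simp add: mult_ac)
    also have "(\<Sum>i\<in>UNIV. a $ i *\<^sub>R B p (axis i 1)) = B p (\<Sum>i\<in>UNIV. a $ i *\<^sub>R axis i 1)"
      using has_derivative_linear[OF inv[OF p]] by (simp add: linear_sum linear_scale)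
    also have "(\<Sum>i\<in>UNIV. a $ i *\<^sub>R axis i 1) = a"
      using basis_expansion[of a] by (simp add: scalar_mult_eq_scaleR)
    finally show ?thesis .
  qed
  show ?thesis
  proof
    have "Ck m (- {0}) (\<lambda>p. f (legendre_inv p))" for m
      by (rule Ck_compose[OF open_punctured open_punctured legendre_inv_image[OF card]
            Ck_legendre_inv[OF card] Ck_f])
    then show "smooth_on (- {0}) k"
      unfolding smooth_on_def using k_eq Ck_eq_on_open[of "- {0}" _ "\<lambda>p. f (legendre_inv p)" k] by auto
  next
    fix p :: "real ^ 'n" and t :: real assume p: "p \<noteq> 0" "t > 0"
    define v where "v = legendre_inv p"
    have v: "v \<noteq> 0" "legendre f v = p"
      using legendre_legendre_inv legendre_inv_nonzero card p by (auto simp: v_def)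
    show "k (t *\<^sub>R p) = t * k p"
      using k[of "t *\<^sub>R v"] k[of v] v p by (simp add: legendre_scale homogeneous)
  next
    fix p :: "real ^ 'n" assume "p \<noteq> 0"
    then show "k p \<ge> 0" using k_eq nonneg legendre_inv_nonzero[OF card] by simp
  next
    fix p a :: "real ^ 'n" assume p: "p \<noteq> 0" and a: "a \<noteq> 0"
    define v w where "v = legendre_inv p" and "w = B p a"
    have v: "v \<noteq> 0" using legendre_inv_nonzero card p by (auto simp: v_def)
    have aw: "tensor_matrix v *v w = a"
      using tensor_matrix_inv[OF v] by (simp add: w_def B_def v_def[symmetric])
    then have "w \<noteq> 0" using a by auto
    then have "w \<bullet> a > 0"
      using fundamental_form_pos[OF v, of w] tensor_matrix_inner[OF v, of w w] aw
      by (simp add: inner_commute)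
    then show "fundamental_form k p a a > 0" using form[OF p] by (simp add: w_def)
  qed
qed

end


section \<open>Atlases and tangent vectors\<close>

lemma chart_inv_left: "inj_on (snd c) (fst c) \<Longrightarrow> x \<in> fst c \<Longrightarrow> chart_inv c (snd c x) = x"
  by (simp add: chart_inv_def)

lemma transition_apply: "inj_on (snd c) (fst c) \<Longrightarrow> x \<in> fst c \<Longrightarrow> transition c c' (snd c x) = snd c' x"
  by (simp add: transition_def chart_inv_left)

abbreviation jacobian :: "('a, 'e::euclidean_space) chart \<Rightarrow> ('a, 'f::euclidean_space) chart \<Rightarrow> 'a \<Rightarrow> 'e \<Rightarrow> 'f" where
  "jacobian c c' x \<equiv> frechet_derivative (transition c c') (at (snd c x))"

locale atlas =
  fixes A :: "('a, 'e::euclidean_space) chart set"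
  assumes smooth_atlas: "smooth_atlas A"
begin

lemma chart_inj: "c \<in> A \<Longrightarrow> inj_on (snd c) (fst c)"
  and chart_open: "c \<in> A \<Longrightarrow> open (snd c ` fst c)"
  and overlap_open: "c \<in> A \<Longrightarrow> c' \<in> A \<Longrightarrow> open (snd c ` (fst c \<inter> fst c'))"
  and transition_smooth: "c \<in> A \<Longrightarrow> c' \<in> A \<Longrightarrow> smooth_on (snd c ` (fst c \<inter> fst c')) (transition c c')"
  using smooth_atlas by (auto simp: smooth_atlas_def)

lemma inv_chart: "c \<in> A \<Longrightarrow> x \<in> fst c \<Longrightarrow> chart_inv c (snd c x) = x"
  by (simp add: chart_inv_left chart_inj)

lemma transition_chart: "c \<in> A \<Longrightarrow> x \<in> fst c \<Longrightarrow> transition c c' (snd c x) = snd c' x"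
  by (simp add: transition_apply chart_inj)

lemma transition_has_derivative:
  "c \<in> A \<Longrightarrow> c' \<in> A \<Longrightarrow> x \<in> fst c \<Longrightarrow> x \<in> fst c' \<Longrightarrow>
    (transition c c' has_derivative jacobian c c' x) (at (snd c x))"
  by (rule smooth_on_has_derivative[OF transition_smooth]) auto

lemma linear_jacobian:
  "c \<in> A \<Longrightarrow> c' \<in> A \<Longrightarrow> x \<in> fst c \<Longrightarrow> x \<in> fst c' \<Longrightarrow> linear (jacobian c c' x)"
  using transition_has_derivative has_derivative_linear by blast

lemma jacobian_cocycle:
  assumes "c \<in> A" "c' \<in> A" "c'' \<in> A" "x \<in> fst c" "x \<in> fst c'" "x \<in> fst c''"
  shows "jacobian c' c'' x (jacobian c c' x v) = jacobian c c'' x v"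
proof -
  let ?S = "snd c ` (fst c \<inter> fst c') \<inter> snd c ` (fst c \<inter> fst c'')"
  have "((\<lambda>e. transition c' c'' (transition c c' e)) has_derivative
      (\<lambda>v. jacobian c' c'' x (jacobian c c' x v))) (at (snd c x))"
    using has_derivative_compose[OF transition_has_derivative[of c c' x], of "transition c' c''"]
      transition_has_derivative[of c' c'' x] transition_chart[of c x c'] assms by simp
  moreover have "open ?S" using assms by (intro open_Int overlap_open)
  moreover have "snd c x \<in> ?S" using assms by blast
  moreover have "transition c' c'' (transition c c' e) = transition c c'' e" if "e \<in> ?S" for e
  proof -
    obtain w where w: "w \<in> fst c" "w \<in> fst c'" "e = snd c w" using \<open>e \<in> ?S\<close> by blast
    then show ?thesis using assms by (simp add: transition_chart)
  qed
  ultimately have "(transition c c'' has_derivative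
      (\<lambda>v. jacobian c' c'' x (jacobian c c' x v))) (at (snd c x))"
    by (rule has_derivative_transform_within_open)
  then show ?thesis
    using transition_has_derivative[of c c'' x] assms has_derivative_unique by metis
qed

lemma jacobian_same:
  assumes "c \<in> A" "x \<in> fst c"
  shows "jacobian c c x v = v"
proof -
  have "(transition c c has_derivative (\<lambda>v. v)) (at (snd c x))"
  proof (rule has_derivative_transform_within_open[OF has_derivative_ident chart_open[OF assms(1)]])
    show "e = transition c c e" if "e \<in> snd c ` fst c" for e
      using that transition_chart[OF assms(1), of _ c] by force
  qed (use assms in blast)
  then show ?thesis
    using transition_has_derivative[of c c x] assms has_derivative_unique by metis
qed

lemma vec_of_tangent:
  assumes "c \<in> A" "x \<in> fst c"
  shows "vec_of A x c a \<in> tangent_space A x"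
  using assms by (auto simp: tangent_space_def vec_of_def jacobian_cocycle)

lemma vec_of_chart: "c \<in> A \<Longrightarrow> x \<in> fst c \<Longrightarrow> vec_of A x c a c = a"
  by (simp add: vec_of_def jacobian_same)

lemma tangent_eq_vec_of:
  assumes "c \<in> A" "x \<in> fst c" "v \<in> tangent_space A x"
  shows "v = vec_of A x c (v c)"
proof
  fix c'
  show "v c' = vec_of A x c (v c) c'"
  proof (cases "c' \<in> A \<and> x \<in> fst c'")
    case True
    then have "v c' = jacobian c c' x (v c)"
      using assms unfolding tangent_space_def by blast
    then show ?thesis using True by (simp add: vec_of_def)
  next
    case False
    then have "v c' = 0" using assms(3) unfolding tangent_space_def by blast
    then show ?thesis using False by (auto simp: vec_of_def)
  qed
qed

lemma covec_of_inner:
  assumes "c \<in> A" "x \<in> fst c" "c' \<in> A" "x \<in> fst c'"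
  shows "covec_of A x c a c' \<bullet> b = a \<bullet> jacobian c' c x b"
  using adjoint_works[OF linear_jacobian[OF assms(3,1,4,2)], of b a] assms
  by (simp add: covec_of_def inner_commute)

lemma covec_of_cotangent:
  assumes "c \<in> A" "x \<in> fst c"
  shows "covec_of A x c a \<in> cotangent_space A x"
proof -
  have "covec_of A x c a c' = 0" if "\<not> (c' \<in> A \<and> x \<in> fst c')" for c'
    using that by (auto simp: covec_of_def)
  then show ?thesis
    using assms by (auto simp: cotangent_space_def covec_of_inner jacobian_cocycle)
qed

lemma covec_of_chart:
  assumes "c \<in> A" "x \<in> fst c"
  shows "covec_of A x c a c = a"
proof -
  have "covec_of A x c a c \<bullet> b = a \<bullet> b" for b
    using assms by (simp add: covec_of_inner jacobian_same)
  then show ?thesis by (metis vector_eq_rdot)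
qed

lemma cotangent_eq_covec_of:
  assumes "c \<in> A" "x \<in> fst c" "p \<in> cotangent_space A x"
  shows "p = covec_of A x c (p c)"
proof
  fix c'
  show "p c' = covec_of A x c (p c) c'"
  proof (cases "c' \<in> A \<and> x \<in> fst c'")
    case True
    then have "p c' \<bullet> b = p c \<bullet> jacobian c' c x b" for b
      using assms unfolding cotangent_space_def by blast
    then have "p c' \<bullet> b = covec_of A x c (p c) c' \<bullet> b" for b
      using assms(1,2) True by (simp add: covec_of_inner)
    then show ?thesis by (metis vector_eq_rdot)
  next
    case False
    then have "p c' = 0" using assms(3) unfolding cotangent_space_def by blast
    then show ?thesis using False by (auto simp: covec_of_def)
  qed
qed

lemma tangent_eqI:
  "c \<in> A \<Longrightarrow> x \<in> fst c \<Longrightarrow> v \<in> tangent_space A x \<Longrightarrow> w \<in> tangent_space A x \<Longrightarrow> v c = w c \<Longrightarrow> v = w"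
  by (metis tangent_eq_vec_of)

lemma cotangent_eqI:
  "c \<in> A \<Longrightarrow> x \<in> fst c \<Longrightarrow> v \<in> cotangent_space A x \<Longrightarrow> w \<in> cotangent_space A x \<Longrightarrow> v c = w c \<Longrightarrow> v = w"
  by (metis cotangent_eq_covec_of)

lemma tangent_zero: "vec_zero \<in> tangent_space A x"
  by (simp add: tangent_space_def vec_zero_def linear_0[OF linear_jacobian])

lemma cotangent_zero: "vec_zero \<in> cotangent_space A x"
  by (simp add: cotangent_space_def vec_zero_def)

lemma vec_of_zero: "c \<in> A \<Longrightarrow> x \<in> fst c \<Longrightarrow> vec_of A x c 0 = vec_zero"
  using tangent_eqI[OF _ _ vec_of_tangent tangent_zero] vec_of_chart by (simp add: vec_zero_def)

lemma covec_of_zero: "c \<in> A \<Longrightarrow> x \<in> fst c \<Longrightarrow> covec_of A x c 0 = vec_zero"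
  using cotangent_eqI[OF _ _ covec_of_cotangent cotangent_zero] covec_of_chart by (simp add: vec_zero_def)

lemma tangent_add_scale:
  assumes "v \<in> tangent_space A x" "w \<in> tangent_space A x"
  shows "vec_add v (vec_scale t w) \<in> tangent_space A x"
proof -
  have trans: "u c' = jacobian c c' x (u c)"
    if "u \<in> tangent_space A x" "c \<in> A" "c' \<in> A" "x \<in> fst c" "x \<in> fst c'" for u c c'
    using that unfolding tangent_space_def by blast
  have "vec_add v (vec_scale t w) c' = jacobian c c' x (vec_add v (vec_scale t w) c)"
    if *: "c \<in> A" "c' \<in> A" "x \<in> fst c" "x \<in> fst c'" for c c'
    using linear_add[OF linear_jacobian[OF *]] linear_scale[OF linear_jacobian[OF *]]
      trans[OF assms(1) *] trans[OF assms(2) *] by (simp add: vec_add_def vec_scale_def)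
  moreover have "vec_add v (vec_scale t w) c = 0" if "\<not> (c \<in> A \<and> x \<in> fst c)" for c
  proof -
    have "v c = 0" "w c = 0" using that assms unfolding tangent_space_def by blast+
    then show ?thesis by (simp add: vec_add_def vec_scale_def)
  qed
  ultimately show ?thesis unfolding tangent_space_def by blast
qed

lemma cotangent_add_scale:
  assumes "v \<in> cotangent_space A x" "w \<in> cotangent_space A x"
  shows "vec_add v (vec_scale t w) \<in> cotangent_space A x"
proof -
  have trans: "u c \<bullet> a = u c' \<bullet> jacobian c c' x a"
    if "u \<in> cotangent_space A x" "c \<in> A" "c' \<in> A" "x \<in> fst c" "x \<in> fst c'" for u c c' a
    using that unfolding cotangent_space_def by blast
  have "vec_add v (vec_scale t w) c \<bullet> a = vec_add v (vec_scale t w) c' \<bullet> jacobian c c' x a"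
    if *: "c \<in> A" "c' \<in> A" "x \<in> fst c" "x \<in> fst c'" for c c' a
    using trans[OF assms(1) *] trans[OF assms(2) *]
    by (simp add: vec_add_def vec_scale_def inner_left_distrib)
  moreover have "vec_add v (vec_scale t w) c = 0" if "\<not> (c \<in> A \<and> x \<in> fst c)" for c
  proof -
    have "v c = 0" "w c = 0" using that assms unfolding cotangent_space_def by blast+
    then show ?thesis by (simp add: vec_add_def vec_scale_def)
  qed
  ultimately show ?thesis unfolding cotangent_space_def by blast
qed

lemma tangent_nonzero_iff:
  "c \<in> A \<Longrightarrow> x \<in> fst c \<Longrightarrow> v \<in> tangent_space A x \<Longrightarrow> v \<noteq> vec_zero \<longleftrightarrow> v c \<noteq> 0"
  using tangent_eqI[OF _ _ _ tangent_zero, of c x v] by (auto simp: vec_zero_def)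

lemma cotangent_nonzero_iff:
  "c \<in> A \<Longrightarrow> x \<in> fst c \<Longrightarrow> v \<in> cotangent_space A x \<Longrightarrow> v \<noteq> vec_zero \<longleftrightarrow> v c \<noteq> 0"
  using cotangent_eqI[OF _ _ _ cotangent_zero, of c x v] by (auto simp: vec_zero_def)

text \<open>Injectivity of the charts makes these sets closed under intersection, which validates the
  abstract construction of the topology.\<close>

lemma openin_manifold_topology:
  "openin (manifold_topology A) W \<longleftrightarrow> W \<subseteq> points A \<and> (\<forall>c\<in>A. open (snd c ` (W \<inter> fst c)))"
proof -
  have "istopology (\<lambda>W. W \<subseteq> points A \<and> (\<forall>c\<in>A. open (snd c ` (W \<inter> fst c))))"
    unfolding istopology_def
  proof (intro conjI allI impI ballI)
    fix S T c assume *: "S \<subseteq> points A \<and> (\<forall>c\<in>A. open (snd c ` (S \<inter> fst c)))"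
      "T \<subseteq> points A \<and> (\<forall>c\<in>A. open (snd c ` (T \<inter> fst c)))" "c \<in> A"
    have "snd c ` (S \<inter> T \<inter> fst c) = snd c ` (S \<inter> fst c) \<inter> snd c ` (T \<inter> fst c)"
      using inj_on_image_Int[OF chart_inj[OF *(3)], of "S \<inter> fst c" "T \<inter> fst c"]
      by (simp add: Int_ac)
    then show "open (snd c ` (S \<inter> T \<inter> fst c))" using * by auto
  next
    fix \<K> c assume *: "\<forall>K\<in>\<K>. K \<subseteq> points A \<and> (\<forall>c\<in>A. open (snd c ` (K \<inter> fst c)))" "c \<in> A"
    have "snd c ` (\<Union> \<K> \<inter> fst c) = (\<Union>K\<in>\<K>. snd c ` (K \<inter> fst c))" by auto
    then show "open (snd c ` (\<Union> \<K> \<inter> fst c))" using * by auto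
  qed blast+
  then show ?thesis by (simp add: manifold_topology_def topology_inverse')
qed

lemma topspace_manifold_topology: "topspace (manifold_topology A) = points A"
proof
  have "openin (manifold_topology A) (points A)"
    unfolding openin_manifold_topology
  proof (intro conjI ballI)
    fix c assume c: "c \<in> A"
    then have "points A \<inter> fst c = fst c" by (auto simp: points_def)
    then show "open (snd c ` (points A \<inter> fst c))" using chart_open[OF c] by simp
  qed simp
  then show "points A \<subseteq> topspace (manifold_topology A)" by (rule openin_subset)
  show "topspace (manifold_topology A) \<subseteq> points A"
    using openin_topspace[of "manifold_topology A"] unfolding openin_manifold_topology by blast
qed

lemma continuous_map_chart_inv:
  assumes "c \<in> A"
  shows "continuous_map (top_of_set (snd c ` fst c)) (manifold_topology A) (chart_inv c)"
  unfolding continuous_map_def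
proof (intro conjI allI impI)
  show "chart_inv c \<in> topspace (top_of_set (snd c ` fst c)) \<rightarrow> topspace (manifold_topology A)"
    using assms inv_chart[OF assms] unfolding topspace_manifold_topology points_def by fastforce
  fix U assume "openin (manifold_topology A) U"
  then have "open (snd c ` (U \<inter> fst c))" using assms by (simp add: openin_manifold_topology)
  moreover have "{e \<in> topspace (top_of_set (snd c ` fst c)). chart_inv c e \<in> U} = snd c ` (U \<inter> fst c)"
    using inv_chart[OF assms] by auto
  ultimately show "openin (top_of_set (snd c ` fst c)) {e \<in> topspace (top_of_set (snd c ` fst c)). chart_inv c e \<in> U}"
    by (auto intro: open_subset)
qed

lemma compatible_chart_preimage_open:
  assumes "compatible_chart A \<phi>" "open U"
  shows "openin (manifold_topology A) {w \<in> fst \<phi>. snd \<phi> w \<in> U}"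
  unfolding openin_manifold_topology
proof (intro conjI ballI)
  interpret \<phi>: atlas "insert \<phi> A"
    using assms by unfold_locales (simp add: compatible_chart_def)
  show "{w \<in> fst \<phi>. snd \<phi> w \<in> U} \<subseteq> points A"
    using assms by (auto simp: compatible_chart_def)
  fix c assume c: "c \<in> A"
  let ?S = "snd c ` (fst c \<inter> fst \<phi>)"
  have "open (transition c \<phi> -` U \<inter> ?S)"
    using smooth_on_continuous_on[OF \<phi>.transition_smooth] \<phi>.overlap_open c assms(2)
      continuous_on_open_vimage by (metis insertCI)
  moreover have "transition c \<phi> -` U \<inter> ?S = snd c ` ({w \<in> fst \<phi>. snd \<phi> w \<in> U} \<inter> fst c)"
    using transition_chart[OF c, of _ \<phi>] by (auto simp: image_iff)
  ultimately show "open (snd c ` ({w \<in> fst \<phi>. snd \<phi> w \<in> U} \<inter> fst c))" by simp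
qed

text \<open>A linear function of the coordinates whose derivative vanishes on the distribution is locally
  constant on an integral manifold: two nearby points are joined by a segment in the slice chart, which
  stays in the slice and is tangent to the distribution.\<close>

lemma integral_manifold_locally_constant:
  fixes g :: "'e \<Rightarrow> 'g::real_normed_vector"
  assumes T: "integral_manifold A D T" and z: "z \<in> topspace T" and c: "c \<in> A" "z \<in> fst c"
    and g: "bounded_linear g" "\<And>w X. w \<in> fst c \<Longrightarrow> X \<in> D w \<Longrightarrow> g (X c) = 0"
  obtains U where "openin T U" "z \<in> U" "U \<subseteq> fst c" "\<And>w. w \<in> U \<Longrightarrow> g (snd c w) = g (snd c z)"
proof -
  from T z obtain \<phi> E W where \<phi>: "compatible_chart A \<phi>" and E: "subspace E"
    and W: "openin T W" "z \<in> W" "W \<subseteq> fst \<phi>" "subtopology T W = subtopology (manifold_topology A) W"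
    and slice: "snd \<phi> ` W = {e \<in> snd \<phi> ` fst \<phi>. e - snd \<phi> z \<in> E}"
    and D: "\<And>w. w \<in> W \<Longrightarrow> D w = {X \<in> tangent_space A w. \<forall>c\<in>A. w \<in> fst c \<longrightarrow>
           frechet_derivative (transition c \<phi>) (at (snd c w)) (X c) \<in> E}"
    unfolding integral_manifold_def by meson
  interpret \<phi>: atlas "insert \<phi> A"
    using \<phi> by unfold_locales (simp add: compatible_chart_def)
  let ?O = "snd \<phi> ` (fst \<phi> \<inter> fst c)"
  have "open ?O" using \<phi>.overlap_open[of \<phi> c] c by simp
  moreover have "snd \<phi> z \<in> ?O" using W c by auto
  ultimately obtain r where r: "r > 0" "ball (snd \<phi> z) r \<subseteq> ?O" using open_contains_ball by blast
  define O' where "O' = {w \<in> fst \<phi>. snd \<phi> w \<in> ball (snd \<phi> z) r}"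
  have in_c: "w \<in> fst c" if "w \<in> fst \<phi>" "snd \<phi> w \<in> ball (snd \<phi> z) r" for w
    using r(2) that \<phi>.chart_inj[of \<phi>] by (auto dest!: subsetD dest: inj_onD)
  show thesis
  proof
    have "openin (manifold_topology A) O'"
      unfolding O'_def by (rule compatible_chart_preimage_open[OF \<phi>]) simp
    then have "openin (subtopology T W) (O' \<inter> W)"
      unfolding W(4) by (auto simp: openin_subtopology)
    then show "openin T (O' \<inter> W)" using W(1) openin_trans_full by blast
    show "z \<in> O' \<inter> W" using W r by (auto simp: O'_def)
    show "O' \<inter> W \<subseteq> fst c" using in_c by (auto simp: O'_def)
    fix w assume w: "w \<in> O' \<inter> W"
    define s where "s = snd \<phi> w - snd \<phi> z"
    have s: "s \<in> E" using slice w W(2) by (auto simp: s_def)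
    let ?e = "\<lambda>t. snd \<phi> z + t *\<^sub>R s"
    have "((\<lambda>t. g (transition \<phi> c (?e t))) has_vector_derivative 0) (at t within {0..1})" if t: "t \<in> {0..1}" for t
    proof -
      have "?e t = (1 - t) *\<^sub>R snd \<phi> z + t *\<^sub>R snd \<phi> w" by (simp add: s_def algebra_simps)
      also have "\<dots> \<in> ball (snd \<phi> z) r"
        using t r w by (intro convexD[OF convex_ball]) (auto simp: O'_def)
      finally have ball: "?e t \<in> ball (snd \<phi> z) r" .
      have "?e t - snd \<phi> z \<in> E" using s E by (simp add: subspace_scale)
      moreover have "?e t \<in> snd \<phi> ` fst \<phi>" using ball r(2) by blast
      ultimately have "?e t \<in> snd \<phi> ` W" using slice by blast
      then obtain y where y: "y \<in> W" "snd \<phi> y = ?e t" by auto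
      have yc: "y \<in> fst c" "y \<in> fst \<phi>" using in_c[of y] y ball W by auto
      define X where "X = vec_of A y \<phi> s"
      have "X \<in> tangent_space A y"
        using yc \<phi>.jacobian_cocycle[of \<phi>] by (auto simp: X_def tangent_space_def vec_of_def)
      moreover have "jacobian c' \<phi> y (X c') \<in> E" if "c' \<in> A" "y \<in> fst c'" for c'
        using that s yc \<phi>.jacobian_cocycle[of \<phi> c' \<phi> y s] \<phi>.jacobian_same[of \<phi> y s]
        by (simp add: X_def vec_of_def)
      ultimately have "X \<in> D y" using D[OF y(1)] by blast
      then have "g (X c) = 0" using g(2) yc by blast
      then have 0: "g (jacobian \<phi> c y s) = 0" using c yc by (simp add: X_def vec_of_def)
      have "(transition \<phi> c has_derivative jacobian \<phi> c y) (at (?e t))"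
        using \<phi>.transition_has_derivative[of \<phi> c y] c yc y by simp
      then have "((\<lambda>e. g (transition \<phi> c e)) has_derivative (\<lambda>v. g (jacobian \<phi> c y v))) (at (?e t))"
        by (rule bounded_linear.has_derivative[OF g(1)])
      moreover have "(?e has_derivative (\<lambda>t. t *\<^sub>R s)) (at t)"
        by (auto intro!: derivative_eq_intros)
      ultimately have "((\<lambda>t. g (transition \<phi> c (?e t))) has_derivative (\<lambda>t. g (jacobian \<phi> c y (t *\<^sub>R s)))) (at t)"
        using has_derivative_compose by blast
      moreover have "g (jacobian \<phi> c y (t *\<^sub>R s)) = 0" for t
        using 0 linear_scale[OF \<phi>.linear_jacobian[of \<phi> c y]] c yc linear_scale[OF bounded_linear.linear[OF g(1)]]
        by simp
      ultimately show ?thesis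
        by (simp add: has_vector_derivative_def has_derivative_at_withinI)
    qed
    then obtain d where "\<And>t. t \<in> {0..1} \<Longrightarrow> g (transition \<phi> c (?e t)) = d"
      using has_vector_derivative_zero_constant[of "{0..1::real}"] by (metis convex_real_interval(5))
    from this[of 0] this[of 1] have "g (transition \<phi> c (snd \<phi> z)) = g (transition \<phi> c (snd \<phi> w))"
      by (simp add: s_def)
    moreover have "w \<in> fst \<phi>" "z \<in> fst \<phi>" using w W(2,3) by auto
    ultimately show "g (snd c w) = g (snd c z)"
      using \<phi>.transition_chart[of \<phi> w c] \<phi>.transition_chart[of \<phi> z c] by simp
  qed
qed

end


section \<open>The leaves of the vertical bundle\<close>

lemma bt_chart_fst: "(x, y, p) \<in> fst (bt_chart A c) \<longleftrightarrow>
  x \<in> fst c \<and> y \<in> tangent_space A x \<and> y \<noteq> vec_zero \<and> p \<in> cotangent_space A x \<and> p \<noteq> vec_zero"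
  by (simp add: bt_chart_def)

lemma bt_chart_snd: "snd (bt_chart A c) (x, y, p) = (snd c x, y c, p c)"
  by (simp add: bt_chart_def)

text \<open>The vertical vector at \<open>z = (x, y, p)\<close> with components \<open>a\<close> and \<open>b\<close>, under the canonical
  identification of the fibre with \<open>T\<^sub>xM \<times> T\<^sup>*\<^sub>xM\<close>.\<close>

definition vertical_lift ::
  "('m, real ^ 'n) chart set \<Rightarrow> ('m, 'n::finite) bt_point \<Rightarrow> ('m, real ^ 'n) tvec \<Rightarrow> ('m, real ^ 'n) tvec \<Rightarrow>
   ('m, 'n) bt_vec" where
  "vertical_lift A z a b = (\<lambda>\<kappa>. if \<kappa> \<in> bt_atlas A \<and> z \<in> fst \<kappa> then (0, snd (snd \<kappa> (fst z, a, b))) else 0)"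

lemma vertical_lift_chart:
  "c \<in> A \<Longrightarrow> z \<in> fst (bt_chart A c) \<Longrightarrow> vertical_lift A z a b (bt_chart A c) = (0, a c, b c)"
  by (simp add: vertical_lift_def bt_chart_snd bt_atlas_def)

lemma nonzero_near_line:
  fixes u v :: "'a::real_normed_vector"
  assumes "u \<noteq> 0"
  shows "\<exists>\<delta>>0. \<forall>t. \<bar>t\<bar> < \<delta> \<longrightarrow> u + t *\<^sub>R v \<noteq> 0"
proof (intro exI conjI allI impI notI)
  show "norm u / (norm v + 1) > 0" using assms by (simp add: add_nonneg_pos)
  fix t assume t: "\<bar>t\<bar> < norm u / (norm v + 1)" and "u + t *\<^sub>R v = 0"
  then have "norm u = \<bar>t\<bar> * norm v" by (metis add_eq_0_iff norm_minus_cancel norm_scaleR)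
  also have "\<dots> \<le> \<bar>t\<bar> * (norm v + 1)" by (simp add: mult_left_mono)
  also have "\<dots> < norm u"
    using t by (subst (asm) pos_less_divide_eq) (auto simp: add_nonneg_pos)
  finally show False by simp
qed

locale big_tangent = base: atlas A + total: atlas "bt_atlas A"
  for A :: "('m, real ^ 'n) chart set"
begin

text \<open>A change of charts of the total space is linear on each fibre. Being differentiable, its
  derivative in a vertical direction can be read off from the line \<open>t \<mapsto> (x, y + t a, p + t b)\<close>.\<close>

lemma vertical_lift_jacobian:
  assumes "c \<in> A" "c' \<in> A" "z \<in> fst (bt_chart A c)" "z \<in> fst (bt_chart A c')"
    and a: "a \<in> tangent_space A (fst z)" and b: "b \<in> cotangent_space A (fst z)"
  shows "jacobian (bt_chart A c) (bt_chart A c') z (0, a c, b c) = (0, a c', b c')"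
proof -
  obtain x y p where z: "z = (x, y, p)" by (cases z)
  have \<kappa>: "bt_chart A c \<in> bt_atlas A" "bt_chart A c' \<in> bt_atlas A" using assms by (auto simp: bt_atlas_def)
  have x: "x \<in> fst c" "x \<in> fst c'" and y: "y \<in> tangent_space A x" "y \<noteq> vec_zero"
    and p: "p \<in> cotangent_space A x" "p \<noteq> vec_zero"
    using assms(3,4) by (auto simp: z bt_chart_fst)
  have a: "a \<in> tangent_space A x" and b: "b \<in> cotangent_space A x" using a b by (auto simp: z)
  have "y c \<noteq> 0" "p c \<noteq> 0"
    using base.tangent_nonzero_iff base.cotangent_nonzero_iff assms(1) x y p by blast+
  then obtain \<delta>1 \<delta>2 where \<delta>: "\<delta>1 > 0" "\<And>t. \<bar>t\<bar> < \<delta>1 \<Longrightarrow> y c + t *\<^sub>R a c \<noteq> 0"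
    "\<delta>2 > 0" "\<And>t. \<bar>t\<bar> < \<delta>2 \<Longrightarrow> p c + t *\<^sub>R b c \<noteq> 0"
    using nonzero_near_line[of "y c" "a c"] nonzero_near_line[of "p c" "b c"] by auto
  show ?thesis
  proof (rule derivative_eq_along_line[OF total.transition_has_derivative[OF \<kappa> assms(3,4)]])
    show "min \<delta>1 \<delta>2 > 0" using \<delta> by simp
    fix t assume t: "\<bar>t\<bar> < min \<delta>1 \<delta>2"
    define z' where "z' = (x, vec_add y (vec_scale t a), vec_add p (vec_scale t b))"
    have "vec_add y (vec_scale t a) \<noteq> vec_zero"
      using base.tangent_nonzero_iff[OF assms(1) x(1) base.tangent_add_scale[OF y(1) a]] \<delta> t
      by (simp add: vec_add_def vec_scale_def)
    moreover have "vec_add p (vec_scale t b) \<noteq> vec_zero"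
      using base.cotangent_nonzero_iff[OF assms(1) x(1) base.cotangent_add_scale[OF p(1) b]] \<delta> t
      by (simp add: vec_add_def vec_scale_def)
    ultimately have "z' \<in> fst (bt_chart A c)"
      using x base.tangent_add_scale[OF y(1) a] base.cotangent_add_scale[OF p(1) b]
      by (simp add: z'_def bt_chart_fst)
    from total.transition_chart[OF \<kappa>(1) this, of "bt_chart A c'"]
    show "transition (bt_chart A c) (bt_chart A c') (snd (bt_chart A c) z + t *\<^sub>R (0, a c, b c)) =
      (snd c' x, y c' + t *\<^sub>R a c', p c' + t *\<^sub>R b c')"
      by (simp add: z'_def z bt_chart_snd vec_add_def vec_scale_def)
  next
    have "((\<lambda>t. (snd c' x, y c' + t *\<^sub>R a c', p c' + t *\<^sub>R b c')) has_derivative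
       (\<lambda>t. (0, t *\<^sub>R a c', t *\<^sub>R b c'))) (at 0)"
      by (auto intro!: derivative_eq_intros)
    then show "((\<lambda>t. (snd c' x, y c' + t *\<^sub>R a c', p c' + t *\<^sub>R b c')) has_vector_derivative
       (0, a c', b c')) (at 0)"
      by (simp add: has_vector_derivative_def)
  qed
qed

lemma vertical_lift_vert:
  assumes a: "a \<in> tangent_space A (fst z)" and b: "b \<in> cotangent_space A (fst z)"
  shows "vertical_lift A z a b \<in> vert A z"
proof -
  have "vertical_lift A z a b \<kappa>' = jacobian \<kappa> \<kappa>' z (vertical_lift A z a b \<kappa>)"
    if \<kappa>: "\<kappa> \<in> bt_atlas A" "\<kappa>' \<in> bt_atlas A" "z \<in> fst \<kappa>" "z \<in> fst \<kappa>'" for \<kappa> \<kappa>'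
  proof -
    obtain c c' where "c \<in> A" "\<kappa> = bt_chart A c" "c' \<in> A" "\<kappa>' = bt_chart A c'"
      using \<kappa>(1,2) by (auto simp: bt_atlas_def)
    then show ?thesis
      using vertical_lift_jacobian[OF _ _ _ _ a b, of c c'] \<kappa>
      by (simp add: vertical_lift_chart)
  qed
  moreover have "vertical_lift A z a b \<kappa> = 0" if "\<not> (\<kappa> \<in> bt_atlas A \<and> z \<in> fst \<kappa>)" for \<kappa>
    unfolding vertical_lift_def using that by (rule if_not_P)
  moreover have "fst (vertical_lift A z a b \<kappa>) = 0" for \<kappa>
    by (simp add: vertical_lift_def)
  ultimately show ?thesis unfolding vert_def tangent_space_def by blast
qed

text \<open>A tangent vector without base component in one chart is a vertical lift there, and vertical lifts
  have no base component in any chart.\<close>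

lemma vert_iff_chart:
  assumes c: "c \<in> A" "z \<in> fst (bt_chart A c)" and X: "X \<in> tangent_space (bt_atlas A) z"
  shows "X \<in> vert A z \<longleftrightarrow> fst (X (bt_chart A c)) = 0"
proof
  have \<kappa>: "bt_chart A c \<in> bt_atlas A" using c by (simp add: bt_atlas_def)
  then show "fst (X (bt_chart A c)) = 0" if "X \<in> vert A z" using that c by (auto simp: vert_def)
  assume 0: "fst (X (bt_chart A c)) = 0"
  have x: "fst z \<in> fst c" using c by (cases z) (simp add: bt_chart_fst)
  define a b where "a = vec_of A (fst z) c (fst (snd (X (bt_chart A c))))"
    and "b = covec_of A (fst z) c (snd (snd (X (bt_chart A c))))"
  have ab: "a \<in> tangent_space A (fst z)" "b \<in> cotangent_space A (fst z)"
    using base.vec_of_tangent base.covec_of_cotangent c x by (auto simp: a_def b_def)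
  have "vertical_lift A z a b (bt_chart A c) = X (bt_chart A c)"
    using c x 0 by (simp add: vertical_lift_chart a_def b_def base.vec_of_chart base.covec_of_chart prod_eq_iff)
  moreover have "vertical_lift A z a b \<in> tangent_space (bt_atlas A) z"
    using vertical_lift_vert[OF ab] by (simp add: vert_def)
  ultimately have "X = vertical_lift A z a b"
    using total.tangent_eqI[OF \<kappa> c(2) X] by simp
  then show "X \<in> vert A z" using vertical_lift_vert[OF ab] by simp
qed

definition fibre :: "'m \<Rightarrow> ('m, 'n) bt_point set" where
  "fibre x = {z \<in> points (bt_atlas A). fst z = x}"

lemma fibre_iff: "(x', y, p) \<in> fibre x \<longleftrightarrow> x' = x \<and> x \<in> points A \<and>
    y \<in> tangent_space A x \<and> y \<noteq> vec_zero \<and> p \<in> cotangent_space A x \<and> p \<noteq> vec_zero"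
  by (auto simp: fibre_def points_def bt_atlas_def bt_chart_def)

lemma fibre_subset_chart: "c \<in> A \<Longrightarrow> x \<in> fst c \<Longrightarrow> fibre x \<subseteq> fst (bt_chart A c)"
  by (auto simp: fibre_iff bt_chart_fst)

lemma chart_image_fibre:
  assumes "c \<in> A" "x \<in> fst c"
  shows "snd (bt_chart A c) ` fibre x = {snd c x} \<times> (- {0}) \<times> (- {0})"
proof (intro equalityI subsetI)
  fix e assume "e \<in> snd (bt_chart A c) ` fibre x"
  then show "e \<in> {snd c x} \<times> (- {0}) \<times> (- {0})"
    using base.tangent_nonzero_iff[OF assms] base.cotangent_nonzero_iff[OF assms]
    by (force simp: fibre_iff bt_chart_snd)
next
  fix e assume e: "e \<in> {snd c x} \<times> (- {0 :: real ^ 'n}) \<times> (- {0 :: real ^ 'n})"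
  then obtain v q where vq: "e = (snd c x, v, q)" "v \<noteq> 0" "q \<noteq> 0" by auto
  have "vec_of A x c v \<noteq> vec_zero" "covec_of A x c q \<noteq> vec_zero"
    using vq base.vec_of_chart[OF assms, of v] base.covec_of_chart[OF assms, of q]
    by (auto simp: vec_zero_def)
  then have "(x, vec_of A x c v, covec_of A x c q) \<in> fibre x"
    using assms base.vec_of_tangent[OF assms] base.covec_of_cotangent[OF assms]
    by (auto simp: fibre_iff points_def)
  moreover have "snd (bt_chart A c) (x, vec_of A x c v, covec_of A x c q) = e"
    using assms vq by (simp add: bt_chart_snd base.vec_of_chart base.covec_of_chart)
  ultimately show "e \<in> snd (bt_chart A c) ` fibre x" by (metis imageI)
qed

lemma fibre_connected:
  assumes "c \<in> A" "x \<in> fst c" "CARD('n) \<ge> 2"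
  shows "connectedin (manifold_topology (bt_atlas A)) (fibre x)"
proof -
  let ?\<kappa> = "bt_chart A c"
  have \<kappa>: "?\<kappa> \<in> bt_atlas A" using assms by (simp add: bt_atlas_def)
  have "connected (- {0 :: real ^ 'n})"
    using assms(3) by (simp add: connected_punctured_universe)
  then have "connected (snd ?\<kappa> ` fibre x)"
    unfolding chart_image_fibre[OF assms(1,2)] by (intro connected_Times) auto
  then have "connectedin (top_of_set (snd ?\<kappa> ` fst ?\<kappa>)) (snd ?\<kappa> ` fibre x)"
    using fibre_subset_chart[OF assms(1,2)] by (auto simp: connectedin_subtopology)
  from connectedin_continuous_map_image[OF total.continuous_map_chart_inv[OF \<kappa>] this]
  have "connectedin (manifold_topology (bt_atlas A)) (chart_inv ?\<kappa> ` snd ?\<kappa> ` fibre x)" .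
  moreover have "chart_inv ?\<kappa> ` snd ?\<kappa> ` fibre x = fibre x"
    using total.inv_chart[OF \<kappa>] fibre_subset_chart[OF assms(1,2)] by (force simp: image_image)
  ultimately show ?thesis by simp
qed

text \<open>The slice chart is the coordinate chart itself: the fibre is where the base coordinates are
  constant.\<close>

lemma fibre_integral_manifold:
  assumes c: "c \<in> A" "x \<in> fst c"
  shows "integral_manifold (bt_atlas A) (vert A) (subtopology (manifold_topology (bt_atlas A)) (fibre x))"
    (is "integral_manifold _ _ ?T")
  unfolding integral_manifold_def
proof (intro conjI ballI)
  let ?\<kappa> = "bt_chart A c"
  let ?E = "{e :: 'n bt_coords. fst e = 0}"
  have \<kappa>: "?\<kappa> \<in> bt_atlas A" using c by (simp add: bt_atlas_def)
  have top: "topspace ?T = fibre x"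
    by (auto simp: total.topspace_manifold_topology fibre_def)
  show "topspace ?T \<subseteq> points (bt_atlas A)" unfolding top by (auto simp: fibre_def)
  fix z assume z: "z \<in> topspace ?T"
  show "\<exists>\<phi> E W. compatible_chart (bt_atlas A) \<phi> \<and> subspace E \<and> openin ?T W \<and> z \<in> W \<and> W \<subseteq> fst \<phi> \<and>
        subtopology ?T W = subtopology (manifold_topology (bt_atlas A)) W \<and>
        snd \<phi> ` W = {e \<in> snd \<phi> ` fst \<phi>. e - snd \<phi> z \<in> E} \<and>
        (\<forall>w\<in>W. vert A w = {X \<in> tangent_space (bt_atlas A) w. \<forall>c\<in>bt_atlas A. w \<in> fst c \<longrightarrow>
           frechet_derivative (transition c \<phi>) (at (snd c w)) (X c) \<in> E})"
  proof (intro exI conjI ballI)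
    show "compatible_chart (bt_atlas A) ?\<kappa>"
      using \<kappa> total.smooth_atlas by (auto simp: compatible_chart_def points_def insert_absorb)
    show "subspace ?E" by (auto simp: subspace_def)
    show "openin ?T (fibre x)" using top openin_topspace by metis
    show "z \<in> fibre x" using z top by simp
    show "fibre x \<subseteq> fst ?\<kappa>" by (rule fibre_subset_chart[OF c])
    show "subtopology ?T (fibre x) = subtopology (manifold_topology (bt_atlas A)) (fibre x)"
      by (simp add: subtopology_subtopology)
    have zx: "fst (snd ?\<kappa> z) = snd c x" using z top by (cases z) (simp add: fibre_iff bt_chart_snd)
    show "snd ?\<kappa> ` fibre x = {e \<in> snd ?\<kappa> ` fst ?\<kappa>. e - snd ?\<kappa> z \<in> ?E}"
    proof (intro equalityI subsetI)
      fix e assume "e \<in> snd ?\<kappa> ` fibre x"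
      moreover from this have "fst e = snd c x" unfolding chart_image_fibre[OF c] by auto
      ultimately show "e \<in> {e \<in> snd ?\<kappa> ` fst ?\<kappa>. e - snd ?\<kappa> z \<in> ?E}"
        using fibre_subset_chart[OF c] zx by auto
    next
      fix e assume "e \<in> {e \<in> snd ?\<kappa> ` fst ?\<kappa>. e - snd ?\<kappa> z \<in> ?E}"
      then obtain w where w: "w \<in> fst ?\<kappa>" "e = snd ?\<kappa> w" "fst (snd ?\<kappa> w) = snd c x" using zx by auto
      obtain x' y p where [simp]: "w = (x', y, p)" by (cases w)
      have "x' = x"
        using w c base.chart_inj[OF c(1)] by (auto simp: bt_chart_fst bt_chart_snd inj_on_def)
      then have "w \<in> fibre x" using w c by (auto simp: bt_chart_fst fibre_iff points_def)
      then show "e \<in> snd ?\<kappa> ` fibre x" using w by blast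
    qed
    fix w assume "w \<in> fibre x"
    then have w: "w \<in> fst ?\<kappa>" using fibre_subset_chart[OF c] by blast
    have "X \<in> vert A w \<longleftrightarrow> (\<forall>c\<in>bt_atlas A. w \<in> fst c \<longrightarrow> jacobian c ?\<kappa> w (X c) \<in> ?E)"
      if X: "X \<in> tangent_space (bt_atlas A) w" for X
    proof -
      have "X ?\<kappa> = jacobian \<kappa>' ?\<kappa> w (X \<kappa>')" if "\<kappa>' \<in> bt_atlas A" "w \<in> fst \<kappa>'" for \<kappa>'
        using X that \<kappa> w unfolding tangent_space_def by blast
      then have "(\<forall>c\<in>bt_atlas A. w \<in> fst c \<longrightarrow> jacobian c ?\<kappa> w (X c) \<in> ?E) \<longleftrightarrow> X ?\<kappa> \<in> ?E"
        using \<kappa> w by metis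
      then show ?thesis unfolding vert_iff_chart[OF c(1) w X] by simp
    qed
    moreover have "vert A w \<subseteq> tangent_space (bt_atlas A) w" by (auto simp: vert_def)
    ultimately show "vert A w = {X \<in> tangent_space (bt_atlas A) w. \<forall>c\<in>bt_atlas A. w \<in> fst c \<longrightarrow>
           jacobian c ?\<kappa> w (X c) \<in> ?E}" by blast
  qed
qed

text \<open>The base point is locally constant on an integral manifold of the vertical bundle.\<close>

lemma connected_integral_manifold_in_fibre:
  assumes T: "integral_manifold (bt_atlas A) (vert A) T" "connected_space T"
    and z: "z \<in> topspace T" "w \<in> topspace T"
  shows "fst w = fst z"
proof -
  have loc: "\<exists>U. openin T U \<and> w \<in> U \<and> (\<forall>w'\<in>U. fst w' = fst w)" if w: "w \<in> topspace T" for w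
  proof -
    have "w \<in> points (bt_atlas A)" using T(1) w unfolding integral_manifold_def by blast
    then obtain c where c: "c \<in> A" "w \<in> fst (bt_chart A c)" by (auto simp: points_def bt_atlas_def)
    have \<kappa>: "bt_chart A c \<in> bt_atlas A" using c by (simp add: bt_atlas_def)
    have v0: "fst (X (bt_chart A c)) = 0" if "w' \<in> fst (bt_chart A c)" "X \<in> vert A w'" for w' X
      using that \<kappa> by (auto simp: vert_def)
    obtain U where U: "openin T U" "w \<in> U" "U \<subseteq> fst (bt_chart A c)"
      "\<And>w'. w' \<in> U \<Longrightarrow> fst (snd (bt_chart A c) w') = fst (snd (bt_chart A c) w)"
      using total.integral_manifold_locally_constant[OF T(1) w \<kappa> c(2) bounded_linear_fst, of thesis] v0
      by blast
    have "fst w' = fst w" if "w' \<in> U" for w'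
    proof -
      have "w' \<in> fst (bt_chart A c)" using U(3) that by blast
      then show ?thesis
        using U(4)[OF that] c(2) inj_onD[OF base.chart_inj[OF c(1)], of "fst w'" "fst w"]
        by (cases w; cases w') (simp add: bt_chart_fst bt_chart_snd)
    qed
    then show ?thesis using U by blast
  qed
  let ?S = "{w \<in> topspace T. fst w = fst z}"
  have op: "openin T {w \<in> topspace T. Q (fst w)}" for Q
  proof (subst openin_subopen, intro ballI)
    fix w assume w: "w \<in> {w \<in> topspace T. Q (fst w)}"
    then obtain U where U: "openin T U" "w \<in> U" "\<forall>w'\<in>U. fst w' = fst w" using loc by blast
    have "U \<subseteq> {w \<in> topspace T. Q (fst w)}" using U(3) w openin_subset[OF U(1)] by auto
    then show "\<exists>U. openin T U \<and> w \<in> U \<and> U \<subseteq> {w \<in> topspace T. Q (fst w)}" using U by blast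
  qed
  have "openin T ?S" by (rule op)
  moreover have "topspace T - ?S = {w \<in> topspace T. fst w \<noteq> fst z}" by blast
  then have "openin T (topspace T - ?S)" using op[of "\<lambda>x. x \<noteq> fst z"] by simp
  then have "closedin T ?S" by (auto simp: closedin_def)
  ultimately have "?S = {} \<or> ?S = topspace T"
    using T(2) connected_space_clopen_in by blast
  then show ?thesis using z by blast
qed

end

text \<open>A leaf of the vertical bundle is a full fibre: it lies in one by connectedness, and the fibre
  is itself a connected integral manifold, so maximality gives equality.\<close>

lemma vert_leaf:
  fixes A :: "('m, real ^ 'n) chart set"
  assumes "smooth_atlas A" "CARD('n) \<ge> 2" "leaf_of (bt_atlas A) (vert A) P"
  obtains x where "big_tangent A" "x \<in> points A" "P = big_tangent.fibre A x"
proof -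
  interpret base: atlas A by unfold_locales (rule assms(1))
  obtain T where T: "topspace T = P" "integral_manifold (bt_atlas A) (vert A) T" "connected_space T"
    and max: "\<And>T'. integral_manifold (bt_atlas A) (vert A) T' \<Longrightarrow> connected_space T' \<Longrightarrow>
        P \<subseteq> topspace T' \<Longrightarrow> topspace T' = P"
    and "P \<noteq> {}"
    using assms(3) unfolding leaf_of_def by blast
  then obtain z where z: "z \<in> P" by blast
  \<comment> \<open>Compatibility of any slice chart contains the smoothness of the induced atlas, so the coordinate
    changes of the total space need not be differentiated by hand.\<close>
  then obtain \<phi> where "compatible_chart (bt_atlas A) \<phi>"
    using T unfolding integral_manifold_def by blast
  then have "smooth_atlas (bt_atlas A)"
    unfolding compatible_chart_def smooth_atlas_def by blast
  then interpret total: atlas "bt_atlas A" by unfold_locales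
  interpret big_tangent A by unfold_locales
  have P: "P \<subseteq> points (bt_atlas A)" using T unfolding integral_manifold_def by blast
  then obtain c where c: "c \<in> A" "fst z \<in> fst c"
    using z by (cases z) (auto simp: points_def bt_atlas_def bt_chart_fst)
  let ?T = "subtopology (manifold_topology (bt_atlas A)) (fibre (fst z))"
  have top: "topspace ?T = fibre (fst z)"
    by (auto simp: total.topspace_manifold_topology fibre_def)
  have "P \<subseteq> fibre (fst z)"
  proof
    fix w assume w: "w \<in> P"
    then have "fst w = fst z"
      using connected_integral_manifold_in_fibre[OF T(2,3), of z w] T(1) z by simp
    then show "w \<in> fibre (fst z)" using w P by (simp add: fibre_def subsetD)
  qed
  moreover have "connected_space ?T"
    using fibre_connected[OF c assms(2)] by (simp add: connectedin_def)
  ultimately have "topspace ?T = P"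
    using max[OF fibre_integral_manifold[OF c]] unfolding top by blast
  then show thesis
    using that[of "fst z"] c top big_tangent_axioms by (auto simp: points_def)
qed


section \<open>Fibre coordinates\<close>

lemma Ck_empty: "Ck k {} f"
  by (induction k arbitrary: f) auto

abbreviation punctured_pairs :: "((real ^ 'n) \<times> (real ^ 'n)) set" where
  "punctured_pairs \<equiv> (- {0}) \<times> (- {0})"

lemma open_punctured_pairs: "open punctured_pairs"
  by (intro open_Times open_punctured)

definition fibre_coords :: "('m, real ^ 'n) chart \<Rightarrow> ('m, 'n) bt_point \<Rightarrow> (real ^ 'n) \<times> (real ^ 'n)" where
  "fibre_coords c z = (fst (snd z) c, snd (snd z) c)"

context big_tangent
begin

definition fibre_point :: "'m \<Rightarrow> ('m, real ^ 'n) chart \<Rightarrow> (real ^ 'n) \<times> (real ^ 'n) \<Rightarrow> ('m, 'n) bt_point" where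
  "fibre_point x c u = (x, vec_of A x c (fst u), covec_of A x c (snd u))"

lemma fibre_coords_point:
  "c \<in> A \<Longrightarrow> x \<in> fst c \<Longrightarrow> fibre_coords c (fibre_point x c u) = u"
  by (simp add: fibre_coords_def fibre_point_def base.vec_of_chart base.covec_of_chart)

lemma fibre_point_coords:
  "c \<in> A \<Longrightarrow> x \<in> fst c \<Longrightarrow> z \<in> fibre x \<Longrightarrow> fibre_point x c (fibre_coords c z) = z"
  using base.tangent_eq_vec_of base.cotangent_eq_covec_of
  by (cases z) (auto simp: fibre_coords_def fibre_point_def fibre_iff)

lemma fibre_coords_nonzero:
  "c \<in> A \<Longrightarrow> x \<in> fst c \<Longrightarrow> z \<in> fibre x \<Longrightarrow> fibre_coords c z \<in> punctured_pairs"
  using base.tangent_nonzero_iff[of c x "fst (snd z)"] base.cotangent_nonzero_iff[of c x "snd (snd z)"]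
  by (cases z) (auto simp: fibre_coords_def fibre_iff)

lemma fibre_point_in_fibre:
  assumes "c \<in> A" "x \<in> fst c" "u \<in> punctured_pairs"
  shows "fibre_point x c u \<in> fibre x"
  using assms base.vec_of_tangent[OF assms(1,2)] base.covec_of_cotangent[OF assms(1,2)]
    base.tangent_nonzero_iff[OF assms(1,2) base.vec_of_tangent[OF assms(1,2)]]
    base.cotangent_nonzero_iff[OF assms(1,2) base.covec_of_cotangent[OF assms(1,2)]]
  by (auto simp: fibre_point_def fibre_iff base.vec_of_chart base.covec_of_chart points_def)

lemma leaf_chart_fibre:
  assumes "c \<in> A" "x \<in> fst c"
  shows "fst (leaf_chart (fibre x) (bt_chart A c)) = fibre x"
    and "snd (leaf_chart (fibre x) (bt_chart A c)) z = fibre_coords c z"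
  using fibre_subset_chart[OF assms]
  by (auto simp: leaf_chart_def fibre_coords_def bt_chart_def split: prod.splits)

lemma leaf_chart_image:
  assumes "c \<in> A" "x \<in> fst c"
  shows "snd (leaf_chart (fibre x) (bt_chart A c)) ` fst (leaf_chart (fibre x) (bt_chart A c)) = punctured_pairs"
proof -
  have "fibre_coords c ` fibre x = punctured_pairs"
  proof (intro equalityI subsetI)
    show "u \<in> punctured_pairs" if "u \<in> fibre_coords c ` fibre x" for u
      using that fibre_coords_nonzero[OF assms] by blast
    show "u \<in> fibre_coords c ` fibre x" if "u \<in> punctured_pairs" for u
      using fibre_coords_point[OF assms, of u] fibre_point_in_fibre[OF assms that] by (metis imageI)
  qed
  then show ?thesis by (simp add: leaf_chart_fibre[OF assms] cong: image_cong)
qed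

lemma chart_inv_leaf_chart:
  assumes "c \<in> A" "x \<in> fst c" "u \<in> punctured_pairs"
  shows "chart_inv (leaf_chart (fibre x) (bt_chart A c)) u = fibre_point x c u"
proof -
  have "inj_on (fibre_coords c) (fibre x)"
    using fibre_point_coords[OF assms(1,2)] by (rule inj_on_inverseI)
  then have "inj_on (snd (leaf_chart (fibre x) (bt_chart A c))) (fst (leaf_chart (fibre x) (bt_chart A c)))"
    unfolding leaf_chart_fibre(1)[OF assms(1,2)]
    by (simp add: inj_on_def leaf_chart_fibre(2)[OF assms(1,2)])
  from chart_inv_left[OF this, of "fibre_point x c u"] show ?thesis
    using fibre_point_in_fibre[OF assms]
    by (simp add: leaf_chart_fibre[OF assms(1,2)] fibre_coords_point[OF assms(1,2)])
qed

text \<open>The vertical field on the fibre over \<open>x\<close> with coefficients \<open>\<xi>\<close> in the chart \<open>c\<close>.\<close>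

definition coord_field ::
  "'m \<Rightarrow> ('m, real ^ 'n) chart \<Rightarrow> ((real ^ 'n) \<times> (real ^ 'n) \<Rightarrow> (real ^ 'n) \<times> (real ^ 'n)) \<Rightarrow>
   ('m, 'n) bt_field" where
  "coord_field x c \<xi> z = vertical_lift A z (vec_of A x c (fst (\<xi> (fibre_coords c z))))
     (covec_of A x c (snd (\<xi> (fibre_coords c z))))"

lemma coord_field_chart:
  assumes "c \<in> A" "x \<in> fst c" "z \<in> fibre x"
  shows "coord_field x c \<xi> z (bt_chart A c) = (0, \<xi> (fibre_coords c z))"
  using fibre_subset_chart[OF assms(1,2)] assms
  by (auto simp: coord_field_def vertical_lift_chart base.vec_of_chart base.covec_of_chart)

lemma coord_field_vert:
  assumes "c \<in> A" "x \<in> fst c" "z \<in> fibre x"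
  shows "coord_field x c \<xi> z \<in> vert A z"
proof -
  have "fst z = x" using assms by (simp add: fibre_def)
  then show ?thesis
    unfolding coord_field_def
    using vertical_lift_vert base.vec_of_tangent[OF assms(1,2)] base.covec_of_cotangent[OF assms(1,2)]
    by simp
qed

text \<open>In another chart the coefficients are changed by the linear coordinate change, so
  smoothness in one chart suffices.\<close>

lemma coord_field_leaf_field:
  assumes c: "c \<in> A" "x \<in> fst c" and \<xi>: "\<And>k. Ck k punctured_pairs \<xi>"
  shows "coord_field x c \<xi> \<in> leaf_fields A (fibre x)"
proof -
  have "smooth_on (snd (leaf_chart (fibre x) \<kappa>) ` fst (leaf_chart (fibre x) \<kappa>))
      (leaf_coeffs (fibre x) \<kappa> (coord_field x c \<xi>))" if "\<kappa> \<in> bt_atlas A" for \<kappa>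
  proof -
    obtain c' where c': "c' \<in> A" "\<kappa> = bt_chart A c'" using \<open>\<kappa> \<in> bt_atlas A\<close> unfolding bt_atlas_def by blast
    show ?thesis
    proof (cases "x \<in> fst c'")
      case False
      then have "fst (leaf_chart (fibre x) \<kappa>) = {}"
        by (auto simp: c' leaf_chart_def fibre_iff bt_chart_fst)
      then show ?thesis by (simp add: smooth_on_def Ck_empty)
    next
      case True
      define \<Lambda> where "\<Lambda> d d' w = (vec_of A x d (fst w) d', covec_of A x d (snd w) d')"
        for d d' :: "('m, real ^ 'n) chart" and w :: "(real ^ 'n) \<times> (real ^ 'n)"
      have \<Lambda>: "bounded_linear (\<Lambda> d d')" if "d \<in> A" "d' \<in> A" "x \<in> fst d" "x \<in> fst d'" for d d'
      proof -
        have "\<Lambda> d d' = (\<lambda>w. (jacobian d d' x (fst w), adjoint (jacobian d' d x) (snd w)))"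
          using that by (auto simp: \<Lambda>_def vec_of_def covec_of_def)
        moreover have "linear (jacobian d d' x)" "linear (adjoint (jacobian d' d x))"
          using that by (auto intro: base.linear_jacobian adjoint_linear)
        ultimately show ?thesis
          by (auto intro!: bounded_linear_Pair intro: bounded_linear_compose[of _ fst] bounded_linear_compose[of _ snd]
              bounded_linear_fst bounded_linear_snd simp: linear_conv_bounded_linear)
      qed
      have coords: "fibre_coords c (fibre_point x c' u) = \<Lambda> c' c u" for u
        by (simp add: fibre_coords_def fibre_point_def \<Lambda>_def)
      have eq: "\<Lambda> c c' (\<xi> (\<Lambda> c' c u)) = leaf_coeffs (fibre x) \<kappa> (coord_field x c \<xi>) u"
        if u: "u \<in> punctured_pairs" for u
        using fibre_point_in_fibre[OF c'(1) True u] fibre_subset_chart[OF c'(1) True] c'(1)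
        by (auto simp: leaf_coeffs_def c'(2) chart_inv_leaf_chart[OF c'(1) True u] coord_field_def
            vertical_lift_chart coords \<Lambda>_def)
      have "Ck k punctured_pairs (\<lambda>u. \<Lambda> c c' (\<xi> (\<Lambda> c' c u)))" for k
      proof (rule Ck_bounded_linear[OF open_punctured_pairs \<Lambda>])
        have "\<Lambda> c' c ` punctured_pairs \<subseteq> punctured_pairs"
          using fibre_coords_nonzero[OF c] fibre_point_in_fibre[OF c'(1) True] coords
          by (metis image_subsetI)
        then show "Ck k punctured_pairs (\<lambda>u. \<xi> (\<Lambda> c' c u))"
          using Ck_compose[OF open_punctured_pairs open_punctured_pairs _ Ck_linear[OF \<Lambda>] \<xi>] c c' True
          by blast
      qed (use c c' True in simp_all)
      then have "Ck k punctured_pairs (leaf_coeffs (fibre x) \<kappa> (coord_field x c \<xi>))" for k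
        by (rule Ck_eq_on_open[OF open_punctured_pairs]) (rule eq)
      then have "smooth_on punctured_pairs (leaf_coeffs (fibre x) \<kappa> (coord_field x c \<xi>))"
        by (simp add: smooth_on_def)
      then show ?thesis
        using leaf_chart_image[OF c'(1) True] c'(2) by simp
    qed
  qed
  then show ?thesis using coord_field_vert[OF c] by (simp add: leaf_fields_def)
qed

lemma leaf_coeffs_coord_field:
  assumes "c \<in> A" "x \<in> fst c" "u \<in> punctured_pairs"
  shows "leaf_coeffs (fibre x) (bt_chart A c) (coord_field x c \<xi>) u = \<xi> u"
  using fibre_point_in_fibre[OF assms]
  by (simp add: leaf_coeffs_def chart_inv_leaf_chart[OF assms] coord_field_chart[OF assms(1,2)]
      fibre_coords_point[OF assms(1,2)])

lemma leaf_deriv_coord_field: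
  assumes c: "c \<in> A" "x \<in> fst c" and z: "z \<in> fibre x"
    and h: "Ck 1 punctured_pairs h" "\<And>u. u \<in> punctured_pairs \<Longrightarrow> g u = h u"
  shows "leaf_deriv (fibre x) (bt_chart A c) (coord_field x c \<xi>) g z =
    frechet_derivative h (at (fibre_coords c z)) (\<xi> (fibre_coords c z))"
proof -
  have u: "fibre_coords c z \<in> punctured_pairs" by (rule fibre_coords_nonzero[OF c z])
  have "h differentiable at (fibre_coords c z)"
    using Ck_Suc_has_derivative[OF h(1)[unfolded One_nat_def] u] by (rule differentiableI)
  then have "frechet_derivative h (at (fibre_coords c z)) = frechet_derivative g (at (fibre_coords c z))"
    by (rule frechet_derivative_transform_within_open[OF _ open_punctured_pairs u]) (simp only: h(2))
  then show ?thesis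
    by (simp add: leaf_deriv_def leaf_chart_fibre[OF c] coord_field_chart[OF c z])
qed

lemma leaf_deriv_leaf_coeffs:
  assumes c: "c \<in> A" "x \<in> fst c" and z: "z \<in> fibre x" and \<eta>: "Ck 1 punctured_pairs \<eta>"
  shows "leaf_deriv (fibre x) (bt_chart A c) (coord_field x c \<xi>)
      (leaf_coeffs (fibre x) (bt_chart A c) (coord_field x c \<eta>)) z =
    frechet_derivative \<eta> (at (fibre_coords c z)) (\<xi> (fibre_coords c z))"
  by (rule leaf_deriv_coord_field[OF c z \<eta>]) (rule leaf_coeffs_coord_field[OF c])

lemma liouville_coord_field:
  assumes c: "c \<in> A" "x \<in> fst c" and z: "z \<in> fibre x"
  shows "liouville1 A z = coord_field x c (\<lambda>u. (fst u, 0)) z"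
    and "liouville2 A z = coord_field x c (\<lambda>u. (0, snd u)) z"
proof -
  obtain y p where zyp: "z = (x, y, p)" using z by (cases z) (auto simp: fibre_iff)
  have y: "y = vec_of A x c (y c)" and p: "p = covec_of A x c (p c)"
    using base.tangent_eq_vec_of base.cotangent_eq_covec_of c z by (auto simp: zyp fibre_iff)
  note 0 = base.vec_of_zero[OF c] base.covec_of_zero[OF c]
  have *: "snd (snd \<kappa> (x, y, vec_zero)) = (fst (snd (snd \<kappa> z)), 0)"
    "snd (snd \<kappa> (x, vec_zero, p)) = (0, snd (snd (snd \<kappa> z)))" if "\<kappa> \<in> bt_atlas A" for \<kappa>
    using that by (auto simp: bt_atlas_def bt_chart_def zyp vec_zero_def)
  show "liouville1 A z = coord_field x c (\<lambda>u. (fst u, 0)) z"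
    by (intro ext) (simp add: coord_field_def liouville1_def vertical_lift_def fibre_coords_def 0 zyp
        y[symmetric] *(1)[unfolded zyp])
  show "liouville2 A z = coord_field x c (\<lambda>u. (0, snd u)) z"
    by (intro ext) (simp add: coord_field_def liouville2_def vertical_lift_def fibre_coords_def 0 zyp
        p[symmetric] *(2)[unfolded zyp])
qed

end


section \<open>The Levi-Civita connection of a fibre\<close>

text \<open>The computation takes place on a single fibre, in the chart \<open>c\<close> that is used to evaluate the
  metric there.\<close>

locale finsler_fibre = big_tangent A
  for A :: "('m, real ^ 'n) chart set" +
  fixes F K :: "'m \<times> ('m, real ^ 'n) tvec \<Rightarrow> real" and x :: 'm and c :: "('m, real ^ 'n) chart"
  assumes card: "CARD('n) \<ge> 2"
    and finsler: "finsler_structure A F" and cartan: "dual_cartan_structure A F K"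
    and c: "c \<in> A" "x \<in> fst c" and chart_at: "chart_at A x = c"
begin

text \<open>The functions \<open>f\<close> and \<open>k\<close> are \<open>F\<close> and \<open>K\<close> on the fibre over \<open>x\<close>, in the coordinates of \<open>c\<close>.\<close>

definition f :: "real ^ 'n \<Rightarrow> real" where
  "f v = F (x, vec_of A x c v)"

definition k :: "real ^ 'n \<Rightarrow> real" where
  "k q = K (x, covec_of A x c q)"

lemma vec_of_nonzero: "v \<noteq> 0 \<Longrightarrow> vec_of A x c v \<noteq> vec_zero"
  using base.vec_of_chart[OF c, of v] by (auto simp: vec_zero_def)

lemma finsler_g_eq: "finsler_g A F c x y i j = fundamental_tensor f (y c) i j"
  by (simp add: finsler_g_def fundamental_tensor_def f_def[abs_def])

lemma cartan_g_eq: "cartan_g A K c x p i j = fundamental_tensor k (p c) i j"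
  by (simp add: cartan_g_def fundamental_tensor_def k_def[abs_def])

lemma Ck_f: "Ck m (- {0}) f"
proof -
  \<comment> \<open>The chart of the tangent bundle induced by \<open>c\<close>; its image contains the punctured fibre as
    \<open>{snd c x} \<times> (- {0})\<close>.\<close>
  define \<tau> where "\<tau> = ({(x, v). x \<in> fst c \<and> v \<in> tangent_space A x}, \<lambda>(x, v :: ('m, real ^ 'n) tvec). (snd c x, v c))"
  define S where "S = snd c ` fst c \<times> (- {0 :: real ^ 'n})"
  have "open S" unfolding S_def by (intro open_Times base.chart_open c open_punctured)
  have "\<tau> \<in> tangent_atlas A" unfolding \<tau>_def tangent_atlas_def using c by blast
  then have "smooth_on (snd \<tau> ` (tangent_bundle0 A \<inter> fst \<tau>)) (F \<circ> chart_inv \<tau>)"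
    using finsler unfolding finsler_structure_def smooth_fun_def by blast
  moreover have "S \<subseteq> snd \<tau> ` (tangent_bundle0 A \<inter> fst \<tau>)"
  proof
    fix e assume "e \<in> S"
    then obtain w v where wv: "w \<in> fst c" "v \<noteq> 0" "e = (snd c w, v)" by (auto simp: S_def)
    have "vec_of A w c v \<noteq> vec_zero"
      using base.vec_of_chart[OF c(1) wv(1), of v] wv(2) by (auto simp: vec_zero_def)
    then have "(w, vec_of A w c v) \<in> tangent_bundle0 A \<inter> fst \<tau>"
      using wv c base.vec_of_tangent[OF c(1) wv(1)]
      by (auto simp: \<tau>_def tangent_bundle0_def tangent_bundle_def points_def)
    moreover have "snd \<tau> (w, vec_of A w c v) = e"
      using base.vec_of_chart[OF c(1) wv(1)] wv by (simp add: \<tau>_def)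
    ultimately show "e \<in> snd \<tau> ` (tangent_bundle0 A \<inter> fst \<tau>)" by (metis imageI)
  qed
  ultimately have smooth: "Ck m S (F \<circ> chart_inv \<tau>)"
    using Ck_subset smooth_on_Ck by blast
  have inj: "inj_on (snd \<tau>) (fst \<tau>)"
  proof (rule inj_onI)
    fix a b assume ab: "a \<in> fst \<tau>" "b \<in> fst \<tau>" "snd \<tau> a = snd \<tau> b"
    then have "fst a = fst b" using inj_onD[OF base.chart_inj[OF c(1)]] by (auto simp: \<tau>_def)
    moreover from this have "snd a = snd b"
      using ab base.tangent_eqI[OF c(1)] by (auto simp: \<tau>_def)
    ultimately show "a = b" by (rule prod_eqI)
  qed
  have "chart_inv \<tau> (snd c x, v) = (x, vec_of A x c v)" for v
    using chart_inv_left[OF inj, of "(x, vec_of A x c v)"] base.vec_of_tangent[OF c] base.vec_of_chart[OF c] c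
    by (simp add: \<tau>_def)
  moreover have "Ck m (- {0}) (\<lambda>v. (F \<circ> chart_inv \<tau>) (snd c x, v))"
  proof (rule Ck_compose[OF open_punctured \<open>open S\<close> _ _ smooth])
    show "Ck m (- {0}) (\<lambda>v. (snd c x, v))"
      by (intro Ck_Pair Ck_const Ck_linear open_punctured bounded_linear_ident)
  qed (use c in \<open>auto simp: S_def\<close>)
  ultimately show ?thesis by (simp add: f_def[abs_def])
qed

lemma fibre_in_bundle: "(x, vec_of A x c v) \<in> tangent_bundle A" "v \<noteq> 0 \<Longrightarrow> (x, vec_of A x c v) \<in> tangent_bundle0 A"
  using c base.vec_of_tangent[OF c] vec_of_nonzero
  by (auto simp: tangent_bundle_def tangent_bundle0_def points_def)

sublocale fn: minkowski_norm f
proof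
  show "smooth_on (- {0}) f" using Ck_f by (simp add: smooth_on_def)
  fix v :: "real ^ 'n" assume v: "v \<noteq> 0"
  show "f v \<ge> 0" using finsler fibre_in_bundle unfolding finsler_structure_def f_def by blast
  show "f (t *\<^sub>R v) = t * f v" if "t > 0" for t
  proof -
    have "vec_of A x c (t *\<^sub>R v) = vec_scale t (vec_of A x c v)"
      using linear_scale[OF base.linear_jacobian[OF c(1) _ c(2)]]
      by (auto simp: vec_of_def vec_scale_def)
    then show ?thesis
      using finsler fibre_in_bundle that unfolding finsler_structure_def f_def by fastforce
  qed
  fix a :: "real ^ 'n" assume "a \<noteq> 0"
  then have "0 < (\<Sum>i\<in>UNIV. \<Sum>j\<in>UNIV. finsler_g A F c x (vec_of A x c v) i j * a $ i * a $ j)"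
    using finsler fibre_in_bundle(2)[OF v] c unfolding finsler_structure_def by fast
  then show "fundamental_form f v a a > 0"
    by (simp add: fundamental_form_def finsler_g_eq base.vec_of_chart[OF c])
qed

text \<open>The condition that characterises the dual Cartan structure says that \<open>k\<close> composed with the Legendre
  map of \<open>f\<close> is \<open>f\<close>.\<close>

sublocale kn: minkowski_norm k
proof (rule fn.legendre_dual[OF card])
  fix v :: "real ^ 'n" assume v: "v \<noteq> 0"
  let ?y = "vec_of A x c v" and ?p = "covec_of A x c (legendre f v)"
  have "?p c $ i = (\<Sum>j\<in>UNIV. finsler_g A F c x ?y i j * ?y c $ j)" for i
    by (simp add: base.vec_of_chart[OF c] base.covec_of_chart[OF c] finsler_g_eq legendre_def)
  then show "k (legendre f v) = f v"
    using cartan c base.vec_of_tangent[OF c] base.covec_of_cotangent[OF c] vec_of_nonzero[OF v]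
    unfolding dual_cartan_structure_def k_def f_def by blast
qed

abbreviation metric :: "(real ^ 'n) \<times> (real ^ 'n) \<Rightarrow> (real ^ 'n) \<times> (real ^ 'n) \<Rightarrow> (real ^ 'n) \<times> (real ^ 'n) \<Rightarrow> real" where
  "metric u a b \<equiv> fundamental_form f (fst u) (fst a) (fst b) + fundamental_form k (snd u) (snd a) (snd b)"

abbreviation fld :: "((real ^ 'n) \<times> (real ^ 'n) \<Rightarrow> (real ^ 'n) \<times> (real ^ 'n)) \<Rightarrow> ('m, 'n) bt_field" where
  "fld \<equiv> coord_field x c"

lemma vert_metric_eq:
  assumes "z \<in> fibre x"
  shows "vert_metric A F K z X Y = metric (fibre_coords c z) (snd (X (bt_chart A c))) (snd (Y (bt_chart A c)))"
  using assms
  by (cases z) (simp add: vert_metric_def fibre_iff chart_at Let_def fibre_coords_def fundamental_form_def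
      finsler_g_eq cartan_g_eq)

lemma metric_linear:
  assumes "u \<in> punctured_pairs"
  shows "linear (metric u a)"
proof -
  have "fst u \<noteq> 0" "snd u \<noteq> 0" using assms by auto
  then have "linear (fundamental_form f (fst u) (fst a))" "linear (fundamental_form k (snd u) (snd a))"
    by (simp_all add: fn.linear_fundamental_form kn.linear_fundamental_form)
  from linear_compose_add[OF linear_compose[OF linear_fst this(1)] linear_compose[OF linear_snd this(2)]]
  show ?thesis by (simp add: o_def)
qed

lemma metric_commute: "u \<in> punctured_pairs \<Longrightarrow> metric u a b = metric u b a"
  using fn.fundamental_form_commute[of "fst u" "fst a"] kn.fundamental_form_commute[of "snd u" "snd a"]
  by (cases u) simp

lemma Ck_fst: "Ck m (- {0}) g \<Longrightarrow> Ck m punctured_pairs (\<lambda>u. g (fst u))"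
  and Ck_snd: "Ck m (- {0}) g \<Longrightarrow> Ck m punctured_pairs (\<lambda>u. g (snd u))"
  for g :: "real ^ 'n \<Rightarrow> 'b::real_normed_vector"
  by (rule Ck_compose[OF open_punctured_pairs open_punctured _ Ck_linear];
      auto intro: bounded_linear_fst bounded_linear_snd)+

lemma Ck_metric:
  assumes "Ck m punctured_pairs \<xi>" "Ck m punctured_pairs \<eta>"
  shows "Ck m punctured_pairs (\<lambda>u. metric u (\<xi> u) (\<eta> u))"
proof -
  have "Ck m punctured_pairs (\<lambda>u. fst (\<xi> u) $ i)" "Ck m punctured_pairs (\<lambda>u. snd (\<xi> u) $ i)"
    if "Ck m punctured_pairs \<xi>" for \<xi> :: "(real ^ 'n) \<times> (real ^ 'n) \<Rightarrow> (real ^ 'n) \<times> (real ^ 'n)" and i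
    using that
    by (auto intro: Ck_vec_nth[OF open_punctured_pairs] Ck_bounded_linear[OF open_punctured_pairs bounded_linear_fst]
       Ck_bounded_linear[OF open_punctured_pairs bounded_linear_snd])
  then show ?thesis
    unfolding fundamental_form_def
    using assms
    by (intro Ck_add Ck_sum Ck_mult Ck_fst[OF fn.Ck_fundamental_tensor] Ck_snd[OF kn.Ck_fundamental_tensor]
        open_punctured_pairs)
qed

lemma frechet_derivative_const_along_line:
  assumes "Ck 1 punctured_pairs h" "u \<in> punctured_pairs" "\<delta> > 0"
    and "\<And>t. \<bar>t\<bar> < \<delta> \<Longrightarrow> h (u + t *\<^sub>R v) = h u"
  shows "frechet_derivative h (at u) v = 0"
  by (rule derivative_eq_along_line[where g = "\<lambda>_. h u",
        OF Ck_Suc_has_derivative[OF assms(1)[unfolded One_nat_def] assms(2)] assms(3,4)]) auto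

end

locale levi_civita_fibre = finsler_fibre A F K x c
  for A :: "('m, real ^ 'n) chart set" and F K x c +
  fixes nabla :: "('m, 'n) bt_field \<Rightarrow> ('m, 'n) bt_field \<Rightarrow> ('m, 'n) bt_field"
  assumes levi_civita: "levi_civita_connection A F K (fibre x) nabla"
begin

text \<open>Write \<open>X\<close> and \<open>E\<close> for the fields with coefficients \<open>\<xi>\<close> and \<open>\<epsilon>\<close>. Differentiating \<open>G(X, E) = 0\<close>
  along \<open>X\<close> gives \<open>G(\<nabla>\<^sub>X X, E) = - G(X, \<nabla>\<^sub>X E)\<close>. As the torsion vanishes,
  \<open>\<nabla>\<^sub>X E = \<nabla>\<^sub>E X + [X, E] = \<nabla>\<^sub>E X + s X\<close>, and \<open>G(X, \<nabla>\<^sub>E X) = 0\<close> because \<open>G(X, X)\<close> is constant to first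
  order along \<open>E\<close>.\<close>

lemma nabla_normal_part:
  assumes z: "z \<in> fibre x" and u: "u = fibre_coords c z"
    and Ck: "\<And>m. Ck m punctured_pairs \<xi>" "\<And>m. Ck m punctured_pairs \<epsilon>"
    and orth: "\<And>u. u \<in> punctured_pairs \<Longrightarrow> metric u (\<xi> u) (\<epsilon> u) = 0"
    and D\<xi>: "frechet_derivative \<xi> (at u) (\<epsilon> u) = 0"
    and D\<epsilon>: "frechet_derivative \<epsilon> (at u) (\<xi> u) = s *\<^sub>R \<xi> u"
    and Dnorm: "frechet_derivative (\<lambda>u. metric u (\<xi> u) (\<xi> u)) (at u) (\<epsilon> u) = 0"
  shows "vert_metric A F K z (nabla (fld \<xi>) (fld \<xi>) z) (fld \<epsilon> z) = - s * metric u (\<xi> u) (\<xi> u)"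
proof -
  let ?\<kappa> = "bt_chart A c" and ?P = "fibre x"
  define N where "N X Y = snd (nabla X Y z ?\<kappa>)" for X Y
  have \<kappa>: "?\<kappa> \<in> bt_atlas A" "z \<in> ?P \<inter> fst ?\<kappa>"
    using c z fibre_subset_chart[OF c] by (auto simp: bt_atlas_def)
  have uQ: "u \<in> punctured_pairs" unfolding u by (rule fibre_coords_nonzero[OF c z])
  have fields: "fld \<xi> \<in> leaf_fields A ?P" "fld \<epsilon> \<in> leaf_fields A ?P"
    using coord_field_leaf_field[OF c] Ck by blast+
  have vm: "vert_metric A F K z (nabla X Y z) (fld \<zeta> z) = metric u (N X Y) (\<zeta> u)"
    "vert_metric A F K z (fld \<zeta> z) (nabla X Y z) = metric u (\<zeta> u) (N X Y)" for X Y \<zeta>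
    by (simp_all add: vert_metric_eq[OF z] coord_field_chart[OF c z] u N_def)
  have compat: "frechet_derivative (\<lambda>u. metric u (\<eta> u) (\<zeta> u)) (at u) (\<theta> u) =
      metric u (N (fld \<theta>) (fld \<eta>)) (\<zeta> u) + metric u (\<eta> u) (N (fld \<theta>) (fld \<zeta>))"
    if "\<theta> \<in> {\<xi>, \<epsilon>}" "\<eta> \<in> {\<xi>, \<epsilon>}" "\<zeta> \<in> {\<xi>, \<epsilon>}" for \<theta> \<eta> \<zeta>
  proof -
    have f: "fld \<theta> \<in> leaf_fields A ?P" "fld \<eta> \<in> leaf_fields A ?P" "fld \<zeta> \<in> leaf_fields A ?P"
      using that fields by auto
    have "Ck 1 punctured_pairs (\<lambda>u. metric u (\<eta> u) (\<zeta> u))"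
      using that Ck[of 1] by (intro Ck_metric) (elim insertE emptyE; simp del: Ck.simps One_nat_def)+
    moreover have "((\<lambda>w. vert_metric A F K w (fld \<eta> w) (fld \<zeta> w)) \<circ> chart_inv (leaf_chart ?P ?\<kappa>)) u =
        metric u (\<eta> u) (\<zeta> u)" if u: "u \<in> punctured_pairs" for u
      using fibre_point_in_fibre[OF c u]
      by (simp add: chart_inv_leaf_chart[OF c u] vert_metric_eq coord_field_chart[OF c] fibre_coords_point[OF c])
    ultimately have "leaf_deriv ?P ?\<kappa> (fld \<theta>) ((\<lambda>w. vert_metric A F K w (fld \<eta> w) (fld \<zeta> w)) \<circ>
        chart_inv (leaf_chart ?P ?\<kappa>)) z = frechet_derivative (\<lambda>u. metric u (\<eta> u) (\<zeta> u)) (at u) (\<theta> u)"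
      unfolding u by (rule leaf_deriv_coord_field[OF c z])
    moreover have "leaf_deriv ?P ?\<kappa> (fld \<theta>) ((\<lambda>w. vert_metric A F K w (fld \<eta> w) (fld \<zeta> w)) \<circ>
        chart_inv (leaf_chart ?P ?\<kappa>)) z =
        vert_metric A F K z (nabla (fld \<theta>) (fld \<eta>) z) (fld \<zeta> z) +
        vert_metric A F K z (fld \<eta> z) (nabla (fld \<theta>) (fld \<zeta>) z)"
      using levi_civita f \<kappa> unfolding levi_civita_connection_def by blast
    ultimately show ?thesis by (simp add: vm)
  qed
  have torsion: "N (fld \<xi>) (fld \<epsilon>) - N (fld \<epsilon>) (fld \<xi>) = s *\<^sub>R \<xi> u"
  proof -
    have "N (fld \<xi>) (fld \<epsilon>) - N (fld \<epsilon>) (fld \<xi>) =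
        leaf_deriv ?P ?\<kappa> (fld \<xi>) (leaf_coeffs ?P ?\<kappa> (fld \<epsilon>)) z -
        leaf_deriv ?P ?\<kappa> (fld \<epsilon>) (leaf_coeffs ?P ?\<kappa> (fld \<xi>)) z"
      using levi_civita fields \<kappa> unfolding levi_civita_connection_def N_def by blast
    also have "\<dots> = frechet_derivative \<epsilon> (at u) (\<xi> u) - frechet_derivative \<xi> (at u) (\<epsilon> u)"
      unfolding u
      by (simp only: leaf_deriv_leaf_coeffs[OF c z Ck(1)] leaf_deriv_leaf_coeffs[OF c z Ck(2)])
    finally show ?thesis using D\<xi> D\<epsilon> by simp
  qed
  have "frechet_derivative (\<lambda>u. metric u (\<xi> u) (\<epsilon> u)) (at u) (\<xi> u) = 0"
  proof -
    have "((\<lambda>u. metric u (\<xi> u) (\<epsilon> u)) has_derivative (\<lambda>_. 0)) (at u)"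
      by (rule has_derivative_transform_within_open[OF has_derivative_const open_punctured_pairs uQ])
        (simp add: orth)
    from frechet_derivative_at[OF this, symmetric] show ?thesis by simp
  qed
  then have "metric u (N (fld \<xi>) (fld \<xi>)) (\<epsilon> u) = - metric u (\<xi> u) (N (fld \<xi>) (fld \<epsilon>))"
    using compat[of \<xi> \<xi> \<epsilon>] by simp
  also have "N (fld \<xi>) (fld \<epsilon>) = N (fld \<epsilon>) (fld \<xi>) + s *\<^sub>R \<xi> u" using torsion by (simp add: algebra_simps)
  also have "metric u (\<xi> u) \<dots> = metric u (\<xi> u) (N (fld \<epsilon>) (fld \<xi>)) + s * metric u (\<xi> u) (\<xi> u)"
    by (simp only: linear_add[OF metric_linear[OF uQ]] linear_scale[OF metric_linear[OF uQ]] real_scaleR_def)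
  also have "metric u (\<xi> u) (N (fld \<epsilon>) (fld \<xi>)) = 0"
  proof -
    have "metric u (N (fld \<epsilon>) (fld \<xi>)) (\<xi> u) + metric u (\<xi> u) (N (fld \<epsilon>) (fld \<xi>)) = 0"
      using compat[of \<epsilon> \<xi> \<xi>] Dnorm by simp
    moreover have "metric u (N (fld \<epsilon>) (fld \<xi>)) (\<xi> u) = metric u (\<xi> u) (N (fld \<epsilon>) (fld \<xi>))"
      by (rule metric_commute[OF uQ])
    ultimately show ?thesis by linarith
  qed
  finally show ?thesis unfolding vm(1) by simp
qed

end


section \<open>The second fundamental form\<close>

context finsler_fibre
begin

abbreviation radial1 :: "(real ^ 'n) \<times> (real ^ 'n) \<Rightarrow> (real ^ 'n) \<times> (real ^ 'n)" where
  "radial1 u \<equiv> (fst u, 0)"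

abbreviation radial2 :: "(real ^ 'n) \<times> (real ^ 'n) \<Rightarrow> (real ^ 'n) \<times> (real ^ 'n)" where
  "radial2 u \<equiv> (0, snd u)"

text \<open>The test fields, one family in each of the two factors.\<close>

definition tangential1 :: "real ^ 'n \<Rightarrow> (real ^ 'n) \<times> (real ^ 'n) \<Rightarrow> (real ^ 'n) \<times> (real ^ 'n)" where
  "tangential1 a u = (fn.radial_complement a (fst u), 0)"

definition tangential2 :: "real ^ 'n \<Rightarrow> (real ^ 'n) \<times> (real ^ 'n) \<Rightarrow> (real ^ 'n) \<times> (real ^ 'n)" where
  "tangential2 a u = (0, kn.radial_complement a (snd u))"

lemma Ck_radial:
  "Ck m punctured_pairs radial1" "Ck m punctured_pairs radial2"
  by (intro Ck_Pair Ck_const Ck_linear bounded_linear_fst bounded_linear_snd open_punctured_pairs)+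

lemma Ck_tangential:
  "Ck m punctured_pairs (tangential1 a)" "Ck m punctured_pairs (tangential2 a)"
  unfolding tangential1_def[abs_def] tangential2_def[abs_def]
  by (intro Ck_Pair Ck_const Ck_fst[OF fn.Ck_radial_complement] Ck_snd[OF kn.Ck_radial_complement]
      open_punctured_pairs)+

lemma tangential_orthogonal:
  assumes "u \<in> punctured_pairs"
  shows "metric u (tangential1 a u) (radial1 u) = 0" "metric u (tangential1 a u) (radial2 u) = 0"
    "metric u (tangential2 a u) (radial1 u) = 0" "metric u (tangential2 a u) (radial2 u) = 0"
proof -
  have "fst u \<noteq> 0" "snd u \<noteq> 0" using assms by auto
  then show "metric u (tangential1 a u) (radial1 u) = 0" "metric u (tangential1 a u) (radial2 u) = 0"
    "metric u (tangential2 a u) (radial1 u) = 0" "metric u (tangential2 a u) (radial2 u) = 0"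
    using fn.radial_complement_orthogonal kn.radial_complement_orthogonal
    by (simp_all add: tangential1_def tangential2_def fundamental_form_def)
qed

text \<open>Moving along a Liouville field rescales one coordinate. The test fields and their lengths are
  homogeneous of degree 0 in one coordinate and independent of the other.\<close>

lemma tangential_scale:
  assumes "fst u \<noteq> 0" "snd u \<noteq> 0" "\<bar>t\<bar> < 1" "r \<in> {radial1, radial2}" "\<xi> \<in> {tangential1 a, tangential2 a}"
  shows "\<xi> (u + t *\<^sub>R r u) = \<xi> u"
    and "metric (u + t *\<^sub>R r u) (\<xi> (u + t *\<^sub>R r u)) (\<xi> (u + t *\<^sub>R r u)) = metric u (\<xi> u) (\<xi> u)"
proof -
  have t: "0 < 1 + t" using assms by auto
  have e: "v + t *\<^sub>R v = (1 + t) *\<^sub>R v" for v :: "real ^ 'n" by (simp add: scaleR_add_left)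
  have zero: "fundamental_form g v 0 0 = 0" for g :: "real ^ 'n \<Rightarrow> real" and v by (simp add: fundamental_form_def)
  show "\<xi> (u + t *\<^sub>R r u) = \<xi> u"
    and "metric (u + t *\<^sub>R r u) (\<xi> (u + t *\<^sub>R r u)) (\<xi> (u + t *\<^sub>R r u)) = metric u (\<xi> u) (\<xi> u)"
    using assms(4,5) fn.radial_complement_scale[OF assms(1) t] kn.radial_complement_scale[OF assms(2) t]
      fn.fundamental_form_scale[OF assms(1) t] kn.fundamental_form_scale[OF assms(2) t]
    by (auto simp: tangential1_def tangential2_def e zero)
qed

lemma tangential_derivative:
  assumes u: "u \<in> punctured_pairs" and r: "r \<in> {radial1, radial2}" and \<xi>: "\<xi> \<in> {tangential1 a, tangential2 a}"
  shows "frechet_derivative \<xi> (at u) (r u) = 0"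
    and "frechet_derivative (\<lambda>u. metric u (\<xi> u) (\<xi> u)) (at u) (r u) = 0"
proof -
  have nz: "fst u \<noteq> 0" "snd u \<noteq> 0" using u by auto
  have Ck: "Ck 1 punctured_pairs \<xi>" using \<xi> Ck_tangential by blast
  show "frechet_derivative \<xi> (at u) (r u) = 0"
    by (rule frechet_derivative_const_along_line[OF Ck u zero_less_one tangential_scale(1)[OF nz _ r \<xi>]])
  show "frechet_derivative (\<lambda>u. metric u (\<xi> u) (\<xi> u)) (at u) (r u) = 0"
    by (rule frechet_derivative_const_along_line[OF Ck_metric[OF Ck Ck] u zero_less_one
          tangential_scale(2)[OF nz _ r \<xi>]])
qed

lemma radial_derivative:
  "frechet_derivative radial1 (at u) v = radial1 v" "frechet_derivative radial2 (at u) v = radial2 v"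
proof -
  have "bounded_linear radial1" "bounded_linear radial2"
    by (intro bounded_linear_Pair bounded_linear_fst bounded_linear_snd bounded_linear_zero)+
  then show "frechet_derivative radial1 (at u) v = radial1 v" "frechet_derivative radial2 (at u) v = radial2 v"
    using frechet_derivative_at[OF bounded_linear_imp_has_derivative] by metis+
qed

lemma zero_field:
  assumes "z \<in> fibre x"
  shows "fld (\<lambda>_. 0) z = vec_zero"
proof
  note 0 = base.vec_of_zero[OF c] base.covec_of_zero[OF c]
  fix \<kappa>
  have "snd (snd \<kappa> (x, vec_zero, vec_zero)) = 0" if "\<kappa> \<in> bt_atlas A"
    using that by (auto simp: bt_atlas_def bt_chart_def vec_zero_def prod_eq_iff)
  then show "fld (\<lambda>_. 0) z \<kappa> = vec_zero \<kappa>"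
    using assms by (auto simp: coord_field_def vertical_lift_def 0 fibre_def vec_zero_def prod_eq_iff)
qed

lemma coord_field_vert1:
  assumes z: "z \<in> fibre x" and \<xi>: "snd (\<xi> (fibre_coords c z)) = 0"
  shows "fld \<xi> z \<in> vert1 A z"
proof -
  have "snd (snd (fld \<xi> z \<kappa>)) = 0" if "\<kappa> \<in> bt_atlas A" for \<kappa>
    using that \<xi> base.covec_of_zero[OF c]
    by (auto simp: coord_field_def vertical_lift_def bt_atlas_def bt_chart_def vec_zero_def)
  then show ?thesis using coord_field_vert[OF c z] by (simp add: vert1_def)
qed

lemma coord_field_vert2:
  assumes z: "z \<in> fibre x" and \<xi>: "fst (\<xi> (fibre_coords c z)) = 0"
  shows "fld \<xi> z \<in> vert2 A z"
proof -
  have "fst (snd (fld \<xi> z \<kappa>)) = 0" if "\<kappa> \<in> bt_atlas A" for \<kappa>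
    using that \<xi> base.vec_of_zero[OF c]
    by (auto simp: coord_field_def vertical_lift_def bt_atlas_def bt_chart_def vec_zero_def)
  then show ?thesis using coord_field_vert[OF c z] by (simp add: vert2_def)
qed

lemma tangential_in_vert_E1_E2:
  assumes z: "z \<in> fibre x" and \<xi>: "\<xi> \<in> {tangential1 a, tangential2 a}"
  shows "fld \<xi> z \<in> vert_E1_E2 A F K z"
proof -
  let ?u = "fibre_coords c z"
  have u: "?u \<in> punctured_pairs" by (rule fibre_coords_nonzero[OF c z])
  have vm: "vert_metric A F K z (fld \<eta> z) (liouville1 A z) = metric ?u (\<eta> ?u) (radial1 ?u)"
    "vert_metric A F K z (fld \<eta> z) (liouville2 A z) = metric ?u (\<eta> ?u) (radial2 ?u)" for \<eta>
    by (simp_all add: vert_metric_eq[OF z] liouville_coord_field[OF c z] coord_field_chart[OF c z])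
  have zero: "fld (\<lambda>_. 0) z \<in> vert_E1 A F K z" "fld (\<lambda>_. 0) z \<in> vert_E2 A F K z"
    using coord_field_vert1[OF z, of "\<lambda>_. 0"] coord_field_vert2[OF z, of "\<lambda>_. 0"]
    by (simp_all add: vert_E1_def vert_E2_def vm fundamental_form_def)
  have add: "vec_add (fld \<xi> z) (fld (\<lambda>_. 0) z) = fld \<xi> z" "vec_add (fld (\<lambda>_. 0) z) (fld \<xi> z) = fld \<xi> z"
    by (simp_all add: zero_field[OF z] vec_add_def vec_zero_def)
  from \<xi> consider "\<xi> = tangential1 a" | "\<xi> = tangential2 a" by blast
  then show ?thesis
  proof cases
    case 1
    have "fld \<xi> z \<in> vert_E1 A F K z"
      using coord_field_vert1[OF z, of \<xi>] tangential_orthogonal(1)[OF u]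
      by (simp add: vert_E1_def vm 1 tangential1_def)
    then show ?thesis using zero(2) add(1) unfolding vert_E1_E2_def by force
  next
    case 2
    have "fld \<xi> z \<in> vert_E2 A F K z"
      using coord_field_vert2[OF z, of \<xi>] tangential_orthogonal(4)[OF u]
      by (simp add: vert_E2_def vm 2 tangential2_def)
    then show ?thesis using zero(1) add(2) unfolding vert_E1_E2_def by force
  qed
qed

lemma tangential_tangent_field:
  assumes "L' \<subseteq> fibre x" "\<xi> \<in> {tangential1 a, tangential2 a}"
  shows "fld \<xi> \<in> tangent_fields A F K (fibre x) L'"
proof -
  have "fld \<xi> \<in> leaf_fields A (fibre x)"
    using assms(2) by (intro coord_field_leaf_field[OF c]) (use Ck_tangential in blast)
  then show ?thesis
    unfolding tangent_fields_def using tangential_in_vert_E1_E2[OF _ assms(2)] assms(1) by blast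
qed

end

context levi_civita_fibre
begin

lemma second_fundamental_form_eq:
  assumes z: "z \<in> fibre x" and u: "fibre_coords c z = (v, q)"
  shows "second_fundamental_form A F K nabla X Y z =
    ((k q)\<^sup>2 * vert_metric A F K z (nabla X Y z) (fld radial1 z) -
     (f v)\<^sup>2 * vert_metric A F K z (nabla X Y z) (fld radial2 z)) / (f v * k q * sqrt ((f v)\<^sup>2 + (k q)\<^sup>2))"
proof -
  obtain y p where zyp: "z = (x, y, p)" using z by (cases z) (auto simp: fibre_iff)
  have vq: "y c = v" "p c = q" using u by (auto simp: fibre_coords_def zyp)
  have uQ: "(v, q) \<in> punctured_pairs" using fibre_coords_nonzero[OF c z] u by simp
  have FK: "F (x, y) = f v" "K (x, p) = k q"
    using base.tangent_eq_vec_of[OF c, of y] base.cotangent_eq_covec_of[OF c, of p] z vq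
    by (auto simp: zyp fibre_iff f_def k_def)
  define M where "M = snd (nabla X Y z (bt_chart A c))"
  define r where "r = 1 / (f v * k q * sqrt ((f v)\<^sup>2 + (k q)\<^sup>2))"
  have "snd (unit_normal A F K z (bt_chart A c)) = r *\<^sub>R ((k q)\<^sup>2 *\<^sub>R (v, 0) + (- (f v)\<^sup>2) *\<^sub>R (0, q))"
    using liouville_coord_field[OF c z] coord_field_chart[OF c z]
    by (simp add: unit_normal_def Let_def zyp FK vec_scale_def vec_add_def r_def u[unfolded zyp])
  then have "second_fundamental_form A F K nabla X Y z =
      metric (v, q) M (r *\<^sub>R ((k q)\<^sup>2 *\<^sub>R (v, 0) + (- (f v)\<^sup>2) *\<^sub>R (0, q)))"
    by (simp only: second_fundamental_form_def vert_metric_eq[OF z] u M_def)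
  also have "\<dots> = r * ((k q)\<^sup>2 * metric (v, q) M (v, 0) + (- (f v)\<^sup>2) * metric (v, q) M (0, q))"
    by (simp only: linear_scale[OF metric_linear[OF uQ]] linear_add[OF metric_linear[OF uQ]] real_scaleR_def)
  also have "metric (v, q) M (v, 0) = vert_metric A F K z (nabla X Y z) (fld radial1 z)"
    by (simp only: vert_metric_eq[OF z] u coord_field_chart[OF c z] fst_conv snd_conv M_def)
  also have "metric (v, q) M (0, q) = vert_metric A F K z (nabla X Y z) (fld radial2 z)"
    by (simp only: vert_metric_eq[OF z] u coord_field_chart[OF c z] fst_conv snd_conv M_def)
  finally show ?thesis by (simp add: r_def)
qed

text \<open>A Liouville field has a nonzero bracket only with the test fields of its own factor, so exactly one
  of the two terms of the normal contributes. The two terms of the normal have opposite signs.\<close>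

lemma second_fundamental_form_tangential:
  assumes z: "z \<in> fibre x" and u: "fibre_coords c z = (v, q)"
  defines "\<alpha> \<equiv> 1 / (f v * k q * sqrt ((f v)\<^sup>2 + (k q)\<^sup>2))"
  shows "second_fundamental_form A F K nabla (fld (tangential1 a)) (fld (tangential1 a)) z =
      - \<alpha> * (k q)\<^sup>2 * vert_metric A F K z (fld (tangential1 a) z) (fld (tangential1 a) z)"
    and "second_fundamental_form A F K nabla (fld (tangential2 a)) (fld (tangential2 a)) z =
      \<alpha> * (f v)\<^sup>2 * vert_metric A F K z (fld (tangential2 a) z) (fld (tangential2 a) z)"
proof -
  have uQ: "(v, q) \<in> punctured_pairs" using fibre_coords_nonzero[OF c z] u by simp
  have vm: "vert_metric A F K z (fld \<xi> z) (fld \<xi> z) = metric (v, q) (\<xi> (v, q)) (\<xi> (v, q))" for \<xi>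
    by (simp add: vert_metric_eq[OF z] coord_field_chart[OF c z] u)
  have N: "vert_metric A F K z (nabla (fld \<xi>) (fld \<xi>) z) (fld r z) = - s * metric (v, q) (\<xi> (v, q)) (\<xi> (v, q))"
    if "\<xi> \<in> {tangential1 a, tangential2 a}" "r \<in> {radial1, radial2}"
      "frechet_derivative r (at (v, q)) (\<xi> (v, q)) = s *\<^sub>R \<xi> (v, q)" for \<xi> r s
  proof (rule nabla_normal_part[OF z u[symmetric]])
    show "Ck m punctured_pairs \<xi>" for m using that(1) Ck_tangential by blast
    show "Ck m punctured_pairs r" for m using that(2) Ck_radial by blast
    show "metric u (\<xi> u) (r u) = 0" if "u \<in> punctured_pairs" for u
      using \<open>\<xi> \<in> _\<close> \<open>r \<in> _\<close> tangential_orthogonal[OF that] by (elim insertE emptyE) simp_all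
    show "frechet_derivative \<xi> (at (v, q)) (r (v, q)) = 0"
      "frechet_derivative (\<lambda>u. metric u (\<xi> u) (\<xi> u)) (at (v, q)) (r (v, q)) = 0"
      by (rule tangential_derivative[OF uQ that(2,1)])+
    show "frechet_derivative r (at (v, q)) (\<xi> (v, q)) = s *\<^sub>R \<xi> (v, q)" by (rule that(3))
  qed
  have D: "frechet_derivative radial1 (at (v, q)) (tangential1 a (v, q)) = 1 *\<^sub>R tangential1 a (v, q)"
    "frechet_derivative radial2 (at (v, q)) (tangential1 a (v, q)) = 0 *\<^sub>R tangential1 a (v, q)"
    "frechet_derivative radial1 (at (v, q)) (tangential2 a (v, q)) = 0 *\<^sub>R tangential2 a (v, q)"
    "frechet_derivative radial2 (at (v, q)) (tangential2 a (v, q)) = 1 *\<^sub>R tangential2 a (v, q)"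
    by (simp_all only: radial_derivative) (simp_all add: tangential1_def tangential2_def zero_prod_def)
  show "second_fundamental_form A F K nabla (fld (tangential1 a)) (fld (tangential1 a)) z =
      - \<alpha> * (k q)\<^sup>2 * vert_metric A F K z (fld (tangential1 a) z) (fld (tangential1 a) z)"
  proof -
    define G where "G = metric (v, q) (tangential1 a (v, q)) (tangential1 a (v, q))"
    have "vert_metric A F K z (nabla (fld (tangential1 a)) (fld (tangential1 a)) z) (fld radial1 z) = - 1 * G"
      "vert_metric A F K z (nabla (fld (tangential1 a)) (fld (tangential1 a)) z) (fld radial2 z) = - 0 * G"
      unfolding G_def by (rule N; (rule D | blast))+
    moreover have "vert_metric A F K z (fld (tangential1 a) z) (fld (tangential1 a) z) = G"
      by (simp only: vm G_def)
    ultimately show ?thesis by (simp add: second_fundamental_form_eq[OF z u] \<alpha>_def)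
  qed
  show "second_fundamental_form A F K nabla (fld (tangential2 a)) (fld (tangential2 a)) z =
      \<alpha> * (f v)\<^sup>2 * vert_metric A F K z (fld (tangential2 a) z) (fld (tangential2 a) z)"
  proof -
    define G where "G = metric (v, q) (tangential2 a (v, q)) (tangential2 a (v, q))"
    have "vert_metric A F K z (nabla (fld (tangential2 a)) (fld (tangential2 a)) z) (fld radial1 z) = - 0 * G"
      "vert_metric A F K z (nabla (fld (tangential2 a)) (fld (tangential2 a)) z) (fld radial2 z) = - 1 * G"
      unfolding G_def by (rule N; (rule D | blast))+
    moreover have "vert_metric A F K z (fld (tangential2 a) z) (fld (tangential2 a) z) = G"
      by (simp only: vm G_def)
    ultimately show ?thesis by (simp add: second_fundamental_form_eq[OF z u] \<alpha>_def)
  qed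
qed

theorem not_umbilical:
  assumes L': "L' \<subseteq> fibre x" "z \<in> L'"
  shows "\<not> totally_umbilical A F K nabla (fibre x) L'"
proof
  assume "totally_umbilical A F K nabla (fibre x) L'"
  then obtain lam where lam: "\<And>X. X \<in> tangent_fields A F K (fibre x) L' \<Longrightarrow>
      second_fundamental_form A F K nabla X X z = lam z * vert_metric A F K z (X z) (X z)"
    unfolding totally_umbilical_def using L'(2) by blast
  have z: "z \<in> fibre x" using L' by blast
  obtain v q where u: "fibre_coords c z = (v, q)" by (cases "fibre_coords c z")
  then have nz: "v \<noteq> 0" "q \<noteq> 0" using fibre_coords_nonzero[OF c z] by auto
  \<comment> \<open>In dimension at least 2 a line does not fill the space, so some test field is nonzero at \<open>z\<close>.\<close>
  have "\<exists>a. a \<notin> span {w}" for w :: "real ^ 'n"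
  proof (rule ccontr)
    assume "\<nexists>a. a \<notin> span {w}"
    then have "span {w} = UNIV" by blast
    then have "dim {w} = CARD('n)" using dim_span[of "{w}"] by simp
    then show False using card by (simp split: if_splits)
  qed
  then obtain a b where ab: "a \<notin> span {v}" "b \<notin> span {q}" by meson
  define g1 g2 where "g1 = vert_metric A F K z (fld (tangential1 a) z) (fld (tangential1 a) z)"
    and "g2 = vert_metric A F K z (fld (tangential2 b) z) (fld (tangential2 b) z)"
  define \<alpha> where "\<alpha> = 1 / (f v * k q * sqrt ((f v)\<^sup>2 + (k q)\<^sup>2))"
  have "g1 > 0" "g2 > 0"
    using fn.fundamental_form_pos[OF nz(1) fn.radial_complement_nonzero[OF ab(1)]]
      kn.fundamental_form_pos[OF nz(2) kn.radial_complement_nonzero[OF ab(2)]]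
    by (simp_all add: g1_def g2_def vert_metric_eq[OF z] coord_field_chart[OF c z] u
        tangential1_def tangential2_def) (simp_all add: fundamental_form_def)
  moreover have "lam z * g1 = - \<alpha> * (k q)\<^sup>2 * g1"
    unfolding g1_def \<alpha>_def second_fundamental_form_tangential(1)[OF z u, symmetric]
    by (rule lam[symmetric], rule tangential_tangent_field[OF L'(1)]) blast
  moreover have "lam z * g2 = \<alpha> * (f v)\<^sup>2 * g2"
    unfolding g2_def \<alpha>_def second_fundamental_form_tangential(2)[OF z u, symmetric]
    by (rule lam[symmetric], rule tangential_tangent_field[OF L'(1)]) blast
  ultimately have "- \<alpha> * (k q)\<^sup>2 = \<alpha> * (f v)\<^sup>2" by (metis mult_cancel_right less_irrefl)
  moreover have "\<alpha> > 0" "(k q)\<^sup>2 > 0" "(f v)\<^sup>2 > 0"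
    using fn.f_pos[OF nz(1)] kn.f_pos[OF nz(2)] by (simp_all add: \<alpha>_def add_pos_pos)
  ultimately show False
    by (metis add.inverse_neutral mult_minus_left mult_pos_pos neg_less_0_iff_less not_less_iff_gr_or_eq)
qed

end

theorem theorem2p4:
  fixes A :: "('m, real ^ 'n) chart set"
    and F K :: "'m \<times> ('m, real ^ 'n) tvec \<Rightarrow> real"
    and L' L P :: "('m, 'n) bt_point set"
    and nabla :: "('m, 'n) bt_field \<Rightarrow> ('m, 'n) bt_field \<Rightarrow> ('m, 'n) bt_field"
  assumes "smooth_manifold A"
    and "CARD('n) \<ge> 2"
    and "finsler_structure A F"
    and "dual_cartan_structure A F K"
    and "leaf_of (bt_atlas A) (vert_E1_E2 A F K) L'"
    and "leaf_of (bt_atlas A) (vert_E A F K) L"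
    and "leaf_of (bt_atlas A) (vert A) P"
    and "L' \<subseteq> L" and "L \<subseteq> P"
    and "levi_civita_connection A F K P nabla"
  shows "\<not> totally_umbilical A F K nabla P L'"
proof -
  have "smooth_atlas A" using assms(1) by (simp add: smooth_manifold_def)
  then obtain x where bt: "big_tangent A" and x: "x \<in> points A" and P: "P = big_tangent.fibre A x"
    using vert_leaf[OF _ assms(2,7)] by blast
  interpret big_tangent A by (rule bt)
  have "\<exists>c. c \<in> A \<and> x \<in> fst c" using x by (auto simp: points_def)
  then have c: "chart_at A x \<in> A" "x \<in> fst (chart_at A x)"
    unfolding chart_at_def by (metis (mono_tags, lifting) someI_ex)+
  interpret levi_civita_fibre A F K x "chart_at A x" nabla
    by unfold_locales (use assms c P in auto)
  obtain z where "z \<in> L'" using assms(5) unfolding leaf_of_def by blast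
  then show ?thesis using not_umbilical[of L' z] assms(8,9) P by blast
qed

end
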